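(* Suppose $n$ is an odd integer with $t_1+t_3\leq n<t_2$, and put $K=k_1+k_2+k_3$, $N=\tfrac{n+1}{2}$. Then: (i) the $\mathfrak{BI}$-module $\mathscr M_n(x_1)\cap\mathscr M_n(x_3)$ is isomorphic to $W_1\oplus W_1$, where $W_1=E_{n-t_1-t_3}(k_1+k_2+N,\,-k_2-k_3-N,\,N)^{((-1,-1),(2\,3))}$; (ii) the $\mathfrak{BI}$-modules $\mathscr M_n(x_1)/(\mathscr M_n(x_1)\cap\mathscr M_n(x_3))$ and $\mathscr M_n/\mathscr M_n(x_3)$ are each isomorphic to $W_2\oplus W_2$, where $W_2=O_{t_3-1}(k_2,\,-K-n-1,\,k_1)^{(2\,3)}$; (iii) the $\mathfrak{BI}$-modules $\mathscr M_n(x_3)/(\mathscr M_n(x_1)\cap\mathscr M_n(x_3))$ and $\mathscr M_n/\mathscr M_n(x_1)$ are each isomorphic to $W_3\oplus W_3$, where $W_3=O_{t_1-1}(k_2,\,-K-n-1,\,k_3)^{(1\,2\,3)}$. Moreover, if $k_2\geq0$, then $W_1,W_2,W_3$ are irreducible and are isomorphic to $E_{n-t_1-t_3}(k_1+k_2+N,\,N,\,k_2+k_3+N)^{(-1,1)}$, $O_{t_3-1}(k_2,\,k_1,\,-K-n-1)$ and $O_{t_1-1}(-K-n-1,\,k_3,\,k_2)$, respectively.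
   Context: Fix real numbers $k_1,k_2,k_3$. For $i=1,2,3$ let $R_i$ be the operator on functions on $\mathbb R^3$ replacing $x_i$ by $-x_i$, and $T_if=\frac{\partial f}{\partial x_i}+k_i\frac{f-R_if}{x_i}$ (Dunkl operators). Let $\sigma_1=\begin{pmatrix}0&1\\1&0\end{pmatrix}$, $\sigma_2=\begin{pmatrix}0&-\sqrt{-1}\\ \sqrt{-1}&0\end{pmatrix}$, $\sigma_3=\begin{pmatrix}1&0\\0&-1\end{pmatrix}$, and let $e_i$ act on $\mathbb C^2$ by $\sigma_i$. Tensor products are over $\mathbb R$; $\mathbb R[\cdots]_m$ denotes homogeneous polynomials of degree $m$. Let $\mathbf D=e_1\otimes T_1+e_2\otimes T_2+e_3\otimes T_3$ and $\mathscr M_n=\ker(\mathbf D|_{\mathbb C^2\otimes\mathbb R[x_1,x_2,x_3]_n})$. For $i=1,2,3$ set $t_i=-2k_i$ if $2k_i$ is an odd negative integer, and $t_i=\infty$ otherwise. For $i=1,2,3$, $\mathscr M_n(x_i)=\mathscr M_n\cap\bigoplus_{j=t_i}^n\mathbb C^2\otimes(x_i^j\cdot\mathbb R[x_p,x_q]_{n-j})$ where $\{p,q\}=\{1,2,3\}\setminus\{i\}$ (it is $\{0\}$ if $n<t_i$); it is a $\mathfrak{BI}$-submodule of $\mathscr M_n$. $\mathfrak{BI}$ is the unital associative $\mathbb C$-algebra generated by $X,Y,Z$ with relations saying that $\{X,Y\}-Z$, $\{Y,Z\}-X$, $\{Z,X\}-Y$ commute with $X,Y,Z$ ($\{A,B\}=AB+BA$).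 $\mathscr M_n$ is a $\mathfrak{BI}$-module via $X=(\sqrt{-1}\,e_1\otimes(x_3T_2-x_2T_3)+\tfrac12)R_2R_3+k_2R_3+k_3R_2$, $Y=(\sqrt{-1}\,e_2\otimes(x_1T_3-x_3T_1)+\tfrac12)R_1R_3+k_3R_1+k_1R_3$, $Z=(\sqrt{-1}\,e_3\otimes(x_2T_1-x_1T_2)+\tfrac12)R_1R_2+k_1R_2+k_2R_1$, operators composed right to left, $R_i$ acting on the polynomial factor. Twisting: for a $\mathfrak{BI}$-module $V$ and algebra automorphism $\varepsilon$, $V^\varepsilon$ is $V$ with action $x\cdot v=\varepsilon(x)v$. Write $(W_1,W_2,W_3)=(X,Y,Z)$ for the generators. A permutation $\sigma\in\mathfrak S_3$ denotes the automorphism sending the generator with index $i$ to the generator with index $\sigma(i)$; the sign automorphisms are $(1,-1)\colon X\mapsto X,Y\mapsto -Y,Z\mapsto -Z$; $(-1,1)\colon X\mapsto -X,Y\mapsto Y,Z\mapsto -Z$; $(-1,-1)\colon X\mapsto -X,Y\mapsto -Y,Z\mapsto Z$; a pair $(\epsilon,\sigma)$ denotes the composite $\epsilon\circ\sigma$. For $a,b,c\in\mathbb C$ and an integer $d\geq0$, let $\theta_i=\frac{(-1)^i(2a-d+2i)}{2}$, $\theta^*_i=\frac{(-1)^i(2b-d+2i)}{2}$ ($0\le i\le d$). For odd $d$, $E_d(a,b,c)$ is the $\mathfrak{BI}$-module $\mathbb C^{d+1}$ in which, w.r.t. a basis $v_0,\dots,v_d$, $X$ acts by the lower bidiagonal matrix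 with diagonal $(\theta_i)$ and subdiagonal entries $1$, $Y$ by the upper bidiagonal matrix with diagonal $(\theta^*_i)$ and superdiagonal $(\varphi_1,\dots,\varphi_d)$ with $\varphi_i=i(d-i+1)$ ($i$ even), $\varphi_i=c^2-\frac{(2a+2b-d+2i-1)^2}{4}$ ($i$ odd), and $Z=\{X,Y\}-\big(c^2-a^2-b^2+\frac{(d+1)^2}{4}\big)$. For even $d$, $O_d(a,b,c)$ is defined in the same way but with $\varphi_i=\frac{i(d+1-2i-2a-2b-2c)}{2}$ ($i$ even), $\varphi_i=\frac{(i-d-1)(d+1-2i-2a-2b+2c)}{2}$ ($i$ odd), and $Z=\{X,Y\}-(2ab-c(d+1))$. *)

theory Defs
  imports Complex_Main "HOL-Library.Extended_Nat"
begin

text \<open>A monomial x1^a x2^b x3^c is encoded by its exponent triple (a,b,c).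
  An element of C^2 (tensor over R) R[x1,x2,x3] is encoded by its coefficient function
  on (component, monomial); component False is the first coordinate of C^2, True the second.\<close>

type_synonym mono = "nat \<times> nat \<times> nat"
type_synonym sp = "bool \<times> mono \<Rightarrow> complex"

definition mexp :: "nat \<Rightarrow> mono \<Rightarrow> nat" where
  "mexp i m = (case m of (a,b,c) \<Rightarrow> if i = 1 then a else if i = 2 then b else c)"

definition mdeg :: "mono \<Rightarrow> nat" where
  "mdeg m = (case m of (a,b,c) \<Rightarrow> a + b + c)"

definition bump :: "nat \<Rightarrow> mono \<Rightarrow> mono" where
  "bump i m = (case m of (a,b,c) \<Rightarrow>
     if i = 1 then (a+1,b,c) else if i = 2 then (a,b+1,c) else (a,b,c+1))"

definition unbump :: "nat \<Rightarrow> mono \<Rightarrow> mono" where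
  "unbump i m = (case m of (a,b,c) \<Rightarrow>
     if i = 1 then (a-1,b,c) else if i = 2 then (a,b-1,c) else (a,b,c-1))"

definition hom :: "nat \<Rightarrow> sp set" where
  "hom n = {f. \<forall>s m. f (s,m) \<noteq> 0 \<longrightarrow> mdeg m = n}"

definition refl :: "nat \<Rightarrow> sp \<Rightarrow> sp" where
  "refl i f = (\<lambda>(s,m). (-1) ^ mexp i m * f (s,m))"

definition pder :: "nat \<Rightarrow> sp \<Rightarrow> sp" where
  "pder i f = (\<lambda>(s,m). of_nat (mexp i m + 1) * f (s, bump i m))"

text \<open>division by x_i (for polynomials divisible by x_i)\<close>
definition divx :: "nat \<Rightarrow> sp \<Rightarrow> sp" where
  "divx i g = (\<lambda>(s,m). g (s, bump i m))"

definition mulx :: "nat \<Rightarrow> sp \<Rightarrow> sp" where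
  "mulx i f = (\<lambda>(s,m). if mexp i m = 0 then 0 else f (s, unbump i m))"

definition dunkl :: "(nat \<Rightarrow> real) \<Rightarrow> nat \<Rightarrow> sp \<Rightarrow> sp" where
  "dunkl k i f = (\<lambda>p. pder i f p + of_real (k i) * divx i (\<lambda>q. f q - refl i f q) p)"

definition pauli :: "nat \<Rightarrow> sp \<Rightarrow> sp" where
  "pauli i f = (\<lambda>(s,m).
     if i = 1 then f (\<not> s, m)
     else if i = 2 then (if s then \<i> * f (False, m) else - \<i> * f (True, m))
     else (if s then - f (True, m) else f (False, m)))"

definition kf :: "real \<Rightarrow> real \<Rightarrow> real \<Rightarrow> nat \<Rightarrow> real" where
  "kf k1 k2 k3 = (\<lambda>i. if i = 1 then k1 else if i = 2 then k2 else k3)"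

definition dirac :: "(nat \<Rightarrow> real) \<Rightarrow> sp \<Rightarrow> sp" where
  "dirac k f = (\<lambda>p. pauli 1 (dunkl k 1 f) p + pauli 2 (dunkl k 2 f) p + pauli 3 (dunkl k 3 f) p)"

definition Mn :: "(nat \<Rightarrow> real) \<Rightarrow> nat \<Rightarrow> sp set" where
  "Mn k n = {f \<in> hom n. dirac k f = (\<lambda>_. 0)}"

definition tval :: "real \<Rightarrow> enat" where
  "tval c = (if \<exists>m::nat. odd m \<and> 2 * c = - real m then enat (nat \<lfloor>- 2 * c\<rfloor>) else \<infinity>)"

definition Mx :: "(nat \<Rightarrow> real) \<Rightarrow> nat \<Rightarrow> nat \<Rightarrow> sp set" where
  "Mx k i n = {f \<in> Mn k n. \<forall>s m. enat (mexp i m) < tval (k i) \<longrightarrow> f (s,m) = 0}"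

definition gen :: "(nat \<Rightarrow> real) \<Rightarrow> nat \<Rightarrow> nat \<Rightarrow> nat \<Rightarrow> sp \<Rightarrow> sp" where
  "gen k a b c f = (let g = refl b (refl c f) in
     (\<lambda>p. \<i> * pauli a (\<lambda>q. mulx b (dunkl k c g) q - mulx c (dunkl k b g) q) p
          + g p / 2 + of_real (k c) * refl b f p + of_real (k b) * refl c f p))"

text \<open>Action of the generators W_1 = X, W_2 = Y, W_3 = Z on the spinor polynomials\<close>
definition BIops :: "(nat \<Rightarrow> real) \<Rightarrow> nat \<Rightarrow> sp \<Rightarrow> sp" where
  "BIops k i = (if i = 1 then gen k 1 3 2 else if i = 2 then gen k 2 1 3 else gen k 3 2 1)"

definition Vd :: "nat \<Rightarrow> (nat \<Rightarrow> complex) set" where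
  "Vd d = {v. \<forall>i>d. v i = 0}"

definition thetaf :: "nat \<Rightarrow> complex \<Rightarrow> nat \<Rightarrow> complex" where
  "thetaf d a i = (-1) ^ i * (2 * a - of_nat d + 2 * of_nat i) / 2"

definition Xmat :: "nat \<Rightarrow> complex \<Rightarrow> (nat \<Rightarrow> complex) \<Rightarrow> nat \<Rightarrow> complex" where
  "Xmat d a v = (\<lambda>i. if i \<le> d then thetaf d a i * v i + (if 1 \<le> i then v (i - 1) else 0) else 0)"

definition Ymat :: "nat \<Rightarrow> complex \<Rightarrow> (nat \<Rightarrow> complex) \<Rightarrow> (nat \<Rightarrow> complex) \<Rightarrow> nat \<Rightarrow> complex" where
  "Ymat d b phi v = (\<lambda>i. if i \<le> d then thetaf d b i * v i + (if i + 1 \<le> d then phi (i + 1) * v (i + 1) else 0) else 0)"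

definition bimod :: "nat \<Rightarrow> complex \<Rightarrow> complex \<Rightarrow> (nat \<Rightarrow> complex) \<Rightarrow> complex
     \<Rightarrow> nat \<Rightarrow> (nat \<Rightarrow> complex) \<Rightarrow> nat \<Rightarrow> complex" where
  "bimod d a b phi z = (\<lambda>g. if g = 1 then Xmat d a
      else if g = 2 then Ymat d b phi
      else (\<lambda>v j. Xmat d a (Ymat d b phi v) j + Ymat d b phi (Xmat d a v) j - z * v j))"

definition E_phi :: "nat \<Rightarrow> complex \<Rightarrow> complex \<Rightarrow> complex \<Rightarrow> nat \<Rightarrow> complex" where
  "E_phi d a b c i = (if even i then of_nat i * (of_nat d - of_nat i + 1)
      else c ^ 2 - (2 * a + 2 * b - of_nat d + 2 * of_nat i - 1) ^ 2 / 4)"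

definition O_phi :: "nat \<Rightarrow> complex \<Rightarrow> complex \<Rightarrow> complex \<Rightarrow> nat \<Rightarrow> complex" where
  "O_phi d a b c i = (if even i
      then of_nat i * (of_nat d + 1 - 2 * of_nat i - 2 * a - 2 * b - 2 * c) / 2
      else (of_nat i - of_nat d - 1) * (of_nat d + 1 - 2 * of_nat i - 2 * a - 2 * b + 2 * c) / 2)"

text \<open>E_d(a,b,c) (meant for odd d) and O_d(a,b,c) (meant for even d), generators indexed 1,2,3\<close>
definition Emod :: "nat \<Rightarrow> complex \<Rightarrow> complex \<Rightarrow> complex \<Rightarrow> nat \<Rightarrow> (nat \<Rightarrow> complex) \<Rightarrow> nat \<Rightarrow> complex" where
  "Emod d a b c = bimod d a b (E_phi d a b c) (c ^ 2 - a ^ 2 - b ^ 2 + (of_nat d + 1) ^ 2 / 4)"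

definition Omod :: "nat \<Rightarrow> complex \<Rightarrow> complex \<Rightarrow> complex \<Rightarrow> nat \<Rightarrow> (nat \<Rightarrow> complex) \<Rightarrow> nat \<Rightarrow> complex" where
  "Omod d a b c = bimod d a b (O_phi d a b c) (2 * a * b - c * (of_nat d + 1))"

text \<open>Twist by epsilon o sigma, where epsilon is the sign automorphism W_i to s_i W_i and sigma
  sends W_i to W_(sigma i): in the twisted module W_i acts as s_(sigma i) W_(sigma i).\<close>
definition twist :: "(nat \<Rightarrow> complex) \<Rightarrow> (nat \<Rightarrow> nat) \<Rightarrow> (nat \<Rightarrow> ('a \<Rightarrow> complex) \<Rightarrow> 'a \<Rightarrow> complex)
     \<Rightarrow> nat \<Rightarrow> ('a \<Rightarrow> complex) \<Rightarrow> 'a \<Rightarrow> complex" where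
  "twist sg \<sigma> W = (\<lambda>i v x. sg (\<sigma> i) * W (\<sigma> i) v x)"

definition sg_id :: "nat \<Rightarrow> complex" where "sg_id = (\<lambda>i. 1)"
definition sg_1m1 :: "nat \<Rightarrow> complex" where "sg_1m1 = (\<lambda>i. if i = 1 then 1 else -1)"
definition sg_m11 :: "nat \<Rightarrow> complex" where "sg_m11 = (\<lambda>i. if i = 2 then 1 else -1)"
definition sg_m1m1 :: "nat \<Rightarrow> complex" where "sg_m1m1 = (\<lambda>i. if i = 3 then 1 else -1)"

definition perm_id :: "nat \<Rightarrow> nat" where "perm_id = (\<lambda>i. i)"
definition perm23 :: "nat \<Rightarrow> nat" where "perm23 = (\<lambda>i. if i = 2 then 3 else if i = 3 then 2 else i)"
definition perm123 :: "nat \<Rightarrow> nat" where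
  "perm123 = (\<lambda>i. if i = 1 then 2 else if i = 2 then 3 else if i = 3 then 1 else i)"

definition dcar :: "nat \<Rightarrow> (bool \<times> nat \<Rightarrow> complex) set" where
  "dcar d = {w. \<forall>s. (\<lambda>j. w (s,j)) \<in> Vd d}"

definition dirsum :: "(nat \<Rightarrow> (nat \<Rightarrow> complex) \<Rightarrow> nat \<Rightarrow> complex) \<Rightarrow> nat \<Rightarrow> (bool \<times> nat \<Rightarrow> complex) \<Rightarrow> bool \<times> nat \<Rightarrow> complex" where
  "dirsum W = (\<lambda>g w (s,i). W g (\<lambda>j. w (s,j)) i)"

definition lin_on :: "('a \<Rightarrow> complex) set \<Rightarrow> (('a \<Rightarrow> complex) \<Rightarrow> 'b \<Rightarrow> complex) \<Rightarrow> bool" where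
  "lin_on U f \<longleftrightarrow> (\<forall>u\<in>U. \<forall>v\<in>U. \<forall>c::complex. f (\<lambda>x. u x + c * v x) = (\<lambda>y. f u y + c * f v y))"

definition csub :: "('a \<Rightarrow> complex) set \<Rightarrow> bool" where
  "csub U \<longleftrightarrow> (\<lambda>_. 0) \<in> U \<and> (\<forall>u\<in>U. \<forall>v\<in>U. \<forall>c::complex. (\<lambda>x. u x + c * v x) \<in> U)"

text \<open>The BI-module U/W (W a submodule of U, actions W_i) is isomorphic to the BI-module S with
  actions V_i: there is a C-linear surjection U onto S with kernel W intertwining the generators.\<close>
definition bi_quot_iso :: "('a \<Rightarrow> complex) set \<Rightarrow> ('a \<Rightarrow> complex) set \<Rightarrow> (nat \<Rightarrow> ('a \<Rightarrow> complex) \<Rightarrow> 'a \<Rightarrow> complex)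
    \<Rightarrow> ('b \<Rightarrow> complex) set \<Rightarrow> (nat \<Rightarrow> ('b \<Rightarrow> complex) \<Rightarrow> 'b \<Rightarrow> complex) \<Rightarrow> bool" where
  "bi_quot_iso U W WU S VS \<longleftrightarrow> (\<exists>f. lin_on U f \<and> f ` U = S
      \<and> (\<forall>u\<in>U. f u = (\<lambda>_. 0) \<longleftrightarrow> u \<in> W)
      \<and> (\<forall>g\<in>{1,2,3::nat}. \<forall>u\<in>U. f (WU g u) = VS g (f u)))"

definition bi_iso :: "('a \<Rightarrow> complex) set \<Rightarrow> (nat \<Rightarrow> ('a \<Rightarrow> complex) \<Rightarrow> 'a \<Rightarrow> complex)
    \<Rightarrow> ('b \<Rightarrow> complex) set \<Rightarrow> (nat \<Rightarrow> ('b \<Rightarrow> complex) \<Rightarrow> 'b \<Rightarrow> complex) \<Rightarrow> bool" where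
  "bi_iso U WU S VS \<longleftrightarrow> bi_quot_iso U {\<lambda>_. 0} WU S VS"

definition bi_irred :: "('a \<Rightarrow> complex) set \<Rightarrow> (nat \<Rightarrow> ('a \<Rightarrow> complex) \<Rightarrow> 'a \<Rightarrow> complex) \<Rightarrow> bool" where
  "bi_irred S W \<longleftrightarrow> S \<noteq> {\<lambda>_. 0} \<and>
     (\<forall>U. U \<subseteq> S \<and> csub U \<and> (\<forall>g\<in>{1,2,3::nat}. \<forall>u\<in>U. W g u \<in> U) \<longrightarrow> U = {\<lambda>_. 0} \<or> U = S)"

end

theory Submission
  imports Defs "HOL-Library.Function_Algebras"
begin

text \<open>Since n < t2, no coefficient of T2 in degree at most n vanishes, so the Dirac equation determines an
  element of M_n by its part free of x2, an arbitrary homogeneous element of degree n in x1, x3. On this part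
  e1 e3 commutes with X, Y, Z, and on each of its two eigenspaces X and Z are bidiagonal in opposite directions
  in the basis x1^a x3^(n-a), with Y = {X,Z} - const. The off-diagonal coefficients vanish exactly where
  a = t1 or n - a = t3, which cuts the monomial basis into the pieces W3, W1, W2.
  For the last part, a common eigenvector of two elements such as Y and X + Z generates an image of E_d or O_d,
  and an explicit eigenvector of Z in E_d(a,b,c) or O_d(a,b,c) gives the isomorphisms permuting a, b, c.\<close>

section \<open>Modules over the Bannai-Ito relations\<close>

text \<open>Setting x2 = 0 kills x2 T3 and x2 T1, and the Dirac equation trades the remaining T2 for
  T1 and T3. This makes X and Z one-sided: X couples the exponent a of x1 only to a and a + 1, Z
  only to a and a - 1. The central elements {X,Y} - Z, {Y,Z} - X, {Z,X} - Y act as scalars on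
  E_d(a,b,c) and O_d(a,b,c), and permuting a, b, c permutes these scalars. So a twist by a
  permutation has the right scalars and only a start vector is missing: v_0 is an eigenvector of Y
  and, since the first two diagonal entries of Y sum to -1, of X + Z. The resulting map is bijective
  by dimension once one side is irreducible. Irreducibility combines two descents inside a
  submodule, one to the eigenvector of X for its first eigenvalue and one from there to v_0. It
  needs distinct eigenvalues of X. The X of the O modules in W2 and W3 has parameter k2, and its
  eigenvalues may coincide even for k2 >= 0; hence irreducibility is proved for a rotated form whose
  X has parameter -K - n - 1.\<close>

fun chain :: "(('a \<Rightarrow> complex) \<Rightarrow> 'a \<Rightarrow> complex) \<Rightarrow> (nat \<Rightarrow> complex) \<Rightarrow> ('a \<Rightarrow> complex) \<Rightarrow> nat \<Rightarrow> 'a \<Rightarrow> complex" where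
  "chain X th v 0 = v"
| "chain X th v (Suc i) = (\<lambda>x. X (chain X th v i) x - th i * chain X th v i x)"

section \<open>Linear maps and subspaces of function spaces\<close>

lemma lin_on_add_scale:
  assumes "lin_on S f" "u \<in> S" "v \<in> S"
  shows "f (\<lambda>x. u x + c * v x) y = f u y + c * f v y"
  using assms by (simp add: lin_on_def)

lemma csub_add_scale:
  assumes "csub S" "u \<in> S" "v \<in> S"
  shows "(\<lambda>x. u x + c * v x) \<in> S"
  using assms by (simp add: csub_def)

lemma csub_scale:
  assumes "csub S" "v \<in> S"
  shows "(\<lambda>x. c * v x) \<in> S"
  using csub_add_scale[OF assms(1) _ assms(2), of "\<lambda>_. 0" c] assms(1) by (simp add: csub_def)

lemma csub_diff_scale:
  assumes "csub S" "u \<in> S" "v \<in> S"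
  shows "(\<lambda>x. u x - c * v x) \<in> S"
  using csub_add_scale[OF assms, of "-c"] by simp

lemma csub_add:
  assumes "csub S" "u \<in> S" "v \<in> S"
  shows "(\<lambda>x. u x + v x) \<in> S"
  using csub_add_scale[OF assms, of 1] by simp

lemma lin_on_diff_scale:
  assumes "lin_on S f" "u \<in> S" "v \<in> S"
  shows "f (\<lambda>x. u x - c * v x) y = f u y - c * f v y"
  using lin_on_add_scale[OF assms, of "-c"] by simp

lemma lin_on_zero:
  assumes "lin_on S f" "csub S"
  shows "f (\<lambda>_. 0) = (\<lambda>_. 0)"
proof
  fix y
  have "(\<lambda>_. 0) \<in> S" using assms(2) by (simp add: csub_def)
  from lin_on_add_scale[OF assms(1) this this, of "-1" y] show "f (\<lambda>_. 0) y = 0" by simp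
qed

lemma lin_on_scale:
  assumes "lin_on S f" "csub S" "v \<in> S"
  shows "f (\<lambda>x. c * v x) y = c * f v y"
  using lin_on_add_scale[OF assms(1) _ assms(3), of "\<lambda>_. 0" c y] assms lin_on_zero[OF assms(1,2)]
  by (simp add: csub_def)

lemma csub_image:
  assumes f: "lin_on S f" "csub S" and U: "csub U" "U \<subseteq> S"
  shows "csub (f ` U)"
  unfolding csub_def
proof (intro conjI ballI allI)
  have "f (\<lambda>_. 0) \<in> f ` U" using U by (intro imageI) (simp add: csub_def)
  then show "(\<lambda>_. 0) \<in> f ` U" by (simp only: lin_on_zero[OF f])
next
  fix u v c assume "u \<in> f ` U" "v \<in> f ` U"
  then obtain u' v' where u': "u' \<in> U" "u = f u'" "v' \<in> U" "v = f v'" by auto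
  have "f (\<lambda>x. u' x + c * v' x) = (\<lambda>x. u x + c * v x)"
    using lin_on_add_scale[OF f(1) subsetD[OF U(2) u'(1)] subsetD[OF U(2) u'(3)], of c] u' by auto
  moreover have "f (\<lambda>x. u' x + c * v' x) \<in> f ` U" by (intro imageI csub_add_scale[OF U(1)] u')
  ultimately show "(\<lambda>x. u x + c * v x) \<in> f ` U" by simp
qed

lemma lin_on_comb3:
  assumes "lin_on S f" "csub S" "u \<in> S" "v \<in> S" "w \<in> S"
  shows "f (\<lambda>x. p * u x + q * v x + r * w x) y = p * f u y + q * f v y + r * f w y"
  using lin_on_add_scale[OF assms(1) csub_add_scale[OF assms(2) csub_scale[OF assms(2,3)] assms(4)] assms(5)]
    lin_on_add_scale[OF assms(1) csub_scale[OF assms(2,3)] assms(4)] lin_on_scale[OF assms(1-3)] by simp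

lemma lin_on_sum:
  assumes "lin_on S f" "csub S" "finite I" "\<And>i. i \<in> I \<Longrightarrow> v i \<in> S"
  shows "(\<lambda>x. \<Sum>i\<in>I. c i * v i x) \<in> S \<and> f (\<lambda>x. \<Sum>i\<in>I. c i * v i x) = (\<lambda>y. \<Sum>i\<in>I. c i * f (v i) y)"
  using assms(3,4)
proof (induction I)
  case empty
  then show ?case using assms(2) lin_on_zero[OF assms(1,2)] by (simp add: csub_def)
next
  case (insert j I)
  have *: "(\<lambda>x. \<Sum>i\<in>insert j I. c i * v i x) = (\<lambda>x. (\<Sum>i\<in>I. c i * v i x) + c j * v j x)"
    using insert(1,2) by (simp add: add.commute)
  have IH: "(\<lambda>x. \<Sum>i\<in>I. c i * v i x) \<in> S"
    "f (\<lambda>x. \<Sum>i\<in>I. c i * v i x) = (\<lambda>y. \<Sum>i\<in>I. c i * f (v i) y)"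
    using insert by auto
  show ?case
    unfolding * using csub_add_scale[OF assms(2) IH(1), of "v j" "c j"]
      lin_on_add_scale[OF assms(1) IH(1), of "v j" "c j"] insert IH(2)
    by (auto simp: add.commute)
qed

text \<open>The elements {X,Y} - Z, {Z,X} - Y, {Y,Z} - X are central, and on the modules compared
  here they act as scalars, namely \<open>\<zeta>\<close>, \<open>\<xi>\<close>,
  \<open>\<eta>\<close>. Twists by permutations and signs only permute these scalars and change
  their signs.\<close>

locale BI_triple =
  fixes S :: "('a \<Rightarrow> complex) set" and X Y Z :: "('a \<Rightarrow> complex) \<Rightarrow> 'a \<Rightarrow> complex"
    and \<zeta> \<xi> \<eta> :: complex
  assumes sub: "csub S"
    and lin: "lin_on S X" "lin_on S Y" "lin_on S Z"
    and closed: "\<And>v. v \<in> S \<Longrightarrow> X v \<in> S" "\<And>v. v \<in> S \<Longrightarrow> Y v \<in> S" "\<And>v. v \<in> S \<Longrightarrow> Z v \<in> S"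
    and XY: "\<And>v x. v \<in> S \<Longrightarrow> X (Y v) x + Y (X v) x = Z v x + \<zeta> * v x"
    and ZX: "\<And>v x. v \<in> S \<Longrightarrow> Z (X v) x + X (Z v) x = Y v x + \<xi> * v x"
    and YZ: "\<And>v x. v \<in> S \<Longrightarrow> Y (Z v) x + Z (Y v) x = X v x + \<eta> * v x"
begin

lemma swap: "BI_triple S X Z Y \<xi> \<zeta> \<eta>"
  by unfold_locales (use sub lin closed XY ZX YZ in \<open>auto simp: add.commute\<close>)

lemma rotate: "BI_triple S Y Z X \<eta> \<zeta> \<xi>"
  by unfold_locales (use sub lin closed XY ZX YZ in \<open>auto simp: add.commute\<close>)

text \<open>The twist by the sign automorphism (-1,1). It serves even d, where reversing the order
  of the eigenvalues of X costs a sign.\<close>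

lemma neg: "BI_triple S (\<lambda>v x. - X v x) Y (\<lambda>v x. - Z v x) (-\<zeta>) \<xi> (-\<eta>)"
proof -
  have m: "f (\<lambda>x. - v x) = (\<lambda>x. - f v x)" if "lin_on S f" "v \<in> S" for f :: "('a \<Rightarrow> complex) \<Rightarrow> 'a \<Rightarrow> complex" and v
    using lin_on_scale[OF that(1) sub that(2), of "-1"] by auto
  have c: "(\<lambda>x. - v x) \<in> S" if "v \<in> S" for v
    using csub_scale[OF sub that, of "-1"] by simp
  have l: "lin_on S (\<lambda>v x. - f v x)" if "lin_on S f" for f :: "('a \<Rightarrow> complex) \<Rightarrow> 'a \<Rightarrow> complex"
    using that by (auto simp: lin_on_def)
  have "- X (Y v) x + - Y (X v) x = - Z v x + - \<zeta> * v x" if "v \<in> S" for v x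
    using XY[OF that, of x] by (simp add: algebra_simps)
  moreover have "- Y (Z v) x + - Z (Y v) x = - X v x + - \<eta> * v x" if "v \<in> S" for v x
    using YZ[OF that, of x] by (simp add: algebra_simps)
  ultimately show ?thesis
    by unfold_locales (use sub lin closed XY ZX YZ in \<open>auto simp: m c l\<close>)
qed

lemma chain_closed: "v \<in> S \<Longrightarrow> chain X th v i \<in> S"
  by (induction i) (auto intro!: csub_diff_scale[OF sub] closed)

text \<open>All factors X - th i and X - c are polynomials in X, so they commute.\<close>

lemma chain_shift:
  "v \<in> S \<Longrightarrow> chain X th (\<lambda>x. X v x - c * v x) i = (\<lambda>x. X (chain X th v i) x - c * chain X th v i x)"
proof (induction i)
  case (Suc i)
  let ?w = "chain X th v i"
  have w: "?w \<in> S" using chain_closed Suc by auto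
  have XW: "X (\<lambda>x. X ?w x - c * ?w x) = (\<lambda>x. X (X ?w) x - c * X ?w x)" for c
    using lin_on_diff_scale[OF lin(1) closed(1)[OF w] w] by auto
  show ?case using Suc by (simp add: XW algebra_simps)
qed simp

end

text \<open>The structure constants of a bidiagonal pair X, Y with diagonals thetaf d a, thetaf d b,
  superdiagonal \<phi>, and of the tridiagonal Z with diagonal D.\<close>
definition split_data :: "nat \<Rightarrow> complex \<Rightarrow> complex \<Rightarrow> (nat \<Rightarrow> complex) \<Rightarrow> (nat \<Rightarrow> complex) \<Rightarrow> complex \<Rightarrow> complex \<Rightarrow> complex \<Rightarrow> bool" where
  "split_data d a b \<phi> D \<zeta> \<xi> \<eta> \<longleftrightarrow> \<phi> 0 = 0 \<and> \<phi> (Suc d) = 0 \<and>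
    (\<forall>i. \<phi> (Suc i) + \<phi> i = D i + \<zeta> - 2 * thetaf d a i * thetaf d b i
       \<and> (-1) ^ i * (\<phi> i - \<phi> (Suc i)) = \<xi> + thetaf d b i - 2 * thetaf d a i * D i
       \<and> (-1) ^ i * (\<phi> i - \<phi> (Suc i)) = \<eta> + thetaf d a i - 2 * thetaf d b i * D i
       \<and> D (Suc i) = - 1 - D i)"

text \<open>The sum of neighbouring diagonal entries is a sign. Hence the off-diagonal entries of
  {X,Y}, which are such sums times those of X and Y, are again those of X and Y up to sign.\<close>

lemma thetaf_Suc: "thetaf d a (Suc i) = - ((-1) ^ i) - thetaf d a i"
  by (simp add: thetaf_def field_simps)

lemma m1sq: "(-1::complex) ^ i * (-1) ^ i = 1" "(-1::complex) ^ i * ((-1) ^ i * x) = x"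
  by (simp_all flip: power_mult_distrib mult.assoc)

context BI_triple
begin

text \<open>In E_d and O_d the basis vector v_i is (X - th (i-1)) ... (X - th 0) v_0, a
  \<open>chain\<close>. The relations for {X,Y} and {Z,X} express Y and Z on X c_i through their
  values on c_i, so any vector sharing the two eigenvalue properties of v_0 starts a chain with the
  same formulas.\<close>

lemma split_chain:
  assumes data: "split_data d a b \<phi> D \<zeta> \<xi> \<eta>'" and v: "v \<in> S"
    and Yv: "\<And>x. Y v x = thetaf d b 0 * v x"
    and XZv: "\<And>x. X v x + Z v x = (thetaf d a 0 + D 0) * v x"
  defines "c \<equiv> chain X (thetaf d a) v"
  shows "Y (c i) x = thetaf d b i * c i x + \<phi> i * c (i - 1) x
     \<and> Z (c i) x = - ((-1) ^ i * c (Suc i) x) + D i * c i x + (-1) ^ i * \<phi> i * c (i - 1) x"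
proof (induction i arbitrary: x)
  case 0
  have "\<phi> 0 = 0" using data by (simp add: split_data_def)
  then show ?case using Yv XZv[of x] by (simp add: c_def algebra_simps)
next
  case (Suc i)
  let ?t = "thetaf d a" and ?s = "thetaf d b"
  define e where "e = (-1::complex) ^ i"
  have e: "(-1::complex) ^ i = e" and e2: "e * e = 1" by (simp_all add: e_def m1sq)
  have tS: "?t (Suc i) = - e - ?t i" "?s (Suc i) = - e - ?s i" by (simp_all add: thetaf_Suc e)
  have cS: "c j \<in> S" for j unfolding c_def using chain_closed[OF v] .
  have cSuc: "c (Suc j) = (\<lambda>x. X (c j) x - ?t j * c j x)" for j by (simp add: c_def)
  have Xc: "X (c j) y = c (Suc j) y + ?t j * c j y" for j y by (simp add: cSuc)
  have Yi: "Y (c i) = (\<lambda>x. ?s i * c i x + \<phi> i * c (i - 1) x)"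
    and Zi: "Z (c i) = (\<lambda>x. - e * c (Suc i) x + D i * c i x + e * \<phi> i * c (i - 1) x)"
    using Suc by (auto simp: e)
  have XYi: "X (Y (c i)) x = ?s i * X (c i) x + \<phi> i * X (c (i - 1)) x"
    unfolding Yi using lin_on_add_scale[OF lin(1) csub_scale[OF sub cS] cS] lin_on_scale[OF lin(1) sub cS] by simp
  have XZi: "X (Z (c i)) x = - e * X (c (Suc i)) x + D i * X (c i) x + e * \<phi> i * X (c (i - 1)) x"
    unfolding Zi by (intro lin_on_comb3[OF lin(1) sub] cS)
  have Ys: "Y (c (Suc i)) x = - X (Y (c i)) x + Z (c i) x + \<zeta> * c i x - ?t i * Y (c i) x"
    using lin_on_diff_scale[OF lin(2) closed(1)[OF cS] cS, of i "?t i" i x] XY[OF cS, of i x]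
    by (simp add: cSuc algebra_simps)
  have Zs: "Z (c (Suc i)) x = - X (Z (c i)) x + Y (c i) x + \<xi> * c i x - ?t i * Z (c i) x"
    using lin_on_diff_scale[OF lin(3) closed(1)[OF cS] cS, of i "?t i" i x] ZX[OF cS, of i x]
    by (simp add: cSuc algebra_simps)
  have d1: "\<phi> (Suc i) = D i + \<zeta> - 2 * ?t i * ?s i - \<phi> i"
    and d2: "e * \<phi> (Suc i) = e * \<phi> i - \<xi> - ?s i + 2 * ?t i * D i"
    and d3: "D (Suc i) = - 1 - D i" and p0: "\<phi> 0 = 0"
    using data by (auto simp: split_data_def algebra_simps simp flip: e)
  \<comment> \<open>The factor \<open>\<phi> i\<close> covers i = 0, where \<open>c (i - 1)\<close>
    is again \<open>c 0\<close>: there \<open>\<phi> 0 = 0\<close>.\<close>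
  have Xp: "\<phi> i * X (c (i - 1)) x = \<phi> i * (c i x + (e - ?t i) * c (i - 1) x)"
  proof (cases i)
    case (Suc j)
    have "e - ?t i = ?t j" using Suc by (simp add: e_def thetaf_Suc)
    then show ?thesis using Suc by (simp add: Xc)
  qed (simp add: p0)
  have "Y (c (Suc i)) x = ?s (Suc i) * c (Suc i) x + \<phi> (Suc i) * c i x"
    unfolding Ys XYi unfolding Yi Zi d1 tS Xc[of i] using Xp by algebra
  moreover have "Z (c (Suc i)) x = e * c (Suc (Suc i)) x + D (Suc i) * c (Suc i) x - e * \<phi> (Suc i) * c i x"
    unfolding Zs XZi unfolding Yi Zi d3 d2 Xc[of i] Xc[of "Suc i"] tS using Xp e2 by algebra
  ultimately show ?case by (simp add: e)
qed

end

section \<open>The bidiagonal matrix modules on \<open>Vd d\<close>\<close>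

lemma Vd_csub: "csub (Vd d)"
  by (auto simp: csub_def Vd_def)

lemma thetaf_eq: "thetaf d a i = (-1) ^ i * (a - of_nat d / 2 + of_nat i)"
  by (simp add: thetaf_def field_simps)

lemma Xmat_coord:
  "i \<le> d \<Longrightarrow> Xmat d a v i = thetaf d a i * v i + (if 1 \<le> i then v (i - 1) else 0)"
  "\<not> i \<le> d \<Longrightarrow> Xmat d a v i = 0"
  by (auto simp: Xmat_def)

lemma Ymat_coord:
  assumes "v \<in> Vd d"
  shows "i \<le> d \<Longrightarrow> Ymat d b phi v i = thetaf d b i * v i + phi (Suc i) * v (Suc i)"
    "\<not> i \<le> d \<Longrightarrow> Ymat d b phi v i = 0"
  using assms by (auto simp: Ymat_def Vd_def)

lemma Xmat_Vd: "Xmat d a v \<in> Vd d" and Ymat_Vd: "Ymat d b phi v \<in> Vd d"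
  by (auto simp: Vd_def Xmat_def Ymat_def)

lemma Xmat_lin: "lin_on S (Xmat d a)" and Ymat_lin: "lin_on S (Ymat d b phi)"
  by (auto simp: lin_on_def Xmat_def Ymat_def algebra_simps)

text \<open>Closed form of {X,Y} - \<open>\<zeta>\<close> under \<open>split_data\<close>; the signs
  are sums of neighbouring diagonal entries of X and Y.\<close>

definition Zmat :: "nat \<Rightarrow> (nat \<Rightarrow> complex) \<Rightarrow> (nat \<Rightarrow> complex) \<Rightarrow> (nat \<Rightarrow> complex) \<Rightarrow> nat \<Rightarrow> complex" where
  "Zmat d \<phi> D v = (\<lambda>i. if i \<le> d then D i * v i + (-1) ^ i * ((if 1 \<le> i then v (i - 1) else 0) - \<phi> (Suc i) * v (Suc i)) else 0)"

lemma Zmat_Vd: "Zmat d \<phi> D v \<in> Vd d"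
  by (auto simp: Vd_def Zmat_def)

lemma Zmat_lin: "lin_on S (Zmat d \<phi> D)"
  by (auto simp: lin_on_def Zmat_def algebra_simps)

lemma Vd_Suc: "v \<in> Vd d \<Longrightarrow> v (Suc d) = 0"
  by (simp add: Vd_def)

lemma bimod3_eq_Zmat:
  assumes data: "split_data d a b \<phi> D \<zeta> \<xi> \<eta>" and v: "v \<in> Vd d"
  shows "bimod d a b \<phi> \<zeta> 3 v = Zmat d \<phi> D v"
proof
  fix i
  have D: "D j = \<phi> (Suc j) + \<phi> j - \<zeta> + 2 * thetaf d a j * thetaf d b j" for j
    using data by (simp add: split_data_def)
  have p: "\<phi> 0 = 0" "\<phi> (Suc d) = 0" using data by (auto simp: split_data_def)
  show "bimod d a b \<phi> \<zeta> 3 v i = Zmat d \<phi> D v i"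
  proof (cases "i \<le> d")
    case True
    then show ?thesis using v p
      by (cases i; cases "i = d") (simp_all add: bimod_def Xmat_coord Ymat_coord Xmat_Vd Ymat_Vd Zmat_def
            D thetaf_Suc Vd_Suc algebra_simps)
  next
    case False
    then show ?thesis using v by (simp add: bimod_def Xmat_def Ymat_def Zmat_def Vd_def)
  qed
qed

lemma Zmat_coord:
  assumes "v \<in> Vd d"
  shows "i \<le> d \<Longrightarrow> Zmat d \<phi> D v i = D i * v i + (-1) ^ i * ((if 1 \<le> i then v (i - 1) else 0) - \<phi> (Suc i) * v (Suc i))"
    "\<not> i \<le> d \<Longrightarrow> Zmat d \<phi> D v i = 0"
  by (auto simp: Zmat_def)

text \<open>The relation for {X,Y} defines Z. In the other two, the diagonal entries are the second
  and third conditions of \<open>split_data\<close>; the off-diagonal entries agree because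
  neighbouring diagonal entries of X and Y sum to a sign and those of Z to -1.\<close>

lemma BI_triple_split:
  assumes data: "split_data d a b \<phi> D \<zeta> \<xi> \<eta>"
  shows "BI_triple (Vd d) (Xmat d a) (Ymat d b \<phi>) (Zmat d \<phi> D) \<zeta> \<xi> \<eta>"
proof
  fix v :: "nat \<Rightarrow> complex" and i assume v: "v \<in> Vd d"
  let ?X = "Xmat d a" and ?Y = "Ymat d b \<phi>" and ?Z = "Zmat d \<phi> D"
  let ?t = "thetaf d a" and ?s = "thetaf d b"
  show "?X (?Y v) i + ?Y (?X v) i = ?Z v i + \<zeta> * v i"
    using fun_cong[OF bimod3_eq_Zmat[OF data v], of i] by (simp add: bimod_def algebra_simps)
  have d2: "(-1) ^ j * (\<phi> j - \<phi> (Suc j)) = \<xi> + ?s j - 2 * ?t j * D j" 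
   and d4: "(-1) ^ j * (\<phi> j - \<phi> (Suc j)) = \<eta> + ?t j - 2 * ?s j * D j"
   and d3: "D (Suc j) = - 1 - D j" for j
    using data unfolding split_data_def by blast+
  have p: "\<phi> 0 = 0" "\<phi> (Suc d) = 0" using data by (auto simp: split_data_def)
  have t: "?t (Suc j) = - ((-1) ^ j) - ?t j" "?s (Suc j) = - ((-1) ^ j) - ?s j" for j
    by (rule thetaf_Suc)+
  note coord = Xmat_coord Ymat_coord Zmat_coord Xmat_Vd Ymat_Vd Zmat_Vd
  define e where "e j = (-1::complex) ^ j" for j :: nat
  define q where "q j = (if 1 \<le> j then v (j - 1) else 0)" for j :: nat
  have eS: "e (Suc j) = - e j" and e2: "e j * e j = 1" for j by (simp_all add: e_def m1sq)
  have tS: "?t (Suc j) = - e j - ?t j" "?s (Suc j) = - e j - ?s j" for j by (simp_all add: e_def t)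
  note d2' = d2[folded e_def] and d4' = d4[folded e_def]
  have q: "q 0 = 0" "q (Suc j) = v j" for j by (simp_all add: q_def)
  have vc: "?X v j = ?t j * v j + q j" "?Y v j = ?s j * v j + \<phi> (Suc j) * v (Suc j)"
     "?Z v j = D j * v j + e j * (q j - \<phi> (Suc j) * v (Suc j))" if "j \<le> d" for j
    using that v by (simp_all add: coord q_def e_def)
  \<comment> \<open>For i = d the entry at \<open>Suc d\<close> is 0 and does not follow the general
    formula; the factor \<open>\<phi> (Suc i)\<close>, which vanishes there, removes this
    exception.\<close>
  have vS: "\<phi> (Suc i) * ?X v (Suc i) = \<phi> (Suc i) * (?t (Suc i) * v (Suc i) + v i)"
     "\<phi> (Suc i) * ?Y v (Suc i) = \<phi> (Suc i) * (?s (Suc i) * v (Suc i) + \<phi> (Suc (Suc i)) * v (Suc (Suc i)))"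
     "\<phi> (Suc i) * ?Z v (Suc i) = \<phi> (Suc i) * (D (Suc i) * v (Suc i) + e (Suc i) * (v i - \<phi> (Suc (Suc i)) * v (Suc (Suc i))))"
    if "i \<le> d"
    using that p vc[of "Suc i"] q by (cases "i = d"; simp)+
  have ops: "?X u i = ?t i * u i + (if 1 \<le> i then u (i - 1) else 0)" "?Y u i = ?s i * u i + \<phi> (Suc i) * u (Suc i)"
     "?Z u i = D i * u i + e i * ((if 1 \<le> i then u (i - 1) else 0) - \<phi> (Suc i) * u (Suc i))"
    if "i \<le> d" "u \<in> Vd d" for u using that by (simp_all add: coord e_def)
  show "?Z (?X v) i + ?X (?Z v) i = ?Y v i + \<xi> * v i"
  proof (cases "i \<le> d")
    case True
    have g: "?Z (?X v) i = D i * ?X v i + e i * (if 1 \<le> i then ?X v (i - 1) else 0) - e i * (\<phi> (Suc i) * ?X v (Suc i))"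
      using ops(3)[OF True Xmat_Vd] by (simp add: algebra_simps)
    show ?thesis
    proof (cases i)
      case 0
      have "\<phi> i = 0" "q i = 0" using 0 p q by auto
      then have "?Z (?X v) i + ?X (?Z v) i = D i * ?X v i - e i * (\<phi> (Suc i) * ?X v (Suc i)) + ?t i * ?Z v i"
        unfolding g ops(1)[OF True Zmat_Vd] using 0 by simp
      also have "\<dots> = ?Y v i + \<xi> * v i"
        unfolding vS[OF True] vc[OF True] d3 tS
        using d2'[of i] e2[of i] \<open>\<phi> i = 0\<close> \<open>q i = 0\<close> by algebra
      finally show ?thesis .
    next
      case (Suc j)
      then have j: "j \<le> d" using True by simp
      have *: "?X v j = ?t j * v j + q j" "?Z v j = D j * v j + e j * (q j - \<phi> i * v i)" "q i = v j"
        using vc[OF j] q Suc by auto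
      have **: "e i = - e j" "?t i = - e j - ?t j" "?s i = - e j - ?s j" "D i = - 1 - D j"
        using eS[of j] tS[of j] d3[of j] Suc by auto
      have "?Z (?X v) i + ?X (?Z v) i = D i * ?X v i + e i * ?X v j - e i * (\<phi> (Suc i) * ?X v (Suc i)) + (?t i * ?Z v i + ?Z v j)"
        unfolding g ops(1)[OF True Zmat_Vd] using Suc by simp
      also have "\<dots> = ?Y v i + \<xi> * v i"
        unfolding vS[OF True] * vc[OF True] d3 tS
        using d2'[of i] e2[of j] ** by algebra
      finally show ?thesis .
    qed
  qed (use v in \<open>simp add: Xmat_def Ymat_def Zmat_def Vd_def\<close>)
  show "?Y (?Z v) i + ?Z (?Y v) i = ?X v i + \<eta> * v i"
  proof (cases "i \<le> d")
    case True
    have g: "?Y (?Z v) i = ?s i * ?Z v i + \<phi> (Suc i) * ?Z v (Suc i)"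
      by (rule ops[OF True Zmat_Vd])
    have g': "?Z (?Y v) i = D i * ?Y v i + e i * (if 1 \<le> i then ?Y v (i - 1) else 0) - e i * (\<phi> (Suc i) * ?Y v (Suc i))"
      using ops(3)[OF True Ymat_Vd] by (simp add: algebra_simps)
    show ?thesis
    proof (cases i)
      case 0
      have "\<phi> i = 0" "q i = 0" using 0 p q by auto
      then have "?Y (?Z v) i + ?Z (?Y v) i = ?s i * ?Z v i + \<phi> (Suc i) * ?Z v (Suc i) + (D i * ?Y v i - e i * (\<phi> (Suc i) * ?Y v (Suc i)))"
        unfolding g g' using 0 by simp
      also have "\<dots> = ?X v i + \<eta> * v i"
        unfolding vS[OF True] vc[OF True] d3 tS eS
        using d4'[of i] e2[of i] \<open>\<phi> i = 0\<close> \<open>q i = 0\<close> by algebra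
      finally show ?thesis .
    next
      case (Suc j)
      then have j: "j \<le> d" using True by simp
      have *: "?Y v j = ?s j * v j + \<phi> i * v i" "q i = v j"
        using vc[OF j] q Suc by auto
      have **: "e i = - e j" "?t i = - e j - ?t j" "?s i = - e j - ?s j" "D i = - 1 - D j"
        using eS[of j] tS[of j] d3[of j] Suc by auto
      have "?Y (?Z v) i + ?Z (?Y v) i = ?s i * ?Z v i + \<phi> (Suc i) * ?Z v (Suc i) + (D i * ?Y v i + e i * ?Y v j - e i * (\<phi> (Suc i) * ?Y v (Suc i)))"
        unfolding g g' using Suc by simp
      also have "\<dots> = ?X v i + \<eta> * v i"
        unfolding vS[OF True] * vc[OF True] d3 tS eS
        using d4'[of i] e2[of j] ** by algebra
      finally show ?thesis .
    qed
  qed (use v in \<open>simp add: Xmat_def Ymat_def Zmat_def Vd_def\<close>)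
qed (auto intro: Vd_csub Xmat_lin Ymat_lin Zmat_lin Xmat_Vd Ymat_Vd Zmat_Vd)

section \<open>Irreducibility of bidiagonal modules\<close>

context BI_triple
begin

text \<open>The factors commute, so the outermost may be applied first; this permits inductions over
  vectors with shrinking support.\<close>

lemma chain_split_last:
  assumes "v \<in> S"
  shows "chain X th v (Suc k) = chain X th (\<lambda>x. X v x - th k * v x) k"
  using chain_shift[OF assms] by simp

end

text \<open>X is lower triangular, so each factor kills one more leading coordinate: Cayley-Hamilton
  for a triangular matrix.\<close>

lemma chain_Xmat_eq_0:
  assumes v: "v \<in> Vd d"
  shows "chain (Xmat d a) (thetaf d a) v (Suc d) = (\<lambda>_. 0)"
proof -
  have *: "j < i \<Longrightarrow> i \<le> Suc d \<Longrightarrow> chain (Xmat d a) (thetaf d a) v i j = 0" for i j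
  proof (induction i arbitrary: j)
    case (Suc i)
    then show ?case by (cases "j = i"; cases "i = 0") (auto simp: Xmat_coord)
  qed simp
  have **: "chain (Xmat d a) (thetaf d a) v i \<in> Vd d" for i
    by (induction i) (use v in \<open>auto intro!: csub_diff_scale[OF Vd_csub] Xmat_Vd\<close>)
  show ?thesis
  proof
    fix j show "chain (Xmat d a) (thetaf d a) v (Suc d) j = 0"
      using *[of j "Suc d"] **[of "Suc d"] by (cases "j \<le> d") (auto simp: Vd_def)
  qed
qed

text \<open>In an upper triangular matrix the trailing coordinates die first, which takes the
  eigenvalues in the opposite order; hence the reordering by
  \<open>chain_split_last\<close>.\<close>

lemma chain_Ymat_eq_0:
  assumes tri: "BI_triple (Vd d) (Ymat d b \<phi>) Y Z \<zeta> \<xi> \<eta>" and v: "v \<in> Vd d"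
  shows "chain (Ymat d b \<phi>) (thetaf d b) v (Suc d) = (\<lambda>_. 0)"
proof -
  let ?Y = "Ymat d b \<phi>"
  have "u \<in> Vd d \<Longrightarrow> (\<forall>j\<ge>k. u j = 0) \<Longrightarrow> k \<le> Suc d \<Longrightarrow> chain ?Y (thetaf d b) u k = (\<lambda>_. 0)" for k u
  proof (induction k arbitrary: u)
    case (Suc k)
    show ?case
      unfolding BI_triple.chain_split_last[OF tri Suc.prems(1)]
    proof (rule Suc.IH)
      show "(\<lambda>x. ?Y u x - thetaf d b k * u x) \<in> Vd d"
        using csub_diff_scale[OF Vd_csub Ymat_Vd Suc.prems(1)] .
      show "\<forall>j\<ge>k. ?Y u j - thetaf d b k * u j = 0"
      proof (intro allI impI)
        fix j assume "k \<le> j"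
        then show "?Y u j - thetaf d b k * u j = 0"
          using Suc.prems Ymat_coord[OF Suc.prems(1), of j] by (cases "j = k"; cases "j \<le> d") auto
      qed
    qed (use Suc.prems in auto)
  qed auto
  from this[OF v, of "Suc d"] show ?thesis using v by (auto simp: Vd_def)
qed

text \<open>Row by row from the top: a diagonal entry different from the eigenvalue leaves no
  choice. So an eigenvector starts in row i, and each eigenspace is at most a line.\<close>

lemma Xmat_eigvec_low:
  assumes "\<And>i j. i < j \<Longrightarrow> j \<le> d \<Longrightarrow> thetaf d a i \<noteq> thetaf d a j"
    and "i \<le> d" "w \<in> Vd d" and eig: "\<And>x. Xmat d a w x = thetaf d a i * w x"
  shows "j < i \<Longrightarrow> w j = 0" and "w \<noteq> (\<lambda>_. 0) \<Longrightarrow> w i \<noteq> 0"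
proof -
  have *: "(thetaf d a i - thetaf d a j) * w j = (if 1 \<le> j then w (j - 1) else 0)" if "j \<le> d" for j
    using eig[of j] that by (simp add: Xmat_coord algebra_simps)
  show low: "w j = 0" if "j < i" for j
    using that
  proof (induction j)
    case 0
    then show ?case using *[of 0] assms(1)[of 0 i] assms(2) by auto
  next
    case (Suc j)
    then show ?case using *[of "Suc j"] assms(1)[of "Suc j" i] assms(2) by auto
  qed
  assume "w \<noteq> (\<lambda>_. 0)"
  show "w i \<noteq> 0"
  proof
    assume 0: "w i = 0"
    have "j \<le> d \<Longrightarrow> w j = 0" for j
    proof (induction j rule: less_induct)
      case (less j)
      show ?case
      proof (cases "j \<le> i")
        case True
        then show ?thesis using 0 low by (cases "j = i") auto
      next
        case False
        then show ?thesis using *[of j] assms(1)[of i j] less by auto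
      qed
    qed
    then have "w j = 0" for j using assms(3) by (cases "j \<le> d") (auto simp: Vd_def)
    then show False using \<open>w \<noteq> (\<lambda>_. 0)\<close> by auto
  qed
qed

definition unit_vec :: "nat \<Rightarrow> nat \<Rightarrow> complex" where
  "unit_vec i = (\<lambda>j. if j = i then 1 else 0)"

lemma Vd_expand:
  assumes "v \<in> Vd d"
  shows "v = (\<lambda>x. \<Sum>i\<in>{..d}. v i * unit_vec i x)"
proof
  fix x
  show "v x = (\<Sum>i\<in>{..d}. v i * unit_vec i x)"
  proof (cases "x \<le> d")
    case True
    then show ?thesis by (simp add: unit_vec_def if_distrib[of "(*) _"] cong: if_cong)
  next
    case False
    then show ?thesis using assms by (auto simp: Vd_def unit_vec_def intro!: sum.neutral[symmetric])
  qed
qed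

lemma csub_sum:
  assumes "csub S" "finite I" "\<And>i. i \<in> I \<Longrightarrow> v i \<in> S"
  shows "(\<lambda>x. \<Sum>i\<in>I. c i * v i x) \<in> S"
  using lin_on_sum[of S "\<lambda>v. v" I v c] assms by (simp add: lin_on_def)

lemma bidiag_generate:
  assumes U: "csub U" "U \<subseteq> Vd d" and X: "\<And>v. v \<in> U \<Longrightarrow> Xmat d a v \<in> U" and e0: "unit_vec 0 \<in> U"
  shows "U = Vd d"
proof -
  have e: "i \<le> d \<Longrightarrow> unit_vec i \<in> U" for i
  proof (induction i)
    case (Suc i)
    have "unit_vec (Suc i) = (\<lambda>x. Xmat d a (unit_vec i) x - thetaf d a i * unit_vec i x)"
      using Suc.prems by (auto simp: unit_vec_def Xmat_def fun_eq_iff)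
    then show ?case using Suc X csub_diff_scale[OF U(1)] by simp
  qed (rule e0)
  have "v \<in> U" if "v \<in> Vd d" for v
    by (subst Vd_expand[OF that]) (rule csub_sum[OF U(1)], use e in auto)
  then show ?thesis using U(2) by auto
qed

text \<open>The second split data describe the chain of \<epsilon>X from the same vector, in the reversed order of
  eigenvalues; its last member is the eigenvector of X for the first eigenvalue.\<close>
lemma bidiag_irreducible:
  assumes data: "split_data d a b \<phi> D \<zeta> \<xi> \<eta>"
    and data2: "split_data d a2 b \<phi>2 D2 (\<epsilon> * \<zeta>) \<xi> (\<epsilon> * \<eta>)"
    and eps: "\<epsilon> = 1 \<or> \<epsilon> = -1"
    and rev: "\<And>i. i \<le> d \<Longrightarrow> thetaf d a2 i = \<epsilon> * thetaf d a (d - i)"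
    and D0: "thetaf d a2 0 + D2 0 = \<epsilon> * (thetaf d a 0 + D 0)"
    and inj: "\<And>i j. i < j \<Longrightarrow> j \<le> d \<Longrightarrow> thetaf d a i \<noteq> thetaf d a j"
    and nz: "\<And>i. 1 \<le> i \<Longrightarrow> i \<le> d \<Longrightarrow> \<phi> i \<noteq> 0" "\<And>i. 1 \<le> i \<Longrightarrow> i \<le> d \<Longrightarrow> \<phi>2 i \<noteq> 0"
  shows "bi_irred (Vd d) (bimod d a b \<phi> \<zeta>)"
  unfolding bi_irred_def
proof (intro conjI allI impI)
  have "unit_vec 0 \<in> Vd d" "unit_vec 0 \<noteq> (\<lambda>_. 0)"
    by (auto simp: unit_vec_def Vd_def fun_eq_iff)
  then show "Vd d \<noteq> {\<lambda>_. 0}" by blast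
next
  fix U
  assume "U \<subseteq> Vd d \<and> csub U \<and> (\<forall>g\<in>{1,2,3}. \<forall>u\<in>U. bimod d a b \<phi> \<zeta> g u \<in> U)"
  then have UV: "U \<subseteq> Vd d" and csU: "csub U"
    and cl: "\<And>g u. g \<in> {1,2,3} \<Longrightarrow> u \<in> U \<Longrightarrow> bimod d a b \<phi> \<zeta> g u \<in> U" by auto
  let ?X = "Xmat d a" and ?Y = "Ymat d b \<phi>" and ?Z = "Zmat d \<phi> D"
  let ?t = "thetaf d a" and ?s = "thetaf d b"
  have clX: "?X u \<in> U" and clY: "?Y u \<in> U" and clZ: "?Z u \<in> U" if "u \<in> U" for u
    using cl[of 1 u] cl[of 2 u] cl[of 3 u] that UV bimod3_eq_Zmat[OF data, of u] by (auto simp: bimod_def)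
  have tri: "BI_triple (Vd d) ?X ?Y ?Z \<zeta> \<xi> \<eta>" by (rule BI_triple_split[OF data])
  interpret BI_triple "Vd d" ?X ?Y ?Z \<zeta> \<xi> \<eta> by (rule tri)
  have tri2: "BI_triple (Vd d) (\<lambda>v x. \<epsilon> * ?X v x) ?Y (\<lambda>v x. \<epsilon> * ?Z v x) (\<epsilon> * \<zeta>) \<xi> (\<epsilon> * \<eta>)"
    using eps tri neg by auto
  have e0: "\<epsilon> \<noteq> 0" using eps by auto
  show "U = {\<lambda>_. 0} \<or> U = Vd d"
  proof (cases "U = {\<lambda>_. 0}")
    case False
    then obtain u where u: "u \<in> U" "u \<noteq> (\<lambda>_. 0)" using csU by (auto simp: csub_def)
    define eigU where "eigU i w \<longleftrightarrow> w \<in> U \<and> w \<noteq> (\<lambda>_. 0) \<and> (\<forall>x. ?X w x = ?t i * w x)" for i w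
    have "\<exists>i\<le>d. \<exists>w. eigU i w"
    proof -
      \<comment> \<open>The last nonzero member of the chain is killed by the next factor, so it is
        an eigenvector of X inside U.\<close>
      define k where "k = (LEAST k. chain ?X ?t u k = (\<lambda>_. 0))"
      have 0: "chain ?X ?t u (Suc d) = (\<lambda>_. 0)" using chain_Xmat_eq_0 u UV by blast
      have k: "chain ?X ?t u k = (\<lambda>_. 0)" unfolding k_def by (rule LeastI, rule 0)
      have kd: "k \<le> Suc d" unfolding k_def by (rule Least_le, rule 0)
      obtain i where i: "k = Suc i" using k u by (cases k) auto
      have "chain ?X ?t u i \<noteq> (\<lambda>_. 0)"
      proof
        assume "chain ?X ?t u i = (\<lambda>_. 0)"
        then have "k \<le> i" unfolding k_def by (rule Least_le)
        then show False using i by simp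
      qed
      moreover have "chain ?X ?t u j \<in> U" for j
        by (induction j) (use u in \<open>auto intro!: csub_diff_scale[OF csU] clX\<close>)
      ultimately have "eigU i (chain ?X ?t u i)" using k i by (auto simp: eigU_def fun_eq_iff)
      then show ?thesis using kd i by auto
    qed
    then obtain i0 where i0: "i0 \<le> d" "\<exists>w. eigU i0 w" by blast
    define i where "i = (LEAST i. \<exists>w. eigU i w)"
    have "\<exists>w. eigU i w" unfolding i_def by (rule LeastI, rule i0(2))
    then obtain w where w: "eigU i w" by blast
    have id: "i \<le> d" using Least_le[of "\<lambda>i. \<exists>w. eigU i w", OF i0(2)] i0(1) by (simp add: i_def)
    have min: "\<not> eigU j w'" if "j < i" for j w'
      using not_less_Least that unfolding i_def by blast
    have wU: "w \<in> U" and w0: "w \<noteq> (\<lambda>_. 0)" and Xw: "?X w x = ?t i * w x" for x using w by (auto simp: eigU_def)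
    have wV: "w \<in> Vd d" using wU UV by blast
    have low: "j < i \<Longrightarrow> w j = 0" and lead: "w i \<noteq> 0" for j
      using Xmat_eigvec_low(1)[of d a i w j] Xmat_eigvec_low(2)[of d a i w] inj id wV Xw w0 by blast+
    have "i = 0"
    proof (rule ccontr)
      assume "i \<noteq> 0"
      then obtain j where j: "i = Suc j" by (cases i) auto
      define e where "e = (-1::complex) ^ i"
      \<comment> \<open>Y + e Z is a lowering operator: by the relations it sends w to an
        eigenvector for index j = i - 1, up to a multiple of w. Subtracting that multiple gives a
        vector of U that contradicts the minimality of i unless it is 0.\<close>
      define q where "q = (\<lambda>x. ?Y w x + e * ?Z w x)"
      define \<kappa> where "\<kappa> = \<zeta> + e * \<xi>"
      have e2: "e * e = 1" by (simp add: e_def m1sq)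
      have tj: "?t j = e - ?t i" using thetaf_Suc[of d a j] j by (simp add: e_def)
      have tne: "?t i - ?t j \<noteq> 0" using inj[of j i] j id by auto
      have qU: "q \<in> U" unfolding q_def by (intro csub_add_scale[OF csU] clY clZ wU)
      have Xfun: "?X w = (\<lambda>x. ?t i * w x)" using Xw by auto
      have Xq: "?X q x = ?t j * q x + \<kappa> * w x" for x
      proof -
        have "?X q x = ?X (?Y w) x + e * ?X (?Z w) x"
          unfolding q_def using lin_on_add_scale[OF lin(1)] Ymat_Vd Zmat_Vd by simp
        moreover have "?X (?Y w) x = ?Z w x + \<zeta> * w x - ?t i * ?Y w x"
          using XY[OF wV, of x] unfolding Xfun lin_on_scale[OF lin(2) sub wV] by algebra
        moreover have "?X (?Z w) x = ?Y w x + \<xi> * w x - ?t i * ?Z w x"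
          using ZX[OF wV, of x] unfolding Xfun lin_on_scale[OF lin(3) sub wV] by algebra
        ultimately show ?thesis unfolding tj \<kappa>_def q_def using e2 by algebra
      qed
      define q' where "q' = (\<lambda>x. q x - (\<kappa> / (?t i - ?t j)) * w x)"
      have q'U: "q' \<in> U" unfolding q'_def by (intro csub_diff_scale[OF csU] qU wU)
      have "?X q' x = ?t j * q' x" for x
      proof -
        have "?X q' x = ?t j * q x + \<kappa> * w x - (\<kappa> / (?t i - ?t j)) * (?t i * w x)"
          unfolding q'_def by (simp only: lin_on_diff_scale[OF lin(1) subsetD[OF UV qU] wV] Xq Xw)
        also have "\<dots> = ?t j * q' x" unfolding q'_def using tne by (simp add: field_simps)
        finally show ?thesis .
      qed
      then have "q' = (\<lambda>_. 0)" using min[of j q'] q'U j by (auto simp: eigU_def)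
      then have "q' j = 0" by simp
      then have "q j = 0" using low[of j] j by (simp add: q'_def)
      \<comment> \<open>The superdiagonals of Y and Z contribute equally to coordinate j, thanks to
        the sign e.\<close>
      moreover have "q j = 2 * \<phi> i * w i"
      proof -
        have zero: "w j = 0" "1 \<le> j \<Longrightarrow> w (j - 1) = 0" using low j by auto
        have "(-1::complex) ^ j = - e" using j by (simp add: e_def)
        then show ?thesis unfolding q_def using zero j id e2
          by (auto simp: Ymat_coord[OF wV] Zmat_coord[OF wV])
      qed
      ultimately show False using nz(1)[of i] id lead j by simp
    qed
    let ?X2 = "\<lambda>v x. \<epsilon> * ?X v x" and ?Z2 = "\<lambda>v x. \<epsilon> * ?Z v x" and ?t2 = "thetaf d a2"
    have eV: "unit_vec 0 \<in> Vd d" by (auto simp: unit_vec_def Vd_def)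
    define c where "c = chain ?X2 ?t2 (unit_vec 0)"
    have cV: "c k \<in> Vd d" for k unfolding c_def by (rule BI_triple.chain_closed[OF tri2 eV])
    have ctop: "(\<forall>j>k. c k j = 0) \<and> c k k \<noteq> 0" if "k \<le> d" for k
      using that
    proof (induction k)
      case 0
      then show ?case by (simp add: c_def unit_vec_def)
    next
      case (Suc k)
      then show ?case using e0 by (auto simp: c_def Xmat_def)
    qed
    \<comment> \<open>In the reversed order factor k kills coordinate d - k, so k factors kill every
      vector supported on the last k coordinates.\<close>
    have red: "x \<in> Vd d \<Longrightarrow> (\<forall>j. j + k \<le> d \<longrightarrow> x j = 0) \<Longrightarrow> k \<le> Suc d \<Longrightarrow> chain ?X2 ?t2 x k = (\<lambda>_. 0)" for x k
    proof (induction k arbitrary: x)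
      case 0
      then have "x j = 0" for j by (cases "j \<le> d") (auto simp: Vd_def)
      then show ?case by auto
    next
      case (Suc k)
      have kd: "k \<le> d" using Suc.prems by simp
      show ?case
        unfolding BI_triple.chain_split_last[OF tri2 Suc.prems(1)]
      proof (rule Suc.IH)
        show "(\<lambda>y. \<epsilon> * ?X x y - ?t2 k * x y) \<in> Vd d"
          by (intro csub_diff_scale[OF Vd_csub] csub_scale[OF Vd_csub] Xmat_Vd Suc.prems)
        show "\<forall>j. j + k \<le> d \<longrightarrow> \<epsilon> * ?X x j - ?t2 k * x j = 0"
        proof (intro allI impI)
          fix j assume j: "j + k \<le> d"
          show "\<epsilon> * ?X x j - ?t2 k * x j = 0"
          proof (cases "j = d - k")
            case True
            have "x (j - 1) = 0" if "1 \<le> j" using Suc.prems(2) that j by auto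
            then show ?thesis using True j kd by (auto simp: Xmat_coord rev algebra_simps)
          next
            case False
            then have "x j = 0" "x (j - 1) = 0" using Suc.prems(2) j by auto
            then show ?thesis using j by (auto simp: Xmat_coord)
          qed
        qed
      qed (use Suc.prems in auto)
    qed
    have "c (Suc d) = (\<lambda>_. 0)" unfolding c_def by (rule red[OF eV]) auto
    then have "\<epsilon> * ?X (c d) x - ?t2 d * c d x = 0" for x unfolding c_def by (auto simp: fun_eq_iff)
    then have "\<epsilon> * (?X (c d) x - ?t 0 * c d x) = 0" for x using rev[of d] by (simp add: algebra_simps)
    then have Xcd: "?X (c d) x = ?t 0 * c d x" for x using e0 by auto
    have w00: "w 0 \<noteq> 0" using lead \<open>i = 0\<close> by simp
    \<comment> \<open>Both \<open>c d\<close> and w belong to the first eigenvalue of X, so the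
      combination with leading entry 0 must vanish.\<close>
    define r where "r = c d 0 / w 0"
    have "(\<lambda>x. c d x - r * w x) = (\<lambda>_. 0)"
    proof (rule ccontr)
      assume n: "(\<lambda>x. c d x - r * w x) \<noteq> (\<lambda>_. 0)"
      have V: "(\<lambda>x. c d x - r * w x) \<in> Vd d" by (intro csub_diff_scale[OF Vd_csub] cV wV)
      have "?X (\<lambda>x. c d x - r * w x) x = ?t 0 * (c d x - r * w x)" for x
        using lin_on_diff_scale[OF lin(1) cV wV] Xcd Xw \<open>i = 0\<close> by (simp add: algebra_simps)
      then have "c d 0 - r * w 0 \<noteq> 0"
        using Xmat_eigvec_low(2)[of d a 0 "\<lambda>x. c d x - r * w x"] inj V n by blast
      then show False using w00 by (simp add: r_def)
    qed
    then have "c d = (\<lambda>x. r * w x)" by (auto simp: fun_eq_iff)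
    then have cd: "c d \<in> U" using csub_scale[OF csU wU] by simp
    have Y0: "?Y (unit_vec 0) x = ?s 0 * unit_vec 0 x" for x
      by (auto simp: Ymat_def unit_vec_def)
    have XZ0: "\<epsilon> * ?X (unit_vec 0) x + \<epsilon> * ?Z (unit_vec 0) x = (?t2 0 + D2 0) * unit_vec 0 x" for x
      unfolding D0 by (cases "x = 0"; cases "x = 1") (auto simp: Xmat_def Zmat_def unit_vec_def algebra_simps)
    \<comment> \<open>Y steps down the second chain with the nonzero coefficients
      \<open>\<phi>2\<close>, which leads inside U from \<open>c d\<close> to
      \<open>unit_vec 0\<close>.\<close>
    note Yc = BI_triple.split_chain[OF tri2 data2 eV Y0 XZ0, folded c_def, THEN conjunct1]
    have "c 0 \<in> U"
    proof (rule inc_induct[of 0 d "\<lambda>k. c k \<in> U"])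
      fix k assume k: "0 \<le> k" "k < d" "c (Suc k) \<in> U"
      have "c k = (\<lambda>x. inverse (\<phi>2 (Suc k)) * (?Y (c (Suc k)) x - ?s (Suc k) * c (Suc k) x))"
        using Yc[of "Suc k"] nz(2)[of "Suc k"] k by (auto simp: field_simps)
      moreover have "\<dots> \<in> U" by (intro csub_scale[OF csU] csub_diff_scale[OF csU] clY k)
      ultimately show "c k \<in> U" by simp
    qed (use cd in auto)
    then have "unit_vec 0 \<in> U" by (simp add: c_def)
    from bidiag_generate[OF csU UV clX this] show ?thesis by simp
  qed simp
qed


section \<open>Isomorphisms, sign changes and an eigenvector of Z\<close>

lemma bi_isoE:
  assumes "bi_iso S W T V"
  obtains f where "lin_on S f \<and> f ` S = T \<and> (\<forall>u\<in>S. f u = (\<lambda>_. 0) \<longleftrightarrow> u \<in> {\<lambda>_. 0})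
      \<and> (\<forall>g\<in>{1,2,3}. \<forall>u\<in>S. f (W g u) = V g (f u))"
  using assms unfolding bi_iso_def bi_quot_iso_def by (elim exE)

lemma bi_iso_sym:
  assumes "bi_iso S W T V" "csub S" "\<And>g v. g \<in> {1,2,3} \<Longrightarrow> v \<in> S \<Longrightarrow> W g v \<in> S"
  shows "bi_iso T V S W"
proof -
  obtain f where f': "lin_on S f \<and> f ` S = T \<and> (\<forall>u\<in>S. f u = (\<lambda>_. 0) \<longleftrightarrow> u \<in> {\<lambda>_. 0})
      \<and> (\<forall>g\<in>{1,2,3}. \<forall>u\<in>S. f (W g u) = V g (f u))"
    by (rule bi_isoE[OF assms(1)])
  then have f: "lin_on S f" "f ` S = T" "\<And>u. u \<in> S \<Longrightarrow> f u = (\<lambda>_. 0) \<longleftrightarrow> u = (\<lambda>_. 0)"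
    and fW: "\<And>g u. g \<in> {1,2,3} \<Longrightarrow> u \<in> S \<Longrightarrow> f (W g u) = V g (f u)"
    by blast+
  have inj: "inj_on f S"
  proof (rule inj_onI)
    fix u v assume uv: "u \<in> S" "v \<in> S" "f u = f v"
    have "f (\<lambda>x. u x - 1 * v x) = (\<lambda>_. 0)"
      using lin_on_diff_scale[OF f(1) uv(1,2), of 1] uv(3) by auto
    then have "(\<lambda>x. u x - 1 * v x) = (\<lambda>_. 0)"
      using f(3) csub_diff_scale[OF assms(2) uv(1,2), of 1] by simp
    then show "u = v" by (auto simp: fun_eq_iff)
  qed
  define h where "h = inv_into S f"
  have hS: "h y \<in> S" "f (h y) = y" if "y \<in> T" for y
    using that f(2) inv_into_into[of y f S] f_inv_into_f[of y f S] by (auto simp: h_def)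
  have hf: "h (f u) = u" if "u \<in> S" for u using inv_into_f_f[OF inj that] by (simp add: h_def)
  have "lin_on T h"
    unfolding lin_on_def
  proof (intro ballI allI)
    fix u v c assume uv: "u \<in> T" "v \<in> T"
    have "(\<lambda>x. u x + c * v x) = f (\<lambda>y. h u y + c * h v y)"
      using lin_on_add_scale[OF f(1) hS(1)[OF uv(1)] hS(1)[OF uv(2)], of c] uv hS(2) by auto
    then show "h (\<lambda>x. u x + c * v x) = (\<lambda>y. h u y + c * h v y)"
      using hf[OF csub_add_scale[OF assms(2) hS(1)[OF uv(1)] hS(1)[OF uv(2)], of c]] by simp
  qed
  moreover have "h ` T = S" using hS hf f(2) by force
  moreover have "h y = (\<lambda>_. 0) \<longleftrightarrow> y \<in> {\<lambda>_. 0}" if "y \<in> T" for y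
  proof -
    have "y = (\<lambda>_. 0) \<longleftrightarrow> f (h y) = (\<lambda>_. 0)" using hS that by simp
    then show ?thesis using f(3)[OF hS(1)[OF that]] by simp
  qed
  moreover have "h (V g y) = W g (h y)" if "g \<in> {1,2,3}" "y \<in> T" for g y
    using hf[OF assms(3)[OF that(1) hS(1)[OF that(2)]]] fW[OF that(1) hS(1)[OF that(2)]] hS(2)[OF that(2)] by simp
  ultimately show ?thesis unfolding bi_iso_def bi_quot_iso_def by (intro exI[of _ h]) simp
qed

lemma bi_irredD:
  assumes "bi_irred S W" "U \<subseteq> S" "csub U" "\<And>g u. g \<in> {1,2,3} \<Longrightarrow> u \<in> U \<Longrightarrow> W g u \<in> U"
  shows "U = {\<lambda>_. 0} \<or> U = S"
  using assms(1)[unfolded bi_irred_def, THEN conjunct2, rule_format, of U] assms(2-4) by auto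

lemma bi_irred_multiples:
  assumes "bi_irred S W" "\<And>g. g \<in> {1,2,3} \<Longrightarrow> \<exists>h\<in>{1,2,3}. \<exists>s. \<forall>v\<in>S. W g v = (\<lambda>x. s * W' h v x)"
  shows "bi_irred S W'"
  unfolding bi_irred_def
proof (intro conjI allI impI)
  show "S \<noteq> {\<lambda>_. 0}" using assms(1) by (simp add: bi_irred_def)
next
  fix U assume U: "U \<subseteq> S \<and> csub U \<and> (\<forall>g\<in>{1,2,3}. \<forall>u\<in>U. W' g u \<in> U)"
  have "W g u \<in> U" if g: "g \<in> {1,2,3}" and "u \<in> U" for g u
  proof -
    obtain h s where hs: "h \<in> {1,2,3}" "\<forall>v\<in>S. W g v = (\<lambda>x. s * W' h v x)" using assms(2)[OF g] by blast
    have "W' h u \<in> U" "u \<in> S" using U hs that by auto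
    then show ?thesis using hs(2) csub_scale[of U "W' h u" s] U by simp
  qed
  then show "U = {\<lambda>_. 0} \<or> U = S" using U by (intro bi_irredD[OF assms(1)]) auto
qed

text \<open>For sign twists: equal signs on both sides leave the intertwiner unchanged.\<close>

lemma bi_iso_multiples:
  assumes "bi_iso S W T V" "csub S" "\<And>g v. g \<in> {1,2,3} \<Longrightarrow> v \<in> S \<Longrightarrow> W g v \<in> S"
    and "\<And>g v. g \<in> {1,2,3} \<Longrightarrow> v \<in> S \<Longrightarrow> W' g v = (\<lambda>x. s g * W g v x)"
    and "\<And>g v. g \<in> {1,2,3} \<Longrightarrow> v \<in> T \<Longrightarrow> V' g v = (\<lambda>x. s g * V g v x)"
  shows "bi_iso S W' T V'"
proof -
  obtain f where f': "lin_on S f \<and> f ` S = T \<and> (\<forall>u\<in>S. f u = (\<lambda>_. 0) \<longleftrightarrow> u \<in> {\<lambda>_. 0})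
      \<and> (\<forall>g\<in>{1,2,3}. \<forall>u\<in>S. f (W g u) = V g (f u))"
    by (rule bi_isoE[OF assms(1)])
  then have f: "lin_on S f" "f ` S = T" "\<And>u. u \<in> S \<Longrightarrow> f u = (\<lambda>_. 0) \<longleftrightarrow> u = (\<lambda>_. 0)"
    and fW: "\<And>g u. g \<in> {1,2,3} \<Longrightarrow> u \<in> S \<Longrightarrow> f (W g u) = V g (f u)"
    by blast+
  have "f (W' g u) = V' g (f u)" if "g \<in> {1,2,3}" "u \<in> S" for g u
  proof -
    have "f u \<in> T" using f(2) that by auto
    then show ?thesis
      using lin_on_scale[OF f(1) assms(2) assms(3)[OF that]] assms(4)[OF that] assms(5)[OF that(1)] fW[OF that]
      by auto
  qed
  then show ?thesis unfolding bi_iso_def bi_quot_iso_def using f by (intro exI[of _ f]) simp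
qed

lemma bimod_Vd:
  assumes "g \<in> {1,2,3}" "v \<in> Vd d"
  shows "bimod d a b \<phi> z g v \<in> Vd d"
  using assms by (auto simp: bimod_def Vd_def Xmat_def Ymat_def)

text \<open>If z_(j-1) = P_j z_j, then in row j the subdiagonal of X contributes P_j z_j, and by the
  factorization of \<open>\<phi>\<close> the superdiagonal of Y contributes Q_j z_j. So X + Y and Z
  multiply each coordinate of z by a number, and the last two hypotheses make these numbers
  independent of j.\<close>

lemma Zmat_eigvec:
  assumes P0: "P 0 = 0" and Qd: "Q d = 0" and PQ: "\<And>j. \<phi> (Suc j) = Q j * P (Suc j)"
    and sum: "\<And>j. thetaf d a j + thetaf d b j = \<mu> - P j - Q j"
    and diff: "\<And>j. D j = \<nu> - (-1) ^ j * (P j - Q j)"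
  shows "\<exists>z\<in>Vd d. z \<noteq> (\<lambda>_. 0) \<and> (\<forall>x. Zmat d \<phi> D z x = \<nu> * z x)
    \<and> (\<forall>x. Xmat d a z x + Ymat d b \<phi> z x = \<mu> * z x)"
proof -
  \<comment> \<open>Built from z_d = 1 by multiplication only, so z is nonzero even if some P_j
    vanish.\<close>
  define z where "z = (\<lambda>j. if j \<le> d then \<Prod>l\<in>{j<..d}. P l else 0)"
  have zV: "z \<in> Vd d" by (auto simp: z_def Vd_def)
  have "z d = 1" by (simp add: z_def)
  then have z0: "z \<noteq> (\<lambda>_. 0)" by force
  have zP: "z j = P (Suc j) * z (Suc j)" if "Suc j \<le> d" for j
  proof -
    have "{j<..d} = insert (Suc j) {Suc j<..d}" using that by auto
    then show ?thesis using that by (simp add: z_def)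
  qed
  have prev: "(if 1 \<le> j then z (j - 1) else 0) = P j * z j" if "j \<le> d" for j
    using zP[of "j - 1"] that P0 by (cases j) auto
  have nxt: "\<phi> (Suc j) * z (Suc j) = Q j * z j" if "j \<le> d" for j
  proof (cases "j = d")
    case True
    then show ?thesis using Qd zV by (simp add: Vd_def)
  next
    case False
    then show ?thesis using that zP[of j] by (simp add: PQ)
  qed
  have Z: "Zmat d \<phi> D z x = \<nu> * z x" for x
  proof (cases "x \<le> d")
    case True
    then show ?thesis by (simp only: Zmat_coord[OF zV] prev nxt diff) algebra
  qed (use zV in \<open>simp add: Zmat_def Vd_def\<close>)
  have XY: "Xmat d a z x + Ymat d b \<phi> z x = \<mu> * z x" for x
  proof (cases "x \<le> d")
    case True
    have "Xmat d a z x + Ymat d b \<phi> z x = (thetaf d a x + thetaf d b x) * z x + P x * z x + Q x * z x"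
      using True by (simp only: Xmat_coord Ymat_coord[OF zV] prev nxt) algebra
    then show ?thesis unfolding sum by algebra
  qed (use zV in \<open>simp add: Xmat_def Ymat_def Vd_def\<close>)
  show ?thesis using zV z0 Z XY by blast
qed

section \<open>Dimension count on \<open>Vd d\<close> and Schur's lemma\<close>

interpretation fvs: vector_space "\<lambda>(c::complex) (v :: nat \<Rightarrow> complex). (\<lambda>x. c * v x)"
  by unfold_locales (auto simp: algebra_simps fun_eq_iff)

lemma sum_fun_apply: "(\<Sum>i\<in>I. f i) x = (\<Sum>i\<in>I. f i x)" for f :: "'b \<Rightarrow> 'a \<Rightarrow> complex"
  by (induction I rule: infinite_finite_induct) auto

lemma unit_vec_Vd: "i \<le> d \<Longrightarrow> unit_vec i \<in> Vd d"
  by (auto simp: unit_vec_def Vd_def)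

lemma inj_unit_vec: "inj unit_vec"
proof (rule injI)
  fix i j :: nat assume "unit_vec i = unit_vec j"
  then have "unit_vec i i = unit_vec j i" by simp
  then show "i = j" by (simp add: unit_vec_def split: if_splits)
qed

lemma subspace_csub: "csub S \<Longrightarrow> fvs.subspace S"
proof (rule fvs.subspaceI)
  assume S: "csub S"
  show "0 \<in> S" using S by (simp add: csub_def zero_fun_def)
  show "x + y \<in> S" if "x \<in> S" "y \<in> S" for x y using csub_add[OF S that] by (simp add: plus_fun_def)
  show "(\<lambda>i. c * x i) \<in> S" if "x \<in> S" for c x by (rule csub_scale[OF S that])
qed

lemma independent_units: "fvs.independent (unit_vec ` {..d})"
proof (rule fvs.independent_if_scalars_zero)
  fix f x assume s: "(\<Sum>x\<in>unit_vec ` {..d}. (\<lambda>y. f x * x y)) = 0" and "x \<in> unit_vec ` {..d}"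
  then obtain j where j: "j \<le> d" "x = unit_vec j" by auto
  have "(\<Sum>i\<in>{..d}. (\<lambda>y. f (unit_vec i) * unit_vec i y)) = 0"
    using s by (subst (asm) sum.reindex) (auto intro: inj_on_subset[OF inj_unit_vec] simp: o_def)
  from fun_cong[OF this, of j] have "(\<Sum>i\<in>{..d}. f (unit_vec i) * unit_vec i j) = 0"
    unfolding sum_fun_apply zero_fun_apply .
  then show "f x = 0" using j by (simp add: unit_vec_def if_distrib[of "(*) _"] cong: if_cong)
qed simp

lemma lin_on_Vd_expand:
  assumes "lin_on (Vd d) h" "v \<in> Vd d"
  shows "h v = (\<Sum>i\<in>{..d}. (\<lambda>y. v i * h (unit_vec i) y))"
proof -
  have "h v = h (\<lambda>x. \<Sum>i\<in>{..d}. v i * unit_vec i x)" using Vd_expand[OF assms(2)] by simp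
  also have "\<dots> = (\<lambda>y. \<Sum>i\<in>{..d}. v i * h (unit_vec i) y)"
    using lin_on_sum[OF assms(1) Vd_csub, of "{..d}" unit_vec v] unit_vec_Vd by auto
  finally show ?thesis by (auto simp: fun_eq_iff sum_fun_apply)
qed

lemma Vd_subset_span: "Vd d \<subseteq> fvs.span (unit_vec ` {..d})"
proof
  fix v assume v: "v \<in> Vd d"
  have "v = (\<Sum>i\<in>{..d}. (\<lambda>y. v i * unit_vec i y))"
  proof
    fix x show "v x = (\<Sum>i\<in>{..d}. (\<lambda>y. v i * unit_vec i y)) x"
      using fun_cong[OF Vd_expand[OF v], of x] unfolding sum_fun_apply .
  qed
  moreover have "(\<Sum>i\<in>{..d}. (\<lambda>y. v i * unit_vec i y)) \<in> fvs.span (unit_vec ` {..d})"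
    by (intro fvs.span_sum fvs.span_scale fvs.span_base) auto
  ultimately show "v \<in> fvs.span (unit_vec ` {..d})" by simp
qed

text \<open>The d + 1 images of the unit vectors are independent; a vector outside their span would
  give d + 2 independent vectors in \<open>Vd d\<close>.\<close>

lemma Vd_inj_imp_surj:
  assumes lin: "lin_on (Vd d) h" and maps: "\<And>v. v \<in> Vd d \<Longrightarrow> h v \<in> Vd d"
    and inj: "\<And>v. v \<in> Vd d \<Longrightarrow> h v = (\<lambda>_. 0) \<Longrightarrow> v = (\<lambda>_. 0)"
  shows "h ` Vd d = Vd d"
proof -
  let ?c = "\<lambda>i. h (unit_vec i)"
  have comb: "\<forall>i\<le>d. v i = 0" if "(\<Sum>i\<in>{..d}. (\<lambda>y. v i * ?c i y)) = 0" for v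
  proof -
    define v' where "v' = (\<lambda>i. if i \<le> d then v i else 0)"
    have v': "v' \<in> Vd d" by (auto simp: v'_def Vd_def)
    have "h v' = (\<Sum>i\<in>{..d}. (\<lambda>y. v i * ?c i y))"
      unfolding lin_on_Vd_expand[OF lin v'] by (rule sum.cong) (auto simp: v'_def)
    then have "h v' = (\<lambda>_. 0)" using that by (simp add: zero_fun_def)
    then have "v' = (\<lambda>_. 0)" by (rule inj[OF v'])
    then have "v' i = 0" for i by simp
    then show ?thesis unfolding v'_def by presburger
  qed
  have injc: "inj_on ?c {..d}"
  proof (rule inj_onI)
    fix i j assume ij: "i \<in> {..d}" "j \<in> {..d}" "?c i = ?c j"
    then have V: "unit_vec i \<in> Vd d" "unit_vec j \<in> Vd d" by (auto intro: unit_vec_Vd)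
    have "h (\<lambda>x. unit_vec i x - 1 * unit_vec j x) = (\<lambda>_. 0)"
      using lin_on_diff_scale[OF lin V, of 1] ij(3) by auto
    then have "(\<lambda>x. unit_vec i x - 1 * unit_vec j x) = (\<lambda>_. 0)"
      by (rule inj[OF csub_diff_scale[OF Vd_csub V]])
    then have "unit_vec i = unit_vec j" by (auto simp: fun_eq_iff)
    then show "i = j" using inj_unit_vec by (simp add: inj_eq)
  qed
  have ind: "fvs.independent (?c ` {..d})"
  proof (rule fvs.independent_if_scalars_zero)
    fix f x assume "(\<Sum>x\<in>?c ` {..d}. (\<lambda>y. f x * x y)) = 0" and x: "x \<in> ?c ` {..d}"
    then have "(\<Sum>i\<in>{..d}. (\<lambda>y. f (?c i) * ?c i y)) = 0"
      by (subst (asm) sum.reindex[OF injc]) (simp add: o_def)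
    from comb[OF this] x show "f x = 0" by auto
  qed simp
  have "y \<in> h ` Vd d" if y: "y \<in> Vd d" for y
  proof -
    have "y \<in> fvs.span (?c ` {..d})"
    proof (rule ccontr)
      assume ny: "y \<notin> fvs.span (?c ` {..d})"
      then have i: "fvs.independent (insert y (?c ` {..d}))" using fvs.independent_insertI[OF ny ind] by simp
      have "insert y (?c ` {..d}) \<subseteq> fvs.span (unit_vec ` {..d})"
        using y maps unit_vec_Vd Vd_subset_span by blast
      then have "card (insert y (?c ` {..d})) \<le> card (unit_vec ` {..d})"
        using fvs.independent_span_bound[of "unit_vec ` {..d}", OF _ i] by simp
      moreover have "y \<notin> ?c ` {..d}"
      proof
        assume "y \<in> ?c ` {..d}"
        from fvs.span_base[OF this] ny show False by contradiction
      qed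
      ultimately show False
        using card_image[OF injc] card_image[OF inj_on_subset[OF inj_unit_vec], of "{..d}"] by simp
    qed
    moreover have "csub (h ` Vd d)" by (rule csub_image[OF lin Vd_csub Vd_csub order_refl])
    moreover have "?c ` {..d} \<subseteq> h ` Vd d" using unit_vec_Vd by auto
    ultimately show ?thesis using fvs.span_minimal[OF _ subspace_csub] by blast
  qed
  then show ?thesis using maps by auto
qed

text \<open>A kernel vector with a nonzero coordinate j lets the images of the other d unit vectors
  span all of \<open>Vd d\<close>.\<close>

lemma Vd_surj_imp_inj:
  assumes lin: "lin_on (Vd d) h" and surj: "h ` Vd d = Vd d" and u: "u \<in> Vd d" "h u = (\<lambda>_. 0)"
  shows "u = (\<lambda>_. 0)"
proof (rule ccontr)
  assume "u \<noteq> (\<lambda>_. 0)"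
  then obtain j where "u j \<noteq> 0" by auto
  then have j: "u j \<noteq> 0" "j \<le> d" using u(1) by (auto simp: Vd_def not_less[symmetric])
  let ?I = "(\<lambda>i. h (unit_vec i)) ` ({..d} - {j})"
  have "Vd d \<subseteq> fvs.span ?I"
  proof
    fix y assume "y \<in> Vd d"
    then obtain v where v: "v \<in> Vd d" "y = h v" using surj by blast
    define v' where "v' = (\<lambda>x. v x - (v j / u j) * u x)"
    have v': "v' \<in> Vd d" unfolding v'_def by (rule csub_diff_scale[OF Vd_csub v(1) u(1)])
    have "h v' = y"
      unfolding v'_def using lin_on_diff_scale[OF lin v(1) u(1), of "v j / u j"] u(2) v(2) by auto
    then have "y = (\<Sum>i\<in>{..d}. (\<lambda>y. v' i * h (unit_vec i) y))" using lin_on_Vd_expand[OF lin v'] by simp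
    also have "\<dots> = (\<Sum>i\<in>{..d} - {j}. (\<lambda>y. v' i * h (unit_vec i) y))"
      using j by (intro sum.mono_neutral_right) (auto simp: v'_def fun_eq_iff)
    also have "\<dots> \<in> fvs.span ?I" by (intro fvs.span_sum fvs.span_scale fvs.span_base) auto
    finally show "y \<in> fvs.span ?I" .
  qed
  then have "unit_vec ` {..d} \<subseteq> fvs.span ?I" using unit_vec_Vd by blast
  then have "card (unit_vec ` {..d}) \<le> card ?I"
    using fvs.independent_span_bound[of ?I, OF _ independent_units] by simp
  also have "\<dots> \<le> card ({..d} - {j})" by (rule card_image_le) simp
  finally show False
    using card_image[OF inj_on_subset[OF inj_unit_vec], of "{..d}"] j by simp
qed

text \<open>Source and target have the same dimension, so irreducibility of either suffices: an
  irreducible source forces a trivial kernel, an irreducible target a full image, and each implies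
  bijectivity.\<close>

lemma schur_Vd:
  assumes irr: "bi_irred (Vd d) W \<or> bi_irred (Vd d) V"
    and h: "lin_on (Vd d) h" "\<And>v. v \<in> Vd d \<Longrightarrow> h v \<in> Vd d" "\<exists>v\<in>Vd d. h v \<noteq> (\<lambda>_. 0)"
    and hW: "\<And>g v. g \<in> {1,2,3} \<Longrightarrow> v \<in> Vd d \<Longrightarrow> h (W g v) = V g (h v)"
    and clW: "\<And>g v. g \<in> {1,2,3} \<Longrightarrow> v \<in> Vd d \<Longrightarrow> W g v \<in> Vd d"
    and V0: "\<And>g. g \<in> {1,2,3} \<Longrightarrow> V g (\<lambda>_. 0) = (\<lambda>_. 0)"
  shows "bi_iso (Vd d) W (Vd d) V"
proof -
  have h0: "h (\<lambda>_. 0) = (\<lambda>_. 0)" by (rule lin_on_zero[OF h(1) Vd_csub])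
  have S0: "(\<lambda>_. 0) \<in> Vd d" by (simp add: Vd_def)
  have surj: "h ` Vd d = Vd d"
    using irr
  proof
    assume irr: "bi_irred (Vd d) W"
    define K where "K = {v \<in> Vd d. h v = (\<lambda>_. 0)}"
    have "csub K"
      unfolding csub_def K_def using S0 h0 csub_add_scale[OF Vd_csub] lin_on_add_scale[OF h(1)] by auto
    moreover have "W g v \<in> K" if "g \<in> {1,2,3}" "v \<in> K" for g v
      using that hW clW V0 by (auto simp: K_def)
    ultimately have "K = {\<lambda>_. 0} \<or> K = Vd d"
      by (intro bi_irredD[OF irr]) (auto simp: K_def)
    then have K: "K = {\<lambda>_. 0}" using h(3) by (auto simp: K_def)
    show ?thesis by (rule Vd_inj_imp_surj[OF h(1,2)]) (use K in \<open>auto simp: K_def\<close>)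
  next
    assume irr: "bi_irred (Vd d) V"
    have "csub (h ` Vd d)" by (rule csub_image[OF h(1) Vd_csub Vd_csub order_refl])
    moreover have "V g y \<in> h ` Vd d" if "g \<in> {1,2,3}" "y \<in> h ` Vd d" for g y
    proof -
      from that(2) obtain v where "v \<in> Vd d" "y = h v" by blast
      then show ?thesis using hW[OF that(1)] clW[OF that(1)] by (metis imageI)
    qed
    moreover have "h ` Vd d \<subseteq> Vd d" using h(2) by auto
    ultimately have "h ` Vd d = {\<lambda>_. 0} \<or> h ` Vd d = Vd d"
      by (intro bi_irredD[OF irr])
    then show ?thesis using h(3) by blast
  qed
  moreover have "h u = (\<lambda>_. 0) \<longleftrightarrow> u \<in> {\<lambda>_. 0}" if "u \<in> Vd d" for u
    using Vd_surj_imp_inj[OF h(1) surj that] h0 by auto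
  ultimately show ?thesis
    unfolding bi_iso_def bi_quot_iso_def using h(1) hW by (intro exI[of _ h] conjI) auto
qed

text \<open>Sending v_i to the chain member c_i is an intertwiner: \<open>split_chain\<close> gives
  Y, the end of the chain after d + 1 steps gives X on v_d, and Z follows from {X,Y}. This map
  starts at \<open>bimod\<close>; it is inverted at the end.\<close>

lemma BI_triple_iso_bimod:
  assumes tri: "BI_triple (Vd d) X Y Z \<zeta> \<xi> \<eta>" and data: "split_data d a b \<phi> D \<zeta> \<xi> \<eta>'"
    and v: "v \<in> Vd d" "v \<noteq> (\<lambda>_. 0)"
    and Yv: "\<And>x. Y v x = thetaf d b 0 * v x"
    and XZv: "\<And>x. X v x + Z v x = (thetaf d a 0 + D 0) * v x"
    and last: "chain X (thetaf d a) v (Suc d) = (\<lambda>_. 0)"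
    and W: "\<And>u. u \<in> Vd d \<Longrightarrow> W 1 u = X u" "\<And>u. u \<in> Vd d \<Longrightarrow> W 2 u = Y u" "\<And>u. u \<in> Vd d \<Longrightarrow> W 3 u = Z u"
    and irr: "bi_irred (Vd d) W \<or> bi_irred (Vd d) (bimod d a b \<phi> \<zeta>)"
  shows "bi_iso (Vd d) W (Vd d) (bimod d a b \<phi> \<zeta>)"
proof -
  interpret BI_triple "Vd d" X Y Z \<zeta> \<xi> \<eta> by (rule tri)
  define c where "c = chain X (thetaf d a) v"
  define h where "h u = (\<lambda>x. \<Sum>i\<in>{..d}. u i * c i x)" for u :: "nat \<Rightarrow> complex"
  have cV: "c i \<in> Vd d" for i unfolding c_def by (rule chain_closed[OF v(1)])
  have hV: "h u \<in> Vd d" for u unfolding h_def by (rule csub_sum[OF Vd_csub]) (use cV in auto)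
  have h_op: "f (h u) = (\<lambda>x. \<Sum>i\<in>{..d}. u i * f (c i) x)" if "lin_on (Vd d) f" for f :: "(nat \<Rightarrow> complex) \<Rightarrow> nat \<Rightarrow> complex" and u
    using lin_on_sum[OF that Vd_csub, of "{..d}" c u] cV by (simp add: h_def)
  have Xc: "X (c i) x = thetaf d a i * c i x + c (Suc i) x" for i x by (simp add: c_def)
  have Yc: "Y (c i) x = thetaf d b i * c i x + \<phi> i * c (i - 1) x" for i x
    using split_chain[OF data v(1) Yv XZv, folded c_def] by blast
  have cl: "c (Suc d) x = 0" for x using last by (simp add: c_def)
  have p0: "\<phi> 0 = 0" using data by (simp add: split_data_def)
  have hX: "h (Xmat d a u) = X (h u)" if "u \<in> Vd d" for u
  proof
    fix x
    have "h (Xmat d a u) x = (\<Sum>i\<le>d. thetaf d a i * u i * c i x) + (\<Sum>i\<le>d. (if 1 \<le> i then u (i - 1) else 0) * c i x)"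
      by (simp add: h_def Xmat_def algebra_simps flip: sum.distrib)
    also have "(\<Sum>i\<le>d. (if 1 \<le> i then u (i - 1) else 0) * c i x) = (\<Sum>i\<le>d. u i * c (Suc i) x)"
      using sum.atMost_Suc_shift[of "\<lambda>i. (if 1 \<le> i then u (i - 1) else 0) * c i x" d] cl by simp
    finally show "h (Xmat d a u) x = X (h u) x"
      by (simp add: h_op[OF lin(1)] Xc algebra_simps flip: sum.distrib)
  qed
  have hY: "h (Ymat d b \<phi> u) = Y (h u)" if u: "u \<in> Vd d" for u
  proof
    fix x
    have "h (Ymat d b \<phi> u) x = (\<Sum>i\<le>d. thetaf d b i * u i * c i x) + (\<Sum>i\<le>d. \<phi> (Suc i) * u (Suc i) * c i x)"
      by (simp add: h_def Ymat_coord[OF u] algebra_simps flip: sum.distrib)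
    also have "(\<Sum>i\<le>d. \<phi> (Suc i) * u (Suc i) * c i x) = (\<Sum>i\<le>d. \<phi> i * u i * c (i - 1) x)"
      using sum.atMost_Suc_shift[of "\<lambda>i. \<phi> i * u i * c (i - 1) x" d] p0 Vd_Suc[OF u] by simp
    finally show "h (Ymat d b \<phi> u) x = Y (h u) x"
      by (simp add: h_op[OF lin(2)] Yc algebra_simps flip: sum.distrib)
  qed
  have hlin: "lin_on (Vd d) h"
    by (auto simp: lin_on_def h_def algebra_simps sum.distrib sum_distrib_left)
  have hZ: "h (bimod d a b \<phi> \<zeta> 3 u) = Z (h u)" if u: "u \<in> Vd d" for u
  proof
    fix x
    have "bimod d a b \<phi> \<zeta> 3 u = (\<lambda>j. 1 * Xmat d a (Ymat d b \<phi> u) j + 1 * Ymat d b \<phi> (Xmat d a u) j + (-\<zeta>) * u j)"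
      by (simp add: bimod_def)
    then have "h (bimod d a b \<phi> \<zeta> 3 u) x = 1 * X (Y (h u)) x + 1 * Y (X (h u)) x + (-\<zeta>) * h u x"
      using lin_on_comb3[OF hlin Vd_csub Xmat_Vd Ymat_Vd u, of 1 a _ 1 b \<phi> _ "-\<zeta>"]
      by (simp only: hX hY Ymat_Vd Xmat_Vd u)
    then show "h (bimod d a b \<phi> \<zeta> 3 u) x = Z (h u) x"
      using XY[OF hV, of u x] by (simp add: algebra_simps)
  qed
  have "bi_iso (Vd d) (bimod d a b \<phi> \<zeta>) (Vd d) W"
  proof (rule schur_Vd[OF _ hlin])
    show "\<exists>u\<in>Vd d. h u \<noteq> (\<lambda>_. 0)"
    proof
      have "h (unit_vec 0) = v"
        by (auto simp: h_def unit_vec_def c_def if_distrib[of "\<lambda>t. t * _"] cong: if_cong)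
      then show "h (unit_vec 0) \<noteq> (\<lambda>_. 0)" using v by simp
    qed (auto simp: unit_vec_def Vd_def)
    show "h (bimod d a b \<phi> \<zeta> g u) = W g (h u)" if "g \<in> {1,2,3}" "u \<in> Vd d" for g u
    proof -
      have "bimod d a b \<phi> \<zeta> 1 = Xmat d a" "bimod d a b \<phi> \<zeta> 2 = Ymat d b \<phi>" by (simp_all add: bimod_def)
      then show ?thesis using that W[OF hV] hX hY hZ by auto
    qed
    show "W g (\<lambda>_. 0) = (\<lambda>_. 0)" if "g \<in> {1,2,3}" for g
    proof -
      have "(\<lambda>_. 0) \<in> Vd d" by (simp add: Vd_def)
      then show ?thesis using that W lin_on_zero[OF lin(1) sub] lin_on_zero[OF lin(2) sub] lin_on_zero[OF lin(3) sub] by auto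
    qed
  qed (use irr hV bimod_Vd in auto)
  then show ?thesis by (rule bi_iso_sym[OF _ Vd_csub bimod_Vd])
qed

lemma bi_irred_transfer:
  assumes iso: "bi_iso S W T V" and irr: "bi_irred T V" and S: "csub S"
  shows "bi_irred S W"
proof -
  obtain f where f': "lin_on S f \<and> f ` S = T \<and> (\<forall>u\<in>S. f u = (\<lambda>_. 0) \<longleftrightarrow> u \<in> {\<lambda>_. 0})
      \<and> (\<forall>g\<in>{1,2,3}. \<forall>u\<in>S. f (W g u) = V g (f u))"
    by (rule bi_isoE[OF iso])
  then have f: "lin_on S f" "f ` S = T" "\<And>u. u \<in> S \<Longrightarrow> f u = (\<lambda>_. 0) \<longleftrightarrow> u = (\<lambda>_. 0)"
    and fW: "\<And>g u. g \<in> {1,2,3} \<Longrightarrow> u \<in> S \<Longrightarrow> f (W g u) = V g (f u)"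
    by blast+
  have S0: "(\<lambda>_. 0) \<in> S" using S by (simp add: csub_def)
  have f0: "f (\<lambda>_. 0) = (\<lambda>_. 0)" by (rule lin_on_zero[OF f(1) S])
  show ?thesis
    unfolding bi_irred_def
  proof (intro conjI allI impI)
    show "S \<noteq> {\<lambda>_. 0}"
    proof
      assume "S = {\<lambda>_. 0}"
      then have "T = {\<lambda>_. 0}" using f(2) f0 by auto
      then show False using irr by (simp add: bi_irred_def)
    qed
  next
    fix U assume U: "U \<subseteq> S \<and> csub U \<and> (\<forall>g\<in>{1,2,3}. \<forall>u\<in>U. W g u \<in> U)"
    have "csub (f ` U)" using U by (intro csub_image[OF f(1) S]) auto
    moreover have "V g y \<in> f ` U" if g: "g \<in> {1,2,3}" and y: "y \<in> f ` U" for g y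
    proof -
      obtain u where u: "u \<in> U" "y = f u" using y by blast
      then have "V g y = f (W g u)" using fW[OF g] U by auto
      moreover have "W g u \<in> U" using U g u(1) by blast
      ultimately show ?thesis by blast
    qed
    moreover have "f ` U \<subseteq> T" using U f(2) by blast
    ultimately have "f ` U = {\<lambda>_. 0} \<or> f ` U = T"
      by (intro bi_irredD[OF irr])
    then show "U = {\<lambda>_. 0} \<or> U = S"
    proof
      assume 0: "f ` U = {\<lambda>_. 0}"
      have "u = (\<lambda>_. 0)" if "u \<in> U" for u
        using f(3)[of u] 0 that U by blast
      moreover have "(\<lambda>_. 0) \<in> U" using U by (simp add: csub_def)
      ultimately show ?thesis by blast
    next
      assume T: "f ` U = T"
      have "v \<in> U" if v: "v \<in> S" for v
      proof -
        have "f v \<in> f ` U" using T f(2) v by blast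
        then obtain u where u: "u \<in> U" "f v = f u" by blast
        then have uS: "u \<in> S" using U by blast
        have "f (\<lambda>x. v x - 1 * u x) = (\<lambda>_. 0)"
          using lin_on_diff_scale[OF f(1) v uS, of 1] u(2) by auto
        then have "(\<lambda>x. v x - 1 * u x) = (\<lambda>_. 0)"
          using f(3)[OF csub_diff_scale[OF S v uS, of 1]] by simp
        then have "v = u" by (auto simp: fun_eq_iff)
        then show ?thesis using u by simp
      qed
      then show ?thesis using U by blast
    qed
  qed
qed

section \<open>The modules E and O\<close>

text \<open>The diagonal of Z on E_d(a,b,c) in the basis v_i.\<close>

definition E_D :: "complex \<Rightarrow> complex \<Rightarrow> nat \<Rightarrow> complex" where
  "E_D a b i = - 1 / 2 - (-1) ^ i * (a + b)"

definition O_D :: "nat \<Rightarrow> complex \<Rightarrow> nat \<Rightarrow> complex" where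
  "O_D d c i = - 1 / 2 + (-1) ^ i * (c + (of_nat d + 1) / 2)"

text \<open>The scalar of {X,Y} - Z on E_d(a,b,c); permuting a, b, c gives the scalars of the other
  two central elements. Only squares of the parameters occur.\<close>

definition E_cas :: "nat \<Rightarrow> complex \<Rightarrow> complex \<Rightarrow> complex \<Rightarrow> complex" where
  "E_cas d a b c = c ^ 2 - a ^ 2 - b ^ 2 + (of_nat d + 1) ^ 2 / 4"

definition O_cas :: "nat \<Rightarrow> complex \<Rightarrow> complex \<Rightarrow> complex \<Rightarrow> complex" where
  "O_cas d a b c = 2 * a * b - c * (of_nat d + 1)"

lemma E_split:
  assumes "odd d"
  shows "split_data d a b (E_phi d a b c) (E_D a b) (E_cas d a b c) (E_cas d a c b) (E_cas d b c a)"
  unfolding split_data_def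
proof (intro conjI allI)
  fix i
  show "E_phi d a b c (Suc i) + E_phi d a b c i = E_D a b i + E_cas d a b c - 2 * thetaf d a i * thetaf d b i"
    by (cases "even i") (simp_all add: E_phi_def E_D_def E_cas_def thetaf_eq field_simps power2_eq_square)
  show "(-1) ^ i * (E_phi d a b c i - E_phi d a b c (Suc i)) = E_cas d a c b + thetaf d b i - 2 * thetaf d a i * E_D a b i"
    by (cases "even i") (simp_all add: E_phi_def E_D_def E_cas_def thetaf_eq field_simps power2_eq_square)
  show "(-1) ^ i * (E_phi d a b c i - E_phi d a b c (Suc i)) = E_cas d b c a + thetaf d a i - 2 * thetaf d b i * E_D a b i"
    by (cases "even i") (simp_all add: E_phi_def E_D_def E_cas_def thetaf_eq field_simps power2_eq_square)
qed (use assms in \<open>simp_all add: E_phi_def E_D_def\<close>)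

lemma O_split:
  assumes "even d"
  shows "split_data d a b (O_phi d a b c) (O_D d c) (O_cas d a b c) (O_cas d a c b) (O_cas d b c a)"
  unfolding split_data_def
proof (intro conjI allI)
  fix i
  show "O_phi d a b c (Suc i) + O_phi d a b c i = O_D d c i + O_cas d a b c - 2 * thetaf d a i * thetaf d b i"
    by (cases "even i") (simp_all add: O_phi_def O_D_def O_cas_def thetaf_eq field_simps power2_eq_square)
  show "(-1) ^ i * (O_phi d a b c i - O_phi d a b c (Suc i)) = O_cas d a c b + thetaf d b i - 2 * thetaf d a i * O_D d c i"
    by (cases "even i") (simp_all add: O_phi_def O_D_def O_cas_def thetaf_eq field_simps power2_eq_square)
  show "(-1) ^ i * (O_phi d a b c i - O_phi d a b c (Suc i)) = O_cas d b c a + thetaf d a i - 2 * thetaf d b i * O_D d c i"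
    by (cases "even i") (simp_all add: O_phi_def O_D_def O_cas_def thetaf_eq field_simps power2_eq_square)
qed (use assms in \<open>simp_all add: O_phi_def O_D_def\<close>)

section \<open>Distinct eigenvalues, nonzero superdiagonals, irreducibility\<close>

definition th_distinct :: "nat \<Rightarrow> complex \<Rightarrow> bool" where
  "th_distinct d a \<longleftrightarrow> (\<forall>m. odd m \<longrightarrow> m < 2 * d \<longrightarrow> 2 * a \<noteq> of_nat d - of_nat m)"

text \<open>For i + j even, equality would give i = j; for i + j odd it gives 2a = d - (i + j). So m
  in \<open>th_distinct\<close> stands for i + j.\<close>

lemma thetaf_inj:
  assumes "th_distinct d a" "i < j" "j \<le> d"
  shows "thetaf d a i \<noteq> thetaf d a j"
proof
  assume eq: "thetaf d a i = thetaf d a j"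
  show False
  proof (cases "even (i + j)")
    case True
    then have "(-1::complex) ^ i = (-1) ^ j" by (cases "even i") auto
    then have "of_nat i = (of_nat j :: complex)" using eq by (simp add: thetaf_eq)
    then show False using assms(2) by simp
  next
    case False
    then have "(-1::complex) ^ i = - ((-1) ^ j)" by (cases "even i") auto
    then have "(-1) ^ j * (2 * a - of_nat d + of_nat (i + j)) = 0" using eq by (simp add: thetaf_eq algebra_simps)
    then have "2 * a - of_nat d + of_nat (i + j) = 0" by (simp only: mult_eq_0_iff) simp
    then have "2 * a = of_nat d - of_nat (i + j)" by (simp add: algebra_simps)
    then show False using assms(1)[unfolded th_distinct_def, rule_format, OF False] assms(2,3) by simp
  qed
qed

text \<open>A condition symmetric in a, b, c. The superdiagonals for a and for -a are both needed;
  passing from i to d + 1 - i changes the sign of the left-hand number, so these four exclusions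
  control both.\<close>

definition E_generic :: "nat \<Rightarrow> complex \<Rightarrow> complex \<Rightarrow> complex \<Rightarrow> bool" where
  "E_generic d a b c \<longleftrightarrow> (\<forall>i. odd i \<longrightarrow> i \<le> d \<longrightarrow>
     (of_nat d + 1) / 2 - of_nat i \<notin> {a + b + c, a + b - c, a - b + c, - a + b + c})"

text \<open>Even i suffice, because an odd index of the superdiagonal is covered by the even index d
  + 1 - i. The set is invariant under permutations and under negating two parameters, which fits the
  parameters -a, b, -c of the reversed chain.\<close>

definition O_generic :: "nat \<Rightarrow> complex \<Rightarrow> complex \<Rightarrow> complex \<Rightarrow> bool" where
  "O_generic d a b c \<longleftrightarrow> (\<forall>i. even i \<longrightarrow> 1 \<le> i \<longrightarrow> i \<le> d \<longrightarrow>
     (of_nat d + 1) / 2 - of_nat i \<notin> {a + b + c, - a - b + c, - a + b - c, a - b - c})"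

lemma O_generic_perm: "O_generic d a b c \<Longrightarrow> O_generic d b c a"
  unfolding O_generic_def by (simp add: algebra_simps)

lemma E_phi_neq_0:
  assumes "odd d" "E_generic d a b c" "1 \<le> i" "i \<le> d"
  shows "E_phi d a b c i \<noteq> 0" "E_phi d (- a) b c i \<noteq> 0"
proof -
  have odd': "odd (d + 1 - i)" "d + 1 - i \<le> d" "of_nat (d + 1 - i) = (of_nat d + 1 - of_nat i :: complex)" if "odd i"
    using that assms by (auto simp: of_nat_diff)
  define r :: complex where "r = (of_nat d + 1) / 2 - of_nat i"
  have r': "(of_nat d + 1) / 2 - (of_nat d + 1 - of_nat i) = - r" by (simp add: r_def field_simps)
  have ne: "r \<notin> {a + b + c, a + b - c, a - b + c, - a + b + c}"
     "- r \<notin> {a + b + c, a + b - c, a - b + c, - a + b + c}" if "odd i"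
    using assms(2)[unfolded E_generic_def, rule_format, of i]
      assms(2)[unfolded E_generic_def, rule_format, OF odd'(1,2)[OF that]] that assms(4)
    unfolding r_def odd'(3)[OF that] r'[unfolded r_def] by simp_all
  have even: "E_phi d x b c i \<noteq> 0" if "even i" for x
  proof -
    have "of_nat i * of_nat (d - i + 1) \<noteq> (0::complex)" using assms(3) by (simp del: of_nat_add of_nat_Suc)
    moreover have "of_nat d - of_nat i + 1 = (of_nat (d - i + 1) :: complex)" using assms by (simp add: of_nat_diff)
    ultimately show ?thesis using that by (simp add: E_phi_def add.commute)
  qed
  have fac: "E_phi d x b c i = (c - (x + b - r)) * (c + (x + b - r))" if "odd i" for x
    using that by (simp add: E_phi_def r_def field_simps power2_eq_square)
  have odd: "r = x + b - c \<or> r = x + b + c" if "odd i" "E_phi d x b c i = 0" for x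
    using that(2) unfolding fac[OF that(1)] mult_eq_0_iff by (auto simp: algebra_simps)
  show "E_phi d a b c i \<noteq> 0"
    using even odd[of a] ne by blast
  show "E_phi d (- a) b c i \<noteq> 0"
  proof
    assume 0: "E_phi d (- a) b c i = 0"
    then have "odd i" using even by blast
    from odd[OF this 0] have "- r = a - b + c \<or> r = - a + b + c" by auto
    with ne[OF \<open>odd i\<close>] show False by blast
  qed
qed

lemma O_phi_neq_0:
  assumes "even d" "O_generic d a b c" "1 \<le> i" "i \<le> d"
  shows "O_phi d a b c i \<noteq> 0" "O_phi d (- a) b (- c) i \<noteq> 0"
proof -
  define r :: complex where "r = (of_nat d + 1) / 2 - of_nat i"
  have r': "(of_nat d + 1) / 2 - (of_nat d + 1 - of_nat i) = - r" by (simp add: r_def field_simps)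
  have ne: "r \<notin> {a + b + c, - a - b + c, - a + b - c, a - b - c}" if "even i"
    using assms(2)[unfolded O_generic_def, rule_format, of i] that assms(3,4) unfolding r_def by simp
  have odd': "even (d + 1 - i)" "1 \<le> d + 1 - i" "d + 1 - i \<le> d" "of_nat (d + 1 - i) = (of_nat d + 1 - of_nat i :: complex)" if "odd i"
    using that assms by (auto simp: of_nat_diff)
  have ne': "- r \<notin> {a + b + c, - a - b + c, - a + b - c, a - b - c}" if "odd i"
    using assms(2)[unfolded O_generic_def, rule_format, OF odd'(1-3)[OF that]]
    unfolding odd'(4)[OF that] r' .
  have even: "O_phi d x b y i = of_nat i * (r - (x + b + y))" if "even i" for x y
    using that by (simp add: O_phi_def r_def field_simps)
  have odd: "O_phi d x b y i = - (of_nat (d + 1 - i) * (r - (x + b - y)))" if "odd i" for x y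
    unfolding odd'(4)[OF that] using that by (simp add: O_phi_def r_def field_simps)
  have i0: "of_nat i \<noteq> (0::complex)" "of_nat (d + 1 - i) \<noteq> (0::complex)" using assms(3,4) unfolding of_nat_eq_0_iff by simp_all
  have zero: "even i \<and> r = x + b + y \<or> odd i \<and> r = x + b - y" if "O_phi d x b y i = 0" for x y
    using that even[of x y] odd[of x y] i0 by (cases "even i") (simp_all del: of_nat_diff)
  show "O_phi d a b c i \<noteq> 0"
  proof
    assume "O_phi d a b c i = 0"
    from zero[OF this] have "even i \<and> r = a + b + c \<or> odd i \<and> - r = - a - b + c" by auto
    then show False using ne ne' by blast
  qed
  show "O_phi d (- a) b (- c) i \<noteq> 0"
  proof
    assume "O_phi d (- a) b (- c) i = 0"
    from zero[OF this] have "even i \<and> r = - a + b - c \<or> odd i \<and> - r = a - b - c" by auto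
    then show False using ne ne' by blast
  qed
qed

text \<open>For odd d, replacing a by -a reverses the order of the eigenvalues and keeps all central
  scalars, so the second chain is that of E_d(-a,b,c).\<close>

lemma Emod_irreducible:
  assumes "odd d" "E_generic d a b c" "th_distinct d a"
  shows "bi_irred (Vd d) (Emod d a b c)"
  unfolding Emod_def E_cas_def[symmetric]
proof (rule bidiag_irreducible[OF E_split[OF assms(1)], where \<epsilon> = 1])
  show "split_data d (- a) b (E_phi d (- a) b c) (E_D (- a) b) (1 * E_cas d a b c) (E_cas d a c b) (1 * E_cas d b c a)"
    using E_split[OF assms(1), of "- a" b c] by (simp add: E_cas_def)
  show "thetaf d (- a) i = 1 * thetaf d a (d - i)" if "i \<le> d" for i
  proof -
    have "(-1::complex) ^ (d - i) = - ((-1) ^ i)" using that assms(1) by (simp add: minus_one_power_iff)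
    then show ?thesis using that by (simp add: thetaf_eq of_nat_diff algebra_simps)
  qed
  show "thetaf d (- a) 0 + E_D (- a) b 0 = 1 * (thetaf d a 0 + E_D a b 0)"
    by (simp add: thetaf_eq E_D_def)
qed (use E_phi_neq_0[OF assms(1,2)] thetaf_inj[OF assms(3)] in auto)

text \<open>For even d the reversal also negates the eigenvalues; after negating X and Z the second
  chain is that of O_d(-a,b,-c).\<close>

lemma Omod_irreducible:
  assumes "even d" "O_generic d a b c" "th_distinct d a"
  shows "bi_irred (Vd d) (Omod d a b c)"
  unfolding Omod_def O_cas_def[symmetric]
proof (rule bidiag_irreducible[OF O_split[OF assms(1)], where \<epsilon> = "- 1"])
  show "split_data d (- a) b (O_phi d (- a) b (- c)) (O_D d (- c)) (- 1 * O_cas d a b c) (O_cas d a c b) (- 1 * O_cas d b c a)"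
    using O_split[OF assms(1), of "- a" b "- c"] by (simp add: O_cas_def)
  show "thetaf d (- a) i = - 1 * thetaf d a (d - i)" if "i \<le> d" for i
  proof -
    have "(-1::complex) ^ (d - i) = (-1) ^ i" using that assms(1) by (simp add: minus_one_power_iff)
    then show ?thesis using that by (simp add: thetaf_eq of_nat_diff algebra_simps)
  qed
  show "thetaf d (- a) 0 + O_D d (- c) 0 = - 1 * (thetaf d a 0 + O_D d c 0)"
    by (simp add: thetaf_eq O_D_def field_simps)
qed (use O_phi_neq_0[OF assms(1,2)] thetaf_inj[OF assms(3)] in auto)

section \<open>Eigenvectors of Z and permutations of a, b, c\<close>

lemma Emod_eigvec:
  assumes "odd d"
  shows "\<exists>z\<in>Vd d. z \<noteq> (\<lambda>_. 0) \<and> (\<forall>x. Zmat d (E_phi d a b c) (E_D a b) z x = thetaf d c 0 * z x)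
    \<and> (\<forall>x. Xmat d a z x + Ymat d b (E_phi d a b c) z x = (thetaf d a 0 + E_D a c 0) * z x)"
\<comment> \<open>The linear factors of \<open>E_phi\<close> are shared between P and Q so that the
  sum of P_j, Q_j and the two diagonal entries is constant. The eigenvalues are those of the start
  vector of E_d(a,c,b), with Y and Z exchanged.\<close>
proof (rule Zmat_eigvec[where d = d and \<phi> = "E_phi d a b c" and D = "E_D a b" and a = a and b = b
      and \<nu> = "thetaf d c 0" and \<mu> = "thetaf d a 0 + E_D a c 0"
      and P = "\<lambda>j. if even j then - of_nat j else a + b - c - of_nat d / 2 + of_nat j - 1 / 2"
      and Q = "\<lambda>j. if even j then - (a + b + c - of_nat d / 2 + of_nat j + 1 / 2) else of_nat j - of_nat d"])
  let ?P = "\<lambda>j. if even j then - of_nat j else a + b - c - of_nat d / 2 + of_nat j - 1 / 2"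
  let ?Q = "\<lambda>j. if even j then - (a + b + c - of_nat d / 2 + of_nat j + 1 / 2) else of_nat j - of_nat d"
  show "?P 0 = 0" "?Q d = 0" using assms by auto
  fix j
  show "E_phi d a b c (Suc j) = ?Q j * ?P (Suc j)"
    by (simp add: E_phi_def field_simps power2_eq_square)
  show "thetaf d a j + thetaf d b j = thetaf d a 0 + E_D a c 0 - ?P j - ?Q j"
    by (simp add: thetaf_eq E_D_def field_simps)
  show "E_D a b j = thetaf d c 0 - (-1) ^ j * (?P j - ?Q j)"
    by (simp add: thetaf_eq E_D_def field_simps)
qed

text \<open>The eigenvalue a + b of X + Y is symmetric, so the same vector can start a chain of X,
  leading to O_d(a,c,b), and a chain of Y, leading to O_d(b,c,a).\<close>

lemma Omod_eigvec:
  assumes "even d"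
  shows "\<exists>z\<in>Vd d. z \<noteq> (\<lambda>_. 0) \<and> (\<forall>x. Zmat d (O_phi d a b c) (O_D d c) z x = thetaf d c 0 * z x)
    \<and> (\<forall>x. Xmat d a z x + Ymat d b (O_phi d a b c) z x = (a + b) * z x)"
proof (rule Zmat_eigvec[where d = d and \<phi> = "O_phi d a b c" and D = "O_D d c" and a = a and b = b
      and \<nu> = "thetaf d c 0" and \<mu> = "a + b"
      and P = "\<lambda>j. if even j then - of_nat j else a + b - c - of_nat d / 2 + of_nat j - 1 / 2"
      and Q = "\<lambda>j. if even j then of_nat d - of_nat j else a + b + c - of_nat d / 2 + of_nat j + 1 / 2"])
  let ?P = "\<lambda>j. if even j then - of_nat j else a + b - c - of_nat d / 2 + of_nat j - 1 / 2"
  let ?Q = "\<lambda>j. if even j then of_nat d - of_nat j else a + b + c - of_nat d / 2 + of_nat j + 1 / 2"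
  show "?P 0 = 0" "?Q d = 0" using assms by auto
  fix j
  show "O_phi d a b c (Suc j) = ?Q j * ?P (Suc j)"
    by (simp add: O_phi_def field_simps)
  show "thetaf d a j + thetaf d b j = a + b - ?P j - ?Q j"
    by (simp add: thetaf_eq field_simps)
  show "O_D d c j = thetaf d c 0 - (-1) ^ j * (?P j - ?Q j)"
    by (simp add: thetaf_eq O_D_def field_simps)
qed

lemma Emod_coord:
  assumes "odd d" "v \<in> Vd d"
  shows "Emod d a b c 1 v = Xmat d a v" "Emod d a b c 2 v = Ymat d b (E_phi d a b c) v"
    "Emod d a b c 3 v = Zmat d (E_phi d a b c) (E_D a b) v"
  using bimod3_eq_Zmat[OF E_split[OF assms(1), of a b c] assms(2)]
  by (simp_all add: Emod_def bimod_def E_cas_def)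

lemma Omod_coord:
  assumes "even d" "v \<in> Vd d"
  shows "Omod d a b c 1 v = Xmat d a v" "Omod d a b c 2 v = Ymat d b (O_phi d a b c) v"
    "Omod d a b c 3 v = Zmat d (O_phi d a b c) (O_D d c) v"
  using bimod3_eq_Zmat[OF O_split[OF assms(1), of a b c] assms(2)]
  by (simp_all add: Omod_def bimod_def O_cas_def)

lemma bi_irred_twist:
  assumes "bi_irred S W" "\<sigma> ` {1,2,3} = {1,2,3}" "\<And>g. sg g * sg g = 1"
  shows "bi_irred S (twist sg \<sigma> W)"
proof (rule bi_irred_multiples[OF assms(1)])
  fix g :: nat assume "g \<in> {1,2,3}"
  then obtain h where h: "h \<in> {1,2,3}" "g = \<sigma> h" using assms(2) by (metis imageE)
  have "W g v = (\<lambda>x. sg g * twist sg \<sigma> W h v x)" for v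
    using assms(3)[of g] by (simp add: twist_def h(2)) (simp flip: mult.assoc)
  then show "\<exists>h\<in>{1,2,3}. \<exists>s. \<forall>v\<in>S. W g v = (\<lambda>x. s * twist sg \<sigma> W h v x)" using h(1) by blast
qed

lemma perm_surj: "perm23 ` {1,2,3} = {1,2,3}" "perm123 ` {1,2,3} = {1,2,3}"
  by (auto simp: perm23_def perm123_def)

lemma sg_square: "sg_id g * sg_id g = 1" "sg_m1m1 g * sg_m1m1 g = 1"
  by (simp_all add: sg_id_def sg_m1m1_def)

text \<open>In the triple (X,Z,Y) the vector of \<open>Emod_eigvec\<close> plays the part of v_0 in
  E_d(a,c,b), and exchanging b and c exchanges the central scalars accordingly.\<close>

lemma Emod_swap_iso:
  assumes d: "odd d" and gen: "E_generic d a b c" and dist: "th_distinct d a"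
  shows "bi_iso (Vd d) (twist sg_id perm23 (Emod d a b c)) (Vd d) (Emod d a c b)"
proof -
  obtain z where z: "z \<in> Vd d" "z \<noteq> (\<lambda>_. 0)"
    and Z: "\<And>x. Zmat d (E_phi d a b c) (E_D a b) z x = thetaf d c 0 * z x"
    and XY: "\<And>x. Xmat d a z x + Ymat d b (E_phi d a b c) z x = (thetaf d a 0 + E_D a c 0) * z x"
    using Emod_eigvec[OF d, of a b c] by blast
  have irr': "bi_irred (Vd d) (twist sg_id perm23 (Emod d a b c))"
    by (intro bi_irred_twist perm_surj sg_square Emod_irreducible d gen dist)
  have W: "twist sg_id perm23 (Emod d a b c) 1 u = Xmat d a u" "twist sg_id perm23 (Emod d a b c) 2 u = Zmat d (E_phi d a b c) (E_D a b) u"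
    "twist sg_id perm23 (Emod d a b c) 3 u = Ymat d b (E_phi d a b c) u" if "u \<in> Vd d" for u
    using Emod_coord[OF d that, of a b c] by (simp_all add: twist_def sg_id_def perm23_def)
  show ?thesis
    unfolding Emod_def[of d a c b] E_cas_def[symmetric]
    by (rule BI_triple_iso_bimod[OF BI_triple.swap[OF BI_triple_split[OF E_split[OF d, of a b c]]]
          E_split[OF d] z Z XY chain_Xmat_eq_0[OF z(1)] W disjI1[OF irr']])
qed

lemma Omod_swap_iso:
  assumes d: "even d" and irr: "bi_irred (Vd d) (Omod d a b c)"
  shows "bi_iso (Vd d) (twist sg_id perm23 (Omod d a b c)) (Vd d) (Omod d a c b)"
proof -
  obtain z where z: "z \<in> Vd d" "z \<noteq> (\<lambda>_. 0)"
    and Z: "\<And>x. Zmat d (O_phi d a b c) (O_D d c) z x = thetaf d c 0 * z x"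
    and XY: "\<And>x. Xmat d a z x + Ymat d b (O_phi d a b c) z x = (a + b) * z x"
    using Omod_eigvec[OF d, of a b c] by blast
  have m: "a + b = thetaf d a 0 + O_D d b 0" by (simp add: thetaf_eq O_D_def field_simps)
  have irr': "bi_irred (Vd d) (twist sg_id perm23 (Omod d a b c))"
    by (intro bi_irred_twist perm_surj sg_square irr)
  have W: "twist sg_id perm23 (Omod d a b c) 1 u = Xmat d a u" "twist sg_id perm23 (Omod d a b c) 2 u = Zmat d (O_phi d a b c) (O_D d c) u"
    "twist sg_id perm23 (Omod d a b c) 3 u = Ymat d b (O_phi d a b c) u" if "u \<in> Vd d" for u
    using Omod_coord[OF d that, of a b c] by (simp_all add: twist_def sg_id_def perm23_def)
  show ?thesis
    unfolding Omod_def[of d a c b] O_cas_def[symmetric]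
    by (rule BI_triple_iso_bimod[OF BI_triple.swap[OF BI_triple_split[OF O_split[OF d, of a b c]]]
          O_split[OF d] z Z XY[unfolded m] chain_Xmat_eq_0[OF z(1)] W disjI1[OF irr']])
qed

text \<open>The triple is (Y,Z,X), so the chain is one of the upper triangular Y and ends by
  \<open>chain_Ymat_eq_0\<close>. Irreducibility is taken from the target, because b may give
  distinct eigenvalues where a does not.\<close>

lemma Omod_rotate_iso:
  assumes d: "even d" and gen: "O_generic d a b c" and dist: "th_distinct d b"
  shows "bi_iso (Vd d) (twist sg_id perm123 (Omod d a b c)) (Vd d) (Omod d b c a)"
proof -
  obtain z where z: "z \<in> Vd d" "z \<noteq> (\<lambda>_. 0)"
    and Z: "\<And>x. Zmat d (O_phi d a b c) (O_D d c) z x = thetaf d c 0 * z x"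
    and XY: "\<And>x. Xmat d a z x + Ymat d b (O_phi d a b c) z x = (a + b) * z x"
    using Omod_eigvec[OF d, of a b c] by blast
  have m: "a + b = thetaf d b 0 + O_D d a 0" by (simp add: thetaf_eq O_D_def field_simps)
  have YX: "Ymat d b (O_phi d a b c) z x + Xmat d a z x = (thetaf d b 0 + O_D d a 0) * z x" for x
    by (subst m[symmetric], subst add.commute, rule XY)
  have irr: "bi_irred (Vd d) (Omod d b c a)"
    by (rule Omod_irreducible[OF d O_generic_perm[OF gen] dist])
  have data: "split_data d b c (O_phi d b c a) (O_D d a) (O_cas d b c a) (O_cas d a b c) (O_cas d c a b)"
    using O_split[OF d, of b c a] by (simp add: O_cas_def mult_ac)
  note tri = BI_triple.rotate[OF BI_triple_split[OF O_split[OF d, of a b c]]]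
  have W: "twist sg_id perm123 (Omod d a b c) 1 u = Ymat d b (O_phi d a b c) u" "twist sg_id perm123 (Omod d a b c) 2 u = Zmat d (O_phi d a b c) (O_D d c) u"
    "twist sg_id perm123 (Omod d a b c) 3 u = Xmat d a u" if "u \<in> Vd d" for u
    using Omod_coord[OF d that, of a b c] by (simp_all add: twist_def sg_id_def perm123_def)
  show ?thesis
    unfolding Omod_def[of d b c a] O_cas_def[symmetric]
    by (rule BI_triple_iso_bimod[OF tri data z Z YX chain_Ymat_eq_0[OF tri z(1)] W disjI2[OF irr[unfolded Omod_def, folded O_cas_def]]])
qed

section \<open>Restriction to x2 = 0\<close>

text \<open>T_i maps x_i^m to this multiple of x_i^(m-1).\<close>

definition dcoeff :: "real \<Rightarrow> nat \<Rightarrow> complex" where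
  "dcoeff k m = of_nat m + of_real k * (1 - (-1) ^ m)"

lemma dcoeff_0 [simp]: "dcoeff k 0 = 0"
  by (simp add: dcoeff_def)

lemma dcoeff_Suc: "dcoeff k (Suc m) = of_nat m + 1 + of_real k * (1 + (-1) ^ m)"
  by (simp add: dcoeff_def)

lemma tval_eq_enat: "tval k = enat t \<longleftrightarrow> odd t \<and> 2 * k = - real t"
proof (cases "\<exists>m::nat. odd m \<and> 2 * k = - real m")
  case True
  then obtain m :: nat where m: "odd m" "2 * k = - real m" by blast
  then have "- 2 * k = real m" by simp
  then have "tval k = enat m" using m unfolding tval_def by auto
  then show ?thesis using m by auto
qed (auto simp: tval_def)

text \<open>The coefficient is m for even m and m + 2k for odd m. So t_i is its only possible
  positive zero, which is how the t_i enter.\<close>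

lemma dcoeff_eq_0_iff:
  assumes "m \<noteq> 0"
  shows "dcoeff k m = 0 \<longleftrightarrow> tval k = enat m"
proof -
  have "dcoeff k m = of_real (if even m then real m else real m + 2 * k)"
    by (simp add: dcoeff_def)
  then show ?thesis using assms unfolding tval_eq_enat by (auto simp del: of_real_add)
qed

lemma dunkl_eq: "dunkl k i f (s, m) = dcoeff (k i) (Suc (mexp i m)) * f (s, bump i m)"
proof -
  have "mexp i (bump i m) = Suc (mexp i m)"
    by (cases m) (simp add: mexp_def bump_def)
  then show ?thesis by (simp add: dunkl_def pder_def divx_def refl_def dcoeff_def algebra_simps)
qed

lemma Mn_hom: "u \<in> Mn k n \<Longrightarrow> a + b + c \<noteq> n \<Longrightarrow> u (s, (a, b, c)) = 0"
  by (auto simp: Mn_def hom_def mdeg_def)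

lemma dirac_coord:
  "dirac k u (False, (a, b, c)) = dcoeff (k 1) (Suc a) * u (True, (Suc a, b, c))
     - \<i> * dcoeff (k 2) (Suc b) * u (True, (a, Suc b, c)) + dcoeff (k 3) (Suc c) * u (False, (a, b, Suc c))"
  "dirac k u (True, (a, b, c)) = dcoeff (k 1) (Suc a) * u (False, (Suc a, b, c))
     + \<i> * dcoeff (k 2) (Suc b) * u (False, (a, Suc b, c)) - dcoeff (k 3) (Suc c) * u (True, (a, b, Suc c))"
  by (simp_all add: dirac_def pauli_def dunkl_eq mexp_def bump_def)

text \<open>The two components of the Dirac equation solved for the T2 term, ready for recursion on
  the exponent of x2.\<close>

lemma Mn_dirac:
  assumes "u \<in> Mn k n"
  shows "\<i> * dcoeff (k 2) (Suc b) * u (True, (a, Suc b, c))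
      = dcoeff (k 1) (Suc a) * u (True, (Suc a, b, c)) + dcoeff (k 3) (Suc c) * u (False, (a, b, Suc c))"
    "\<i> * dcoeff (k 2) (Suc b) * u (False, (a, Suc b, c))
      = dcoeff (k 3) (Suc c) * u (True, (a, b, Suc c)) - dcoeff (k 1) (Suc a) * u (False, (Suc a, b, c))"
proof -
  have "dirac k u p = 0" for p using assms by (simp add: Mn_def)
  from this[of "(False, (a, b, c))"] this[of "(True, (a, b, c))"]
  show "\<i> * dcoeff (k 2) (Suc b) * u (True, (a, Suc b, c))
      = dcoeff (k 1) (Suc a) * u (True, (Suc a, b, c)) + dcoeff (k 3) (Suc c) * u (False, (a, b, Suc c))"
    "\<i> * dcoeff (k 2) (Suc b) * u (False, (a, Suc b, c))
      = dcoeff (k 3) (Suc c) * u (True, (a, b, Suc c)) - dcoeff (k 1) (Suc a) * u (False, (Suc a, b, c))"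
    unfolding dirac_coord by (simp_all add: algebra_simps)
qed

text \<open>Coordinates of the part free of x2 in the eigenspaces of e1 e3; the sign (-1)^a identifies the
  two eigenspaces through the reflection R1.\<close>
definition restr :: "nat \<Rightarrow> sp \<Rightarrow> bool \<Rightarrow> nat \<Rightarrow> complex" where
  "restr n u s a = (if s then (-1) ^ a * (u (False, (a, 0, n - a)) - \<i> * u (True, (a, 0, n - a)))
      else u (False, (a, 0, n - a)) + \<i> * u (True, (a, 0, n - a)))"

text \<open>The operators that X and Z induce, for odd n, on the sequences
  \<open>restr n u s\<close>; the factor (-1)^a in \<open>restr\<close> makes them equal for both s.
  The coupling to a + 1 vanishes at a + 1 = t1, that of \<open>Zres\<close> to a - 1 at n + 1 - a =
  t3.\<close>

definition Xres :: "(nat \<Rightarrow> real) \<Rightarrow> nat \<Rightarrow> (nat \<Rightarrow> complex) \<Rightarrow> nat \<Rightarrow> complex" where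
  "Xres k n w a = - ((-1) ^ a) * (of_nat n - of_nat a + of_real (k 2) + of_real (k 3) + 1 / 2) * w a
     + \<i> * (-1) ^ a * dcoeff (k 1) (Suc a) * w (Suc a)"

definition Zres :: "(nat \<Rightarrow> real) \<Rightarrow> nat \<Rightarrow> (nat \<Rightarrow> complex) \<Rightarrow> nat \<Rightarrow> complex" where
  "Zres k n w a = (-1) ^ a * (of_nat a + of_real (k 1) + of_real (k 2) + 1 / 2) * w a
     + \<i> * (-1) ^ a * dcoeff (k 3) (Suc n - a) * (if a = 0 then 0 else w (a - 1))"

section \<open>Elements of M_n and their parts free of x2\<close>

lemma restr_lin: "restr n (\<lambda>x. u x + c * v x) s a = restr n u s a + c * restr n v s a"
  by (simp add: restr_def algebra_simps)

lemma restr_above: "u \<in> Mn k n \<Longrightarrow> n < a \<Longrightarrow> restr n u s a = 0"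
  by (simp add: restr_def Mn_hom)

lemma restr_eq_0_iff: "(\<forall>s. restr n u s a = 0) \<longleftrightarrow> (\<forall>s. u (s, (a, 0, n - a)) = 0)"
proof
  assume "\<forall>s. restr n u s a = 0"
  then have "restr n u False a = 0" "restr n u True a = 0" by auto
  then have "u (False, (a, 0, n - a)) + \<i> * u (True, (a, 0, n - a)) = 0" "u (False, (a, 0, n - a)) - \<i> * u (True, (a, 0, n - a)) = 0"
    by (auto simp: restr_def)
  then have "2 * u (False, (a, 0, n - a)) = 0" "2 * \<i> * u (True, (a, 0, n - a)) = 0" by algebra+
  then show "\<forall>s. u (s, (a, 0, n - a)) = 0" by (auto simp: all_bool_eq)
qed (simp add: restr_def)

lemma restr_surj:
  assumes dcoeff2: "\<And>m. 1 \<le> m \<Longrightarrow> m \<le> n \<Longrightarrow> dcoeff (k 2) m \<noteq> 0"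
  shows "\<exists>u\<in>Mn k n. \<forall>s a. a \<le> n \<longrightarrow> restr n u s a = w s a"
proof -
  \<comment> \<open>F b s a c is the coefficient of x1^a x2^b x3^c. For b = 0 it inverts the
    formulas of \<open>restr\<close>; each further power of x2 comes from the Dirac equation,
    dividing by the coefficient of T2.\<close>
  define F where "F = rec_nat (\<lambda>s a c. if s then (w False a - (-1) ^ a * w True a) / (2 * \<i>) else (w False a + (-1) ^ a * w True a) / 2)
    (\<lambda>b f s a (c::nat). if s then (dcoeff (k 1) (Suc a) * f True (Suc a) c + dcoeff (k 3) (Suc c) * f False a (Suc c)) / (\<i> * dcoeff (k 2) (Suc b))
       else (dcoeff (k 3) (Suc c) * f True a (Suc c) - dcoeff (k 1) (Suc a) * f False (Suc a) c) / (\<i> * dcoeff (k 2) (Suc b)))"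
  have F0: "F 0 s a c = (if s then (w False a - (-1) ^ a * w True a) / (2 * \<i>) else (w False a + (-1) ^ a * w True a) / 2)" for s a c
    by (simp add: F_def)
  have FS: "F (Suc b) s a c = (if s then (dcoeff (k 1) (Suc a) * F b True (Suc a) c + dcoeff (k 3) (Suc c) * F b False a (Suc c)) / (\<i> * dcoeff (k 2) (Suc b))
       else (dcoeff (k 3) (Suc c) * F b True a (Suc c) - dcoeff (k 1) (Suc a) * F b False (Suc a) c) / (\<i> * dcoeff (k 2) (Suc b)))" for b s a c
    by (simp add: F_def)
  define u :: sp where "u = (\<lambda>(s, (a, b, c)). if a + b + c = n then F b s a c else 0)"
  have u: "u (s, (a, b, c)) = (if a + b + c = n then F b s a c else 0)" for s a b c by (simp add: u_def)
  have "dirac k u (s, (a, b, c)) = 0" for s a b c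
  proof (cases "Suc (a + b + c) = n")
    case True
    then have "dcoeff (k 2) (Suc b) \<noteq> 0" by (intro dcoeff2) auto
    then show ?thesis using True by (cases s) (simp_all add: dirac_coord u FS)
  qed (cases s; simp add: dirac_coord u)
  then have "u \<in> Mn k n" by (auto simp: Mn_def hom_def mdeg_def u_def fun_eq_iff)
  moreover have "restr n u s a = w s a" if "a \<le> n" for s a
    using that by (auto simp: restr_def u F0 field_simps m1sq)
  ultimately show ?thesis by blast
qed

text \<open>The Dirac equation recovers an element of the kernel from its part free of x2; the zero pattern A
  propagates because Dunkl operators cannot leave it.\<close>
lemma Mn_vanish:
  assumes dcoeff2: "\<And>m. 1 \<le> m \<Longrightarrow> m \<le> n \<Longrightarrow> dcoeff (k 2) m \<noteq> 0" and u: "u \<in> Mn k n"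
    and base: "\<And>s a c. A a c \<Longrightarrow> u (s, (a, 0, c)) = 0"
    and A1: "\<And>a c. A a c \<Longrightarrow> A (Suc a) c \<or> dcoeff (k 1) (Suc a) = 0"
    and A3: "\<And>a c. A a c \<Longrightarrow> A a (Suc c) \<or> dcoeff (k 3) (Suc c) = 0"
  shows "A a c \<Longrightarrow> u (s, (a, b, c)) = 0"
proof (induction b arbitrary: a c s)
  case (Suc b)
  show ?case
  proof (cases "a + Suc b + c = n")
    case True
    then have "dcoeff (k 2) (Suc b) \<noteq> 0" by (intro dcoeff2) auto
    moreover have "dcoeff (k 1) (Suc a) * u (t, (Suc a, b, c)) = 0" "dcoeff (k 3) (Suc c) * u (t, (a, b, Suc c)) = 0" for t
      using A1[OF Suc.prems] A3[OF Suc.prems] Suc.IH by auto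
    then have "\<i> * dcoeff (k 2) (Suc b) * u (s, (a, Suc b, c)) = 0"
      by (cases s) (simp_all only: Mn_dirac[OF u], simp_all)
    ultimately show ?thesis by simp
  qed (use Mn_hom[OF u] in auto)
qed (rule base)

text \<open>At x2 = 0 only x3 T2 survives from x3 T2 - x2 T3, and \<open>Mn_dirac\<close> with b = 0
  rewrites it by T1 and T3. As n is odd, the exponents of x1 and x3 have opposite parity, so R3 acts
  as -(-1)^a.\<close>

lemma restr_X:
  assumes u: "u \<in> Mn k n" and n: "odd n" and a: "a \<le> n"
  shows "restr n (BIops k 1 u) s a = Xres k n (restr n u s) a"
proof -
  define e where "e = (-1::complex) ^ a"
  have e2: "e * e = 1" by (simp add: e_def m1sq)
  have ec: "(-1::complex) ^ (n - a) = - e" using n a by (simp add: e_def minus_one_power_iff)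
  have Xc: "BIops k 1 u (t, (a, 0, n - a)) = \<i> * (if n - a = 0 then 0 else dcoeff (k 2) 1 * - e * u (\<not> t, (a, 1, n - a - 1)))
      - e * (1 / 2 + of_real (k 2)) * u (t, (a, 0, n - a)) + of_real (k 3) * u (t, (a, 0, n - a))" for t
  proof -
    have "(-1::complex) ^ (n - a - 1) * - 1 = - e" if "n - a \<noteq> 0"
      using ec that by (cases "n - a") auto
    then show ?thesis
      using ec by (auto simp: BIops_def gen_def Let_def pauli_def mulx_def dunkl_eq refl_def mexp_def bump_def unbump_def algebra_simps)
  qed
  have b3: "dcoeff (k 3) (n - a) = of_nat n - of_nat a + of_real (k 3) * (1 + e)"
    using a ec by (simp add: dcoeff_def of_nat_diff)
  define p where "p t = u (t, (a, 0, n - a))" for t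
  define q where "q t = u (t, (Suc a, 0, n - Suc a))" for t
  \<comment> \<open>For a = n there is no monomial to multiply by x3; the right-hand side vanishes
    too, since \<open>dcoeff (k 3) 0 = 0\<close> and q is taken outside degree n.\<close>
  have dF: "\<i> * (if n - a = 0 then 0 else dcoeff (k 2) 1 * - e * u (True, (a, 1, n - a - 1)))
      = - e * (dcoeff (k 1) (Suc a) * q True + dcoeff (k 3) (n - a) * p False)"
    and dT: "\<i> * (if n - a = 0 then 0 else dcoeff (k 2) 1 * - e * u (False, (a, 1, n - a - 1)))
      = - e * (dcoeff (k 3) (n - a) * p True - dcoeff (k 1) (Suc a) * q False)"
  proof -
    have "n - a = 0 \<Longrightarrow> q t = 0" for t unfolding q_def using Mn_hom[OF u, of "Suc a" 0 "n - Suc a"] by simp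
    moreover have "\<i> * dcoeff (k 2) 1 * u (True, (a, 1, n - a - 1)) = dcoeff (k 1) (Suc a) * q True + dcoeff (k 3) (n - a) * p False"
      "\<i> * dcoeff (k 2) 1 * u (False, (a, 1, n - a - 1)) = dcoeff (k 3) (n - a) * p True - dcoeff (k 1) (Suc a) * q False" if "n - a \<noteq> 0"
      using Mn_dirac[OF u, of 0 a "n - a - 1"] that by (simp_all add: p_def q_def Suc_diff_Suc)
    moreover have "\<i> * (if n - a = 0 then 0 else B * - e * U) = - e * R"
      if "n - a = 0 \<Longrightarrow> R = 0" "n - a \<noteq> 0 \<Longrightarrow> \<i> * B * U = R" for B U R
      using that by (cases "n - a = 0") auto
    moreover have "n - a = 0 \<Longrightarrow> dcoeff (k 3) (n - a) = 0" by simp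
    ultimately show "\<i> * (if n - a = 0 then 0 else dcoeff (k 2) 1 * - e * u (True, (a, 1, n - a - 1)))
      = - e * (dcoeff (k 1) (Suc a) * q True + dcoeff (k 3) (n - a) * p False)"
      "\<i> * (if n - a = 0 then 0 else dcoeff (k 2) 1 * - e * u (False, (a, 1, n - a - 1)))
      = - e * (dcoeff (k 3) (n - a) * p True - dcoeff (k 1) (Suc a) * q False)"
      by simp_all
  qed
  have XF: "BIops k 1 u (False, (a, 0, n - a)) = - e * (dcoeff (k 1) (Suc a) * q True + dcoeff (k 3) (n - a) * p False)
      - e * (1 / 2 + of_real (k 2)) * p False + of_real (k 3) * p False"
    and XT: "BIops k 1 u (True, (a, 0, n - a)) = - e * (dcoeff (k 3) (n - a) * p True - dcoeff (k 1) (Suc a) * q False)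
      - e * (1 / 2 + of_real (k 2)) * p True + of_real (k 3) * p True"
    unfolding Xc p_def[symmetric] by (simp_all only: not_False_eq_True not_True_eq_False dF dT)
  have r: "restr n u s a = (if s then e * (p False - \<i> * p True) else p False + \<i> * p True)"
    "restr n u s (Suc a) = (if s then - e * (q False - \<i> * q True) else q False + \<i> * q True)"
    by (simp_all add: restr_def e_def p_def q_def)
  have i2: "\<i> * \<i> = - 1" by simp
  show ?thesis
  proof (cases s)
    case True
    then show ?thesis
      unfolding Xres_def r unfolding restr_def XF XT b3 e_def[symmetric] using e2 i2 by (simp, algebra)
  next
    case False
    then show ?thesis
      unfolding Xres_def r unfolding restr_def XF XT b3 e_def[symmetric] using e2 i2 by (simp, algebra)
  qed
qed

text \<open>Of x2 T1 - x1 T2 only the second term survives at x2 = 0. Multiplying by x1 shifts the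
  exponent, so the Dirac equation is applied at a - 1 and the coupling goes downwards.\<close>

lemma restr_Z:
  assumes u: "u \<in> Mn k n" and n: "odd n" and a: "a \<le> n"
  shows "restr n (BIops k 3 u) s a = Zres k n (restr n u s) a"
proof -
  define e where "e = (-1::complex) ^ a"
  have e2: "e * e = 1" by (simp add: e_def m1sq)
  have Zc: "BIops k 3 u (t, (a, 0, n - a)) = (if t then \<i> * (if a = 0 then 0 else dcoeff (k 2) 1 * e * u (t, (a - 1, 1, n - a))) else - (\<i> * (if a = 0 then 0 else dcoeff (k 2) 1 * e * u (t, (a - 1, 1, n - a)))))
      + e * (1 / 2 + of_real (k 2)) * u (t, (a, 0, n - a)) + of_real (k 1) * u (t, (a, 0, n - a))" for t
  proof -
    have "(-1::complex) ^ (a - 1) * - 1 = e" if "a \<noteq> 0"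
      using that by (cases a) (auto simp: e_def)
    then show ?thesis
      using e_def by (auto simp: BIops_def gen_def Let_def pauli_def mulx_def dunkl_eq refl_def mexp_def bump_def unbump_def algebra_simps)
  qed
  have b1: "dcoeff (k 1) a = of_nat a + of_real (k 1) * (1 - e)"
    by (simp add: dcoeff_def e_def)
  define p where "p t = u (t, (a, 0, n - a))" for t
  define q where "q t = (if a = 0 then 0 else u (t, (a - 1, 0, n - (a - 1))))" for t
  have dF: "\<i> * (if a = 0 then 0 else dcoeff (k 2) 1 * e * u (True, (a - 1, 1, n - a)))
      = e * (dcoeff (k 1) a * p True + dcoeff (k 3) (Suc n - a) * q False)"
    and dT: "\<i> * (if a = 0 then 0 else dcoeff (k 2) 1 * e * u (False, (a - 1, 1, n - a)))
      = e * (dcoeff (k 3) (Suc n - a) * q True - dcoeff (k 1) a * p False)"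
  proof -
    have "\<i> * dcoeff (k 2) 1 * u (True, (a - 1, 1, n - a)) = dcoeff (k 1) a * p True + dcoeff (k 3) (Suc n - a) * q False"
      "\<i> * dcoeff (k 2) 1 * u (False, (a - 1, 1, n - a)) = dcoeff (k 3) (Suc n - a) * q True - dcoeff (k 1) a * p False" if "a \<noteq> 0"
      using Mn_dirac[OF u, of 0 "a - 1" "n - a"] that a by (simp_all add: p_def q_def Suc_diff_le)
    moreover have "\<i> * (if a = 0 then 0 else B * e * U) = e * R"
      if "a = 0 \<Longrightarrow> R = 0" "a \<noteq> 0 \<Longrightarrow> \<i> * B * U = R" for B U R
      using that by (cases "a = 0") auto
    moreover have "a = 0 \<Longrightarrow> dcoeff (k 1) a = 0" "a = 0 \<Longrightarrow> q t = 0" for t by (simp_all add: q_def)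
    ultimately show "\<i> * (if a = 0 then 0 else dcoeff (k 2) 1 * e * u (True, (a - 1, 1, n - a)))
      = e * (dcoeff (k 1) a * p True + dcoeff (k 3) (Suc n - a) * q False)"
      "\<i> * (if a = 0 then 0 else dcoeff (k 2) 1 * e * u (False, (a - 1, 1, n - a)))
      = e * (dcoeff (k 3) (Suc n - a) * q True - dcoeff (k 1) a * p False)"
      by simp_all
  qed
  have ZF: "BIops k 3 u (False, (a, 0, n - a)) = - (e * (dcoeff (k 3) (Suc n - a) * q True - dcoeff (k 1) a * p False))
      + e * (1 / 2 + of_real (k 2)) * p False + of_real (k 1) * p False"
    and ZT: "BIops k 3 u (True, (a, 0, n - a)) = e * (dcoeff (k 1) a * p True + dcoeff (k 3) (Suc n - a) * q False)
      + e * (1 / 2 + of_real (k 2)) * p True + of_real (k 1) * p True"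
    unfolding Zc p_def[symmetric] by (simp_all only: if_True if_False dF dT)
  have r: "restr n u s a = (if s then e * (p False - \<i> * p True) else p False + \<i> * p True)"
    by (simp add: restr_def e_def p_def)
  have rq: "(if a = 0 then 0 else restr n u s (a - 1)) = (if s then - e * (q False - \<i> * q True) else q False + \<i> * q True)"
    by (cases a) (simp_all add: restr_def e_def q_def)
  have i2: "\<i> * \<i> = - 1" by simp
  show ?thesis
  proof (cases s)
    case True
    then show ?thesis
      unfolding Zres_def rq r unfolding restr_def ZF ZT b1 e_def[symmetric] using e2 i2 by (simp, algebra)
  next
    case False
    then show ?thesis
      unfolding Zres_def rq r unfolding restr_def ZF ZT b1 e_def[symmetric] using e2 i2 by (simp, algebra)
  qed
qed

text \<open>The scalar of {X,Z} - Y on M_n for odd n; it agrees with the scalar of {X,Y} - Z on the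
  untwisted E and O modules in W1, W2, W3.\<close>

definition BI_scalar :: "(nat \<Rightarrow> real) \<Rightarrow> nat \<Rightarrow> complex" where
  "BI_scalar k n = 2 * of_real (k 1) * of_real (k 3) - 2 * of_real (k 2) * (of_real (k 1) + of_real (k 2) + of_real (k 3) + of_nat n + 1)"

text \<open>Y contains x1 T3 - x3 T1 and no T2, so it is compatible with x2 = 0 and its coordinates
  can be read off; R1 R3 acts there as -1 because n is odd.\<close>

lemma restr_Y_coord:
  assumes u: "u \<in> Mn k n" and n: "odd n" and a: "a \<le> n"
  shows "restr n (BIops k 2 u) s a = \<i> * dcoeff (k 3) (Suc n - a) * (if a = 0 then 0 else restr n u s (a - 1))
    - \<i> * dcoeff (k 1) (Suc a) * restr n u s (Suc a) + ((-1) ^ a * (of_real (k 3) - of_real (k 1)) - 1 / 2) * restr n u s a"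
proof -
  define e where "e = (-1::complex) ^ a"
  have e2: "e * e = 1" by (simp add: e_def m1sq)
  have ec: "(-1::complex) ^ (n - a) = - e" using n a by (simp add: e_def minus_one_power_iff)
  define p where "p t = u (t, (a, 0, n - a))" for t
  define q where "q t = (if a = 0 then 0 else u (t, (a - 1, 0, n - (a - 1))))" for t
  define q' where "q' t = u (t, (Suc a, 0, n - Suc a))" for t
  have g: "refl 1 (refl 3 u) (t, (x, 0, y)) = - u (t, (x, 0, y))" if "x + y = n" for t x y
  proof -
    have "(-1::complex) ^ x * (-1) ^ y = - 1" using n that by (simp flip: power_add)
    then show ?thesis by (simp add: refl_def mexp_def flip: mult.assoc)
  qed
  have m1: "mulx 1 (dunkl k 3 (refl 1 (refl 3 u))) (t, (a, 0, n - a)) = - dcoeff (k 3) (Suc n - a) * q t" for t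
  proof (cases "a = 0")
    case False
    then have "dunkl k 3 (refl 1 (refl 3 u)) (t, (a - 1, 0, n - a)) = dcoeff (k 3) (Suc (n - a)) * refl 1 (refl 3 u) (t, (a - 1, 0, Suc (n - a)))"
      by (simp add: dunkl_eq mexp_def bump_def)
    then show ?thesis using False a g[of "a - 1" "Suc (n - a)" t]
      by (simp add: mulx_def mexp_def unbump_def q_def Suc_diff_le)
  qed (simp add: mulx_def mexp_def q_def)
  have m3: "mulx 3 (dunkl k 1 (refl 1 (refl 3 u))) (t, (a, 0, n - a)) = - dcoeff (k 1) (Suc a) * q' t" for t
  proof (cases "n - a = 0")
    case False
    then have "dunkl k 1 (refl 1 (refl 3 u)) (t, (a, 0, n - Suc a)) = dcoeff (k 1) (Suc a) * refl 1 (refl 3 u) (t, (Suc a, 0, n - Suc a))"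
      by (simp add: dunkl_eq mexp_def bump_def)
    then show ?thesis using False a g[of "Suc a" "n - Suc a" t]
      by (simp add: mulx_def mexp_def unbump_def q'_def)
  qed (use Mn_hom[OF u, of "Suc a" 0 "n - Suc a" t] in \<open>simp add: mulx_def mexp_def q'_def\<close>)
  have r1: "refl 1 u (t, (a, 0, n - a)) = e * p t" and r3: "refl 3 u (t, (a, 0, n - a)) = - e * p t" for t
    using ec by (simp_all add: refl_def mexp_def e_def p_def)
  have Yc: "BIops k 2 u (t, (a, 0, n - a)) = \<i> * ((if t then \<i> else - \<i>) * (- dcoeff (k 3) (Suc n - a) * q (\<not> t) + dcoeff (k 1) (Suc a) * q' (\<not> t)))
      - p t / 2 + of_real (k 3) * e * p t - of_real (k 1) * e * p t" for t
    unfolding BIops_def gen_def Let_def using m1 m3 g[of a "n - a" t] a r1 r3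
    by (simp add: pauli_def p_def)
  have r: "restr n u s a = (if s then e * (p False - \<i> * p True) else p False + \<i> * p True)"
    "restr n u s (Suc a) = (if s then - e * (q' False - \<i> * q' True) else q' False + \<i> * q' True)"
    by (simp_all add: restr_def e_def p_def q'_def)
  have rq: "(if a = 0 then 0 else restr n u s (a - 1)) = (if s then - e * (q False - \<i> * q True) else q False + \<i> * q True)"
    by (cases a) (simp_all add: restr_def e_def q_def)
  have i2: "\<i> * \<i> = - 1" by simp
  show ?thesis
  proof (cases s)
    case True
    then show ?thesis
      unfolding rq r unfolding restr_def Yc e_def[symmetric] using e2 i2 by (simp, algebra)
  next
    case False
    then show ?thesis
      unfolding rq r unfolding restr_def Yc e_def[symmetric] using e2 i2 by (simp, algebra)
  qed
qed

text \<open>\<open>Xres\<close> reaches only a + 1 and \<open>Zres\<close> only a - 1, so the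
  anticommutator is tridiagonal and can match the formula of \<open>restr_Y_coord\<close>.\<close>

lemma anticomm_XZ_coord:
  assumes n: "odd n" and a: "a \<le> n" and w: "\<And>j. n < j \<Longrightarrow> w j = 0"
  shows "Xres k n (Zres k n w) a + Zres k n (Xres k n w) a - BI_scalar k n * w a
    = \<i> * dcoeff (k 3) (Suc n - a) * (if a = 0 then 0 else w (a - 1))
    - \<i> * dcoeff (k 1) (Suc a) * w (Suc a) + ((-1) ^ a * (of_real (k 3) - of_real (k 1)) - 1 / 2) * w a"
proof -
  define e where "e = (-1::complex) ^ a"
  have e2: "e * e = 1" by (simp add: e_def m1sq)
  have eS: "(-1::complex) ^ Suc a = - e" by (simp add: e_def)
  have e1: "(-1::complex) ^ (a - 1) = - e" if "a \<noteq> 0" using that by (cases a) (simp_all add: e_def)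
  have ec: "(-1::complex) ^ (n - a) = - e" using n a by (simp add: e_def minus_one_power_iff)
  have bS1: "dcoeff (k 1) (Suc a) = of_nat a + 1 + of_real (k 1) * (1 + e)" by (simp add: dcoeff_Suc e_def)
  have b1: "dcoeff (k 1) a = of_nat a + of_real (k 1) * (1 - e)" by (simp add: dcoeff_def e_def)
  have b3: "dcoeff (k 3) (n - a) = of_nat n - of_nat a + of_real (k 3) * (1 + e)"
    using a ec by (simp add: dcoeff_def of_nat_diff)
  have bS3: "dcoeff (k 3) (Suc n - a) = of_nat n - of_nat a + 1 + of_real (k 3) * (1 - e)"
    using a ec by (simp add: Suc_diff_le dcoeff_Suc of_nat_diff)
  define x where "x = (if a = 0 then 0 else w (a - 1))"
  define y where "y = w (Suc a)"
  have ZS: "Zres k n w (Suc a) = - e * (of_nat a + 1 + of_real (k 1) + of_real (k 2) + 1 / 2) * y - \<i> * e * dcoeff (k 3) (n - a) * w a"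
    by (simp add: Zres_def e_def y_def)
  have Xp: "(if a = 0 then 0 else Xres k n w (a - 1)) = e * (of_nat n - of_nat a + 1 + of_real (k 2) + of_real (k 3) + 1 / 2) * x - \<i> * e * dcoeff (k 1) a * w a"
    using e1 by (cases a) (simp_all add: Xres_def x_def algebra_simps)
  have i2: "\<i> * \<i> = - 1" by simp
  have X0: "Xres k n v a = - e * (of_nat n - of_nat a + of_real (k 2) + of_real (k 3) + 1 / 2) * v a + \<i> * e * dcoeff (k 1) (Suc a) * v (Suc a)"
    and Z0: "Zres k n v a = e * (of_nat a + of_real (k 1) + of_real (k 2) + 1 / 2) * v a + \<i> * e * dcoeff (k 3) (Suc n - a) * (if a = 0 then 0 else v (a - 1))" for v
    by (simp_all add: Xres_def Zres_def e_def)
  define d where "d = (1 / 2 :: complex)"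
  have d: "2 * d = 1" "1 / 2 = d" by (simp_all add: d_def)
  show ?thesis
    unfolding X0[of "Zres k n w"] Z0[of "Xres k n w"] ZS Xp X0[of w] Z0[of w] x_def[symmetric] y_def[symmetric] e_def[symmetric]
    unfolding bS1 bS3 b1 b3 BI_scalar_def d(2)
    using e2 i2 d(1) by algebra
qed

lemma restr_Y:
  assumes "u \<in> Mn k n" "odd n" "a \<le> n"
  shows "restr n (BIops k 2 u) s a = Xres k n (Zres k n (restr n u s)) a + Zres k n (Xres k n (restr n u s)) a - BI_scalar k n * restr n u s a"
  using restr_Y_coord[OF assms] anticomm_XZ_coord[OF assms(2,3)] restr_above[OF assms(1)] by simp

section \<open>Submodules and quotients\<close>

text \<open>The coordinates of one layer, listed by \<open>\<pi>\<close> in the order that makes one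
  operator lower bidiagonal; \<open>\<gamma>\<close> rescales the basis.\<close>

definition pick_coords :: "(nat \<Rightarrow> complex) \<Rightarrow> (nat \<Rightarrow> nat) \<Rightarrow> nat \<Rightarrow> (nat \<Rightarrow> complex) \<Rightarrow> nat \<Rightarrow> complex" where
  "pick_coords \<gamma> \<pi> d w = (\<lambda>j. if j \<le> d then \<gamma> j * w (\<pi> j) else 0)"

lemma pick_coords_Vd: "pick_coords \<gamma> \<pi> d w \<in> Vd d"
  by (simp add: pick_coords_def Vd_def)

text \<open>The quotient map is the projection to the coordinates \<open>\<pi> j\<close>, one copy
  for each s. L and R are X and Z, named so that L is lower bidiagonal. The space C is stable under
  both, so they can be composed to obtain Y; the common sign \<open>\<epsilon>\<close> drops out of
  the anticommutator.\<close>

lemma BI_quot_iso_bidiag: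
  assumes n: "odd n" and U: "U \<subseteq> Mn k n"
    and ops: "(L = Xres k n \<and> R = Zres k n \<and> gl = 1 \<and> gr = 3) \<or> (L = Zres k n \<and> R = Xres k n \<and> gl = 3 \<and> gr = 1)"
    and C: "\<And>u s. u \<in> U \<Longrightarrow> restr n u s \<in> C" "\<And>w. w \<in> C \<Longrightarrow> L w \<in> C" "\<And>w. w \<in> C \<Longrightarrow> R w \<in> C"
    and \<pi>: "\<And>j. j \<le> d \<Longrightarrow> \<pi> j \<le> n"
    and surj: "\<And>w. \<exists>u\<in>U. \<forall>s. \<forall>j\<le>d. restr n u s (\<pi> j) = w s j"
    and ker: "\<And>u. u \<in> U \<Longrightarrow> (\<forall>s. \<forall>j\<le>d. restr n u s (\<pi> j) = 0) \<longleftrightarrow> u \<in> W"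
    and eps: "\<epsilon> * \<epsilon> = 1"
    and L: "\<And>w j. w \<in> C \<Longrightarrow> j \<le> d \<Longrightarrow> L w (\<pi> j) = \<epsilon> * (thetaf d a j * w (\<pi> j) + (if 1 \<le> j then \<beta> j * w (\<pi> (j - 1)) else 0))"
    and R: "\<And>w j. w \<in> C \<Longrightarrow> j \<le> d \<Longrightarrow> R w (\<pi> j) = \<epsilon> * (thetaf d b j * w (\<pi> j) + (if j < d then \<delta> j * w (\<pi> (Suc j)) else 0))"
    and \<beta>: "\<And>j. 1 \<le> j \<Longrightarrow> j \<le> d \<Longrightarrow> \<beta> j \<noteq> 0"
    and \<phi>: "\<And>j. j < d \<Longrightarrow> \<delta> j * \<beta> (Suc j) = \<phi> (Suc j)"
    and V: "\<And>v. V gl v = (\<lambda>j. \<epsilon> * Xmat d a v j)" "\<And>v. V gr v = (\<lambda>j. \<epsilon> * Ymat d b \<phi> v j)"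
      "\<And>v. V 2 v = (\<lambda>j. Xmat d a (Ymat d b \<phi> v) j + Ymat d b \<phi> (Xmat d a v) j - BI_scalar k n * v j)"
  shows "bi_quot_iso U W (BIops k) (dcar d) (dirsum V)"
proof -
  \<comment> \<open>This rescaling turns the subdiagonal entries \<open>\<beta> j\<close> into 1;
    the superdiagonal becomes the product \<open>\<delta> j * \<beta> (Suc j)\<close>.\<close>
  define \<gamma> where "\<gamma> j = (\<Prod>l\<in>{1..j}. inverse (\<beta> l))" for j
  have \<gamma>0: "\<gamma> j \<noteq> 0" if "j \<le> d" for j using that \<beta> by (auto simp: \<gamma>_def)
  have \<gamma>S: "\<gamma> (Suc j) * \<beta> (Suc j) = \<gamma> j" if "j < d" for j
    using that \<beta>[of "Suc j"] by (simp add: \<gamma>_def)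
  let ?p = "pick_coords \<gamma> \<pi> d" and ?X = "Xmat d a" and ?Y = "Ymat d b \<phi>"
  have pL: "?p (L w) = (\<lambda>j. \<epsilon> * ?X (?p w) j)" if "w \<in> C" for w
  proof
    fix j
    show "?p (L w) j = \<epsilon> * ?X (?p w) j"
    proof (cases "j \<le> d")
      case True
      have "\<gamma> j * (if 1 \<le> j then \<beta> j * w (\<pi> (j - 1)) else 0) = (if 1 \<le> j then ?p w (j - 1) else 0)"
        using True \<gamma>S[of "j - 1"] by (cases j) (simp_all add: pick_coords_def flip: mult.assoc)
      moreover have "?p (L w) j = \<epsilon> * (thetaf d a j * (\<gamma> j * w (\<pi> j)) + \<gamma> j * (if 1 \<le> j then \<beta> j * w (\<pi> (j - 1)) else 0))"
        using True L[OF that True] by (simp add: pick_coords_def algebra_simps)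
      moreover have "?p w j = \<gamma> j * w (\<pi> j)" using True by (simp add: pick_coords_def)
      ultimately show ?thesis using Xmat_coord(1)[OF True] by simp
    qed (simp add: pick_coords_def Xmat_def)
  qed
  have pR: "?p (R w) = (\<lambda>j. \<epsilon> * ?Y (?p w) j)" if "w \<in> C" for w
  proof
    fix j
    show "?p (R w) j = \<epsilon> * ?Y (?p w) j"
    proof (cases "j < d")
      case True
      have "\<gamma> j * \<delta> j = \<phi> (Suc j) * \<gamma> (Suc j)" unfolding \<gamma>S[OF True, symmetric] \<phi>[OF True, symmetric] by (simp add: mult_ac)
      then have "\<gamma> j * (\<delta> j * w (\<pi> (Suc j))) = \<phi> (Suc j) * (\<gamma> (Suc j) * w (\<pi> (Suc j)))" by algebra
      then show ?thesis using True R[OF that, of j] by (simp add: pick_coords_def Ymat_def algebra_simps)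
    next
      case False
      then show ?thesis using R[OF that, of j] by (cases "j = d") (auto simp: pick_coords_def Ymat_def)
    qed
  qed
  have scale: "?X (\<lambda>j. \<epsilon> * v j) = (\<lambda>j. \<epsilon> * ?X v j)" "?Y (\<lambda>j. \<epsilon> * v j) = (\<lambda>j. \<epsilon> * ?Y v j)" if "v \<in> Vd d" for v
    using lin_on_scale[OF Xmat_lin Vd_csub that] lin_on_scale[OF Ymat_lin Vd_csub that] by auto
  have ee: "\<epsilon> * (\<epsilon> * x) = x" for x using eps by (simp flip: mult.assoc)
  have pLR: "?p (L (R w)) = ?X (?Y (?p w))" "?p (R (L w)) = ?Y (?X (?p w))" if "w \<in> C" for w
    using pL[OF C(3)[OF that]] pR[OF C(2)[OF that]] pL[OF that] pR[OF that] scale Xmat_Vd Ymat_Vd ee by auto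
  define f where "f u = (\<lambda>(s, j). ?p (restr n u s) j)" for u
  have fs: "(\<lambda>j. f u (s, j)) = ?p (restr n u s)" for u s by (simp add: f_def)
  have rl: "restr n (BIops k gl u) s x = L (restr n u s) x" "restr n (BIops k gr u) s x = R (restr n u s) x"
    and r2: "restr n (BIops k 2 u) s x = L (R (restr n u s)) x + R (L (restr n u s)) x - BI_scalar k n * restr n u s x"
    if "u \<in> U" "x \<le> n" for u s x
    using ops that U n restr_X[of u k n x s] restr_Z[of u k n x s] restr_Y[of u k n x s] by auto
  have int: "f (BIops k g u) = dirsum V g (f u)" if g: "g \<in> {gl, gr, 2}" and u: "u \<in> U" for g u
  proof
    fix q :: "bool \<times> nat"
    obtain s j where q: "q = (s, j)" by (cases q)
    let ?w = "restr n u s"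
    have w: "?w \<in> C" by (rule C(1)[OF u])
    have "?p (restr n (BIops k g u) s) j = V g (?p ?w) j"
    proof -
      consider "g = gl" | "g = gr" | "g = 2" using g by auto
      then show ?thesis
      proof cases
        case 1
        have "?p (restr n (BIops k g u) s) j = ?p (L ?w) j" using rl(1)[OF u] \<pi> 1 by (simp add: pick_coords_def)
        then show ?thesis using 1 pL[OF w] V(1) by simp
      next
        case 2
        have "?p (restr n (BIops k g u) s) j = ?p (R ?w) j" using rl(2)[OF u] \<pi> 2 by (simp add: pick_coords_def)
        then show ?thesis using 2 pR[OF w] V(2) by simp
      next
        case 3
        have "?p (restr n (BIops k g u) s) j = ?p (L (R ?w)) j + ?p (R (L ?w)) j - BI_scalar k n * ?p ?w j"
          by (cases "j \<le> d") (simp_all add: pick_coords_def 3 r2[OF u \<pi>] algebra_simps)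
        then show ?thesis using 3 pLR[OF w] V(3) by simp
      qed
    qed
    then show "f (BIops k g u) q = dirsum V g (f u) q"
      by (simp add: q dirsum_def fs) (simp add: f_def)
  qed
  have "lin_on U f"
    by (auto simp: lin_on_def f_def pick_coords_def restr_lin algebra_simps fun_eq_iff)
  moreover have "f ` U = dcar d"
  proof
    show "f ` U \<subseteq> dcar d" using pick_coords_Vd by (auto simp: dcar_def fs)
    show "dcar d \<subseteq> f ` U"
    proof
      fix v assume v: "v \<in> dcar d"
      obtain u where u: "u \<in> U" "\<And>s j. j \<le> d \<Longrightarrow> restr n u s (\<pi> j) = v (s, j) / \<gamma> j"
        using surj[of "\<lambda>s j. v (s, j) / \<gamma> j"] by blast
      have "f u = v"
        using v \<gamma>0 by (auto simp: f_def pick_coords_def fun_eq_iff u(2) dcar_def Vd_def)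
      then show "v \<in> f ` U" using u(1) by blast
    qed
  qed
  moreover have "f u = (\<lambda>_. 0) \<longleftrightarrow> u \<in> W" if "u \<in> U" for u
    using \<gamma>0 by (auto simp: f_def pick_coords_def fun_eq_iff simp flip: ker[OF that] split: if_splits)
  moreover have "{1, 2, 3} = {gl, gr, 2}" using ops by auto
  ultimately show ?thesis
    unfolding bi_quot_iso_def using int by (intro exI[of _ f]) simp
qed

text \<open>Vanishing for a < t1 at x2 = 0 spreads to all powers of x2: the only way out of this
  range is T1 taken at exponent t1, where its coefficient is 0.\<close>

lemma Mx1_iff:
  assumes dcoeff2: "\<And>m. 1 \<le> m \<Longrightarrow> m \<le> n \<Longrightarrow> dcoeff (k 2) m \<noteq> 0" and t: "tval (k 1) = enat t" "t \<le> n" and u: "u \<in> Mn k n"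
  shows "u \<in> Mx k 1 n \<longleftrightarrow> (\<forall>s. \<forall>a<t. restr n u s a = 0)"
proof
  assume "u \<in> Mx k 1 n"
  then have "u (s, (a, b, c)) = 0" if "a < t" for s a b c
    using that t by (auto simp: Mx_def mexp_def)
  then show "\<forall>s. \<forall>a<t. restr n u s a = 0" by (simp add: restr_def)
next
  assume r: "\<forall>s. \<forall>a<t. restr n u s a = 0"
  have t0: "dcoeff (k 1) t = 0" using t dcoeff_eq_0_iff by (cases "t = 0") auto
  have "u (s, (a, b, c)) = 0" if "a < t" for s a b c
  proof (rule Mn_vanish[where A = "\<lambda>a c. a < t", OF dcoeff2 u])
    fix s a c assume "a < t"
    then have "u (s, (a, 0, n - a)) = 0" using r restr_eq_0_iff by blast
    then show "u (s, (a, 0, c)) = 0" using Mn_hom[OF u, of a 0 c] by (cases "a + c = n") auto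
  next
    fix a assume "a < t"
    then show "Suc a < t \<or> dcoeff (k 1) (Suc a) = 0" using t0 by (cases "Suc a = t") auto
  qed (use that in auto)
  then show "u \<in> Mx k 1 n" using u t by (auto simp: Mx_def mexp_def)
qed

text \<open>The counterpart for x3; at x2 = 0 the condition c < t3 reads a > n - t3.\<close>

lemma Mx3_iff:
  assumes dcoeff2: "\<And>m. 1 \<le> m \<Longrightarrow> m \<le> n \<Longrightarrow> dcoeff (k 2) m \<noteq> 0" and t: "tval (k 3) = enat t" "t \<le> n" and u: "u \<in> Mn k n"
  shows "u \<in> Mx k 3 n \<longleftrightarrow> (\<forall>s. \<forall>a>n - t. restr n u s a = 0)"
proof
  assume "u \<in> Mx k 3 n"
  then have "u (s, (a, b, c)) = 0" if "c < t" for s a b c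
    using that t by (auto simp: Mx_def mexp_def)
  moreover have "n - a < t" if "n - t < a" "a \<le> n" for a using that t by auto
  ultimately have "restr n u s a = 0" if "n - t < a" "a \<le> n" for s a
    using that by (simp add: restr_def)
  then show "\<forall>s. \<forall>a>n - t. restr n u s a = 0" using restr_above[OF u] by (meson not_le)
next
  assume r: "\<forall>s. \<forall>a>n - t. restr n u s a = 0"
  have t0: "dcoeff (k 3) t = 0" using t dcoeff_eq_0_iff by (cases "t = 0") auto
  have "u (s, (a, b, c)) = 0" if "c < t" for s a b c
  proof (rule Mn_vanish[where A = "\<lambda>a c. c < t", OF dcoeff2 u])
    fix s a c assume c: "c < t"
    show "u (s, (a, 0, c)) = 0"
    proof (cases "a + c = n")
      case True
      then have "n - t < a" "c = n - a" using c t by auto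
      then show ?thesis using r restr_eq_0_iff by blast
    qed (use Mn_hom[OF u, of a 0 c] in auto)
  next
    fix c assume "c < t"
    then show "Suc c < t \<or> dcoeff (k 3) (Suc c) = 0" using t0 by (cases "Suc c = t") auto
  qed (use that in auto)
  then show "u \<in> Mx k 3 n" using u t by (auto simp: Mx_def mexp_def)
qed

lemma neg1_diff: "j \<le> n \<Longrightarrow> odd n \<Longrightarrow> (-1::complex) ^ (n - j) = - ((-1) ^ j)"
  by (simp add: minus_one_power_iff)


section \<open>The three layers of M_n\<close>

locale odd_degree =
  fixes k :: "nat \<Rightarrow> real" and n t1 t3 :: nat
  assumes n: "odd n" and t1: "tval (k 1) = enat t1" and t3: "tval (k 3) = enat t3"
    and le: "t1 + t3 \<le> n" and t2: "enat n < tval (k 2)"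
begin

lemma dcoeff2: "1 \<le> m \<Longrightarrow> m \<le> n \<Longrightarrow> dcoeff (k 2) m \<noteq> 0"
  using t2 by (subst dcoeff_eq_0_iff) auto

lemma odd_t: "odd t1" "odd t3"
  using t1 t3 by (auto simp: tval_eq_enat)

lemma k_t: "complex_of_real (k 1) = - of_nat t1 / 2" "complex_of_real (k 3) = - of_nat t3 / 2"
  "complex_of_real (k (Suc 0)) = - of_nat t1 / 2"
proof -
  have "k 1 = - real t1 / 2" "k 3 = - real t3 / 2" using t1 t3 by (auto simp: tval_eq_enat)
  then show "complex_of_real (k 1) = - of_nat t1 / 2" "complex_of_real (k 3) = - of_nat t3 / 2"
    "complex_of_real (k (Suc 0)) = - of_nat t1 / 2" by simp_all
qed

lemma of_nat_t: "of_nat (t1 - 1) = (of_nat t1 - 1 :: complex)" "of_nat (t1 - Suc 0) = (of_nat t1 - 1 :: complex)"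
  "of_nat (t3 - 1) = (of_nat t3 - 1 :: complex)" "of_nat (t3 - Suc 0) = (of_nat t3 - 1 :: complex)"
  using odd_pos[OF odd_t(1)] odd_pos[OF odd_t(2)] by (simp_all add: of_nat_diff)

lemma dcoeff_t: "dcoeff (k 1) t1 = 0" "dcoeff (k 3) t3 = 0"
  using t1 t3 odd_t by (simp_all add: dcoeff_def k_t)

lemma dcoeff_neq_0: "m \<noteq> 0 \<Longrightarrow> m \<noteq> t1 \<Longrightarrow> dcoeff (k 1) m \<noteq> 0" "m \<noteq> 0 \<Longrightarrow> m \<noteq> t3 \<Longrightarrow> dcoeff (k 3) m \<noteq> 0"
  using t1 t3 by (auto simp: dcoeff_eq_0_iff)

lemma Mx1: "u \<in> Mn k n \<Longrightarrow> u \<in> Mx k 1 n \<longleftrightarrow> (\<forall>s. \<forall>a<t1. restr n u s a = 0)"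
  using Mx1_iff[OF dcoeff2 t1] le by simp

lemma Mx3: "u \<in> Mn k n \<Longrightarrow> u \<in> Mx k 3 n \<longleftrightarrow> (\<forall>s. \<forall>a>n - t3. restr n u s a = 0)"
  using Mx3_iff[OF dcoeff2 t3] le by simp

lemma Mx_sub: "Mx k i n \<subseteq> Mn k n"
  by (auto simp: Mx_def)

abbreviation C where "C \<equiv> {w. \<forall>a>n. w a = 0}"

lemma C_closed: "w \<in> C \<Longrightarrow> Xres k n w \<in> C" "w \<in> C \<Longrightarrow> Zres k n w \<in> C"
proof -
  assume w: "w \<in> C"
  then show "Xres k n w \<in> C" by (auto simp: Xres_def)
  show "Zres k n w \<in> C"
  proof (intro CollectI allI impI)
    fix a assume "n < a"
    then show "Zres k n w a = 0" using w by (cases "a = Suc n") (auto simp: Zres_def)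
  qed
qed

lemma surj: "\<exists>u\<in>Mn k n. \<forall>s a. a \<le> n \<longrightarrow> restr n u s a = w s a"
  by (rule restr_surj[where k = k and n = n]) (rule dcoeff2)

abbreviation "\<mu> \<equiv> - complex_of_real (k 1 + k 2 + k 3) - of_nat n - 1"

text \<open>The layer a > n - t3 is read downwards from a = n, so X is lower bidiagonal. Z does not
  couple it to the rest because \<open>dcoeff (k 3) t3 = 0\<close>; the subdiagonal is nonzero
  because only exponents above t1 occur in it.\<close>

lemma quot_Mx3:
  assumes U: "U = Mn k n \<or> U = Mx k 1 n"
  shows "bi_quot_iso U (U \<inter> Mx k 3 n) (BIops k) (dcar (t3 - 1))
    (dirsum (twist sg_id perm23 (Omod (t3 - 1) (of_real (k 2)) \<mu> (of_real (k 1)))))"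
proof (rule BI_quot_iso_bidiag[where k = k and n = n and L = "Xres k n" and R = "Zres k n" and gl = 1 and gr = 3
      and C = C and \<pi> = "\<lambda>j. n - j" and \<epsilon> = 1 and a = "of_real (k 2)" and b = \<mu>
      and \<beta> = "\<lambda>j. - \<i> * (-1) ^ j * dcoeff (k 1) (Suc n - j)" and \<delta> = "\<lambda>j. - \<i> * (-1) ^ j * dcoeff (k 3) (Suc j)"
      and \<phi> = "O_phi (t3 - 1) (of_real (k 2)) \<mu> (of_real (k 1))"])
  show UM: "U \<subseteq> Mn k n" using U Mx_sub by auto
  show "restr n u s \<in> C" if "u \<in> U" for u s using that UM restr_above by blast
  show "\<exists>u\<in>U. \<forall>s. \<forall>j\<le>t3 - 1. restr n u s (n - j) = w s j" for w
  proof -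
    \<comment> \<open>The support a > n - t3 >= t1 puts u into M_n(x1) as well, so one witness
      serves both choices of U.\<close>
    obtain u where u: "u \<in> Mn k n" "\<And>s a. a \<le> n \<Longrightarrow> restr n u s a = (if n - t3 < a then w s (n - a) else 0)"
      using surj[of "\<lambda>s a. if n - t3 < a then w s (n - a) else 0"] by blast
    have "u \<in> Mx k 1 n" unfolding Mx1[OF u(1)] using u(2) le by auto
    then have "u \<in> U" using U u(1) by auto
    moreover have "restr n u s (n - j) = w s j" if "j \<le> t3 - 1" for s j
      using u(2)[of "n - j" s] that le odd_t odd_pos[of t3] by auto
    ultimately show ?thesis by blast
  qed
  show "(\<forall>s. \<forall>j\<le>t3 - 1. restr n u s (n - j) = 0) \<longleftrightarrow> u \<in> U \<inter> Mx k 3 n" if "u \<in> U" for u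
  proof -
    have u: "u \<in> Mn k n" using that UM by blast
    have "restr n u s a = 0" if r: "\<forall>s. \<forall>j\<le>t3 - 1. restr n u s (n - j) = 0" and "n - t3 < a" for s a
    proof (cases "a \<le> n")
      case True
      then have "n - a \<le> t3 - 1" "n - (n - a) = a" using that(2) by auto
      then show ?thesis using r by metis
    qed (use restr_above[OF u] in auto)
    moreover have "n - t3 < n - j" if "j \<le> t3 - 1" for j using that le odd_pos[OF odd_t(2)] by auto
    ultimately show ?thesis using Mx3[OF u] that by blast
  qed
  show "- \<i> * (-1) ^ j * dcoeff (k 1) (Suc n - j) \<noteq> 0" if "1 \<le> j" "j \<le> t3 - 1" for j
    using that le dcoeff_neq_0(1)[of "Suc n - j"] by auto
  fix w :: "nat \<Rightarrow> complex" and j assume w: "w \<in> C" and "j \<le> t3 - 1"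
  then have j: "j \<le> n" "j < t3" using le odd_pos[OF odd_t(2)] by auto
  note d = of_nat_t
  have e: "(-1::complex) ^ (n - j) = - ((-1) ^ j)" by (rule neg1_diff[OF j(1) n])
  have x: "of_nat (n - j) = (of_nat n - of_nat j :: complex)" using j by (simp add: of_nat_diff)
  have wS: "w (Suc n - j) = (if 1 \<le> j then w (n - (j - 1)) else 0)"
    using w j by (cases j) auto
  have "Xres k n w (n - j) = (-1) ^ j * (of_nat j + of_real (k 2) + of_real (k 3) + 1 / 2) * w (n - j)
      - \<i> * (-1) ^ j * dcoeff (k 1) (Suc n - j) * w (Suc n - j)"
    unfolding Xres_def e x Suc_diff_le[OF j(1)] by simp
  then show "Xres k n w (n - j) = 1 * (thetaf (t3 - 1) (of_real (k 2)) j * w (n - j)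
      + (if 1 \<le> j then - \<i> * (-1) ^ j * dcoeff (k 1) (Suc n - j) * w (n - (j - 1)) else 0))"
    unfolding wS by (cases "1 \<le> j") (simp_all add: thetaf_eq d k_t field_simps)
  have wp: "dcoeff (k 3) (Suc j) * (if n - j = 0 then 0 else w (n - j - 1)) = (if j < t3 - 1 then dcoeff (k 3) (Suc j) * w (n - Suc j) else 0)"
  proof (cases "j < t3 - 1")
    case False
    then have "Suc j = t3" using j by simp
    then show ?thesis using dcoeff_t(2) by simp
  qed (use le in auto)
  have s: "Suc n - (n - j) = Suc j" using j by simp
  show "Zres k n w (n - j) = 1 * (thetaf (t3 - 1) \<mu> j * w (n - j)
      + (if j < t3 - 1 then - \<i> * (-1) ^ j * dcoeff (k 3) (Suc j) * w (n - Suc j) else 0))"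
  proof -
    have "Zres k n w (n - j) = - ((-1) ^ j) * (of_nat n - of_nat j + of_real (k 1) + of_real (k 2) + 1 / 2) * w (n - j)
      - \<i> * (-1) ^ j * (dcoeff (k 3) (Suc j) * (if n - j = 0 then 0 else w (n - j - 1)))"
      unfolding Zres_def e x s by (simp add: algebra_simps)
    also have "\<dots> = thetaf (t3 - 1) \<mu> j * w (n - j)
      + (if j < t3 - 1 then - \<i> * (-1) ^ j * dcoeff (k 3) (Suc j) * w (n - Suc j) else 0)"
      unfolding wp by (simp add: thetaf_eq d k_t field_simps)
    finally show ?thesis by simp
  qed
next
  fix j assume "j < t3 - 1"
  then have j: "j \<le> n" "Suc n - Suc j = n - j" using le by auto
  note d = of_nat_t
  have e: "(-1::complex) ^ (n - j) = - ((-1) ^ j)" by (rule neg1_diff[OF j(1) n])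
  have x: "of_nat (n - j) = (of_nat n - of_nat j :: complex)" using j by (simp add: of_nat_diff)
  have "- \<i> * (-1) ^ j * dcoeff (k 3) (Suc j) * (- \<i> * (-1) ^ Suc j * dcoeff (k 1) (n - j)) = dcoeff (k 3) (Suc j) * dcoeff (k 1) (n - j)"
    by (simp add: algebra_simps m1sq)
  also have "\<dots> = O_phi (t3 - 1) (of_real (k 2)) \<mu> (of_real (k 1)) (Suc j)"
    by (cases "even j") (simp_all add: dcoeff_def e x O_phi_def d k_t field_simps)
  finally show "- \<i> * (-1) ^ j * dcoeff (k 3) (Suc j) * (- \<i> * (-1) ^ Suc j * dcoeff (k 1) (Suc n - Suc j))
      = O_phi (t3 - 1) (of_real (k 2)) \<mu> (of_real (k 1)) (Suc j)" unfolding j(2) .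
next
  note d = of_nat_t
  have "2 * of_real (k 2) * \<mu> - of_real (k 1) * (of_nat (t3 - 1) + 1) = BI_scalar k n"
    unfolding BI_scalar_def d by (simp add: k_t field_simps)
  then show "twist sg_id perm23 (Omod (t3 - 1) (of_real (k 2)) \<mu> (of_real (k 1))) 2 v =
      (\<lambda>j. Xmat (t3 - 1) (of_real (k 2)) (Ymat (t3 - 1) \<mu> (O_phi (t3 - 1) (of_real (k 2)) \<mu> (of_real (k 1))) v) j
        + Ymat (t3 - 1) \<mu> (O_phi (t3 - 1) (of_real (k 2)) \<mu> (of_real (k 1))) (Xmat (t3 - 1) (of_real (k 2)) v) j - BI_scalar k n * v j)" for v
    by (simp add: twist_def perm23_def sg_id_def Omod_def bimod_def)
qed (use n C_closed in \<open>auto simp: twist_def perm23_def sg_id_def Omod_def bimod_def\<close>)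

text \<open>The layer a < t1 is read upwards from a = 0, so now Z is lower bidiagonal, and the
  coupling by X to a = t1 vanishes.\<close>

lemma quot_Mx1:
  assumes U: "U = Mn k n \<or> U = Mx k 3 n"
  shows "bi_quot_iso U (U \<inter> Mx k 1 n) (BIops k) (dcar (t1 - 1))
    (dirsum (twist sg_id perm123 (Omod (t1 - 1) (of_real (k 2)) \<mu> (of_real (k 3)))))"
proof (rule BI_quot_iso_bidiag[where k = k and n = n and L = "Zres k n" and R = "Xres k n" and gl = 3 and gr = 1
      and C = C and \<pi> = "\<lambda>j. j" and \<epsilon> = 1 and a = "of_real (k 2)" and b = \<mu>
      and \<beta> = "\<lambda>j. \<i> * (-1) ^ j * dcoeff (k 3) (Suc n - j)" and \<delta> = "\<lambda>j. \<i> * (-1) ^ j * dcoeff (k 1) (Suc j)"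
      and \<phi> = "O_phi (t1 - 1) (of_real (k 2)) \<mu> (of_real (k 3))"])
  show UM: "U \<subseteq> Mn k n" using U Mx_sub by auto
  show "restr n u s \<in> C" if "u \<in> U" for u s using that UM restr_above by blast
  show "\<exists>u\<in>U. \<forall>s. \<forall>j\<le>t1 - 1. restr n u s j = w s j" for w
  proof -
    obtain u where u: "u \<in> Mn k n" "\<And>s a. a \<le> n \<Longrightarrow> restr n u s a = (if a < t1 then w s a else 0)"
      using surj[of "\<lambda>s a. if a < t1 then w s a else 0"] by blast
    have "restr n u s a = 0" if "n - t3 < a" for s a
      using u(2)[of a s] restr_above[OF u(1), of a s] that le by (cases "a \<le> n") auto
    then have "u \<in> U" using U u(1) Mx3[OF u(1)] by auto
    moreover have "restr n u s j = w s j" if "j \<le> t1 - 1" for s j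
      using u(2)[of j s] that le odd_pos[OF odd_t(1)] by auto
    ultimately show ?thesis by blast
  qed
  show "(\<forall>s. \<forall>j\<le>t1 - 1. restr n u s j = 0) \<longleftrightarrow> u \<in> U \<inter> Mx k 1 n" if "u \<in> U" for u
  proof -
    have "u \<in> Mn k n" using that UM by blast
    moreover have "j \<le> t1 - 1 \<longleftrightarrow> j < t1" for j using odd_pos[OF odd_t(1)] by auto
    ultimately show ?thesis using that Mx1 by auto
  qed
  show "\<i> * (-1) ^ j * dcoeff (k 3) (Suc n - j) \<noteq> 0" if "1 \<le> j" "j \<le> t1 - 1" for j
    using that le dcoeff_neq_0(2)[of "Suc n - j"] by auto
  fix w :: "nat \<Rightarrow> complex" and j assume w: "w \<in> C" and "j \<le> t1 - 1"
  then have j: "j \<le> n" "j < t1" using le odd_pos[OF odd_t(1)] by auto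
  note d = of_nat_t
  have "Zres k n w j = (-1) ^ j * (of_nat j + of_real (k 1) + of_real (k 2) + 1 / 2) * w j
      + (if 1 \<le> j then \<i> * (-1) ^ j * dcoeff (k 3) (Suc n - j) * w (j - 1) else 0)"
    unfolding Zres_def by simp
  then show "Zres k n w j = 1 * (thetaf (t1 - 1) (of_real (k 2)) j * w j
      + (if 1 \<le> j then \<i> * (-1) ^ j * dcoeff (k 3) (Suc n - j) * w (j - 1) else 0))"
    by (cases "1 \<le> j") (simp_all add: thetaf_eq d k_t field_simps)
  have "dcoeff (k 1) (Suc j) * w (Suc j) = (if j < t1 - 1 then dcoeff (k 1) (Suc j) * w (Suc j) else 0)"
  proof (cases "j < t1 - 1")
    case False
    then have "Suc j = t1" using j by simp
    then show ?thesis using dcoeff_t(1) by simp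
  qed simp
  moreover have "Xres k n w j = - ((-1) ^ j) * (of_nat n - of_nat j + of_real (k 2) + of_real (k 3) + 1 / 2) * w j
      + \<i> * (-1) ^ j * (dcoeff (k 1) (Suc j) * w (Suc j))"
    unfolding Xres_def by simp
  ultimately have "Xres k n w j = - ((-1) ^ j) * (of_nat n - of_nat j + of_real (k 2) + of_real (k 3) + 1 / 2) * w j
      + \<i> * (-1) ^ j * (if j < t1 - 1 then dcoeff (k 1) (Suc j) * w (Suc j) else 0)"
    by (simp only:)
  moreover have "thetaf (t1 - 1) \<mu> j = - ((-1) ^ j) * (of_nat n - of_nat j + of_real (k 2) + of_real (k 3) + 1 / 2)"
    by (simp add: thetaf_eq d k_t field_simps)
  ultimately show "Xres k n w j = 1 * (thetaf (t1 - 1) \<mu> j * w j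
      + (if j < t1 - 1 then \<i> * (-1) ^ j * dcoeff (k 1) (Suc j) * w (Suc j) else 0))"
    by (cases "j < t1 - 1") simp_all
next
  fix j assume "j < t1 - 1"
  then have j: "j \<le> n" "Suc n - Suc j = n - j" using le by auto
  note d = of_nat_t
  have e: "(-1::complex) ^ (n - j) = - ((-1) ^ j)" by (rule neg1_diff[OF j(1) n])
  have x: "of_nat (n - j) = (of_nat n - of_nat j :: complex)" using j by (simp add: of_nat_diff)
  have "\<i> * (-1) ^ j * dcoeff (k 1) (Suc j) * (\<i> * (-1) ^ Suc j * dcoeff (k 3) (n - j)) = dcoeff (k 1) (Suc j) * dcoeff (k 3) (n - j)"
    by (simp add: algebra_simps m1sq)
  also have "\<dots> = O_phi (t1 - 1) (of_real (k 2)) \<mu> (of_real (k 3)) (Suc j)"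
    by (cases "even j") (simp_all add: dcoeff_def e x O_phi_def d k_t field_simps)
  finally show "\<i> * (-1) ^ j * dcoeff (k 1) (Suc j) * (\<i> * (-1) ^ Suc j * dcoeff (k 3) (Suc n - Suc j))
      = O_phi (t1 - 1) (of_real (k 2)) \<mu> (of_real (k 3)) (Suc j)" unfolding j(2) .
next
  note d = of_nat_t
  have "2 * of_real (k 2) * \<mu> - of_real (k 3) * (of_nat (t1 - 1) + 1) = BI_scalar k n"
    unfolding BI_scalar_def d by (simp add: k_t field_simps)
  then show "twist sg_id perm123 (Omod (t1 - 1) (of_real (k 2)) \<mu> (of_real (k 3))) 2 v =
      (\<lambda>j. Xmat (t1 - 1) (of_real (k 2)) (Ymat (t1 - 1) \<mu> (O_phi (t1 - 1) (of_real (k 2)) \<mu> (of_real (k 3))) v) j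
        + Ymat (t1 - 1) \<mu> (O_phi (t1 - 1) (of_real (k 2)) \<mu> (of_real (k 3))) (Xmat (t1 - 1) (of_real (k 2)) v) j - BI_scalar k n * v j)" for v
    by (simp add: twist_def perm123_def sg_id_def Omod_def bimod_def)
qed (use n le odd_t C_closed in \<open>auto simp: twist_def perm123_def sg_id_def Omod_def bimod_def\<close>)

lemma restr_inj:
  assumes u: "u \<in> Mn k n" and r: "\<And>s a. a \<le> n \<Longrightarrow> restr n u s a = 0"
  shows "u = (\<lambda>_. 0)"
proof -
  have "u (s, (a, b, c)) = 0" for s a b c
  proof (rule Mn_vanish[where A = "\<lambda>_ _. True" and n = n, OF _ u])
    fix s a c
    show "u (s, (a, 0, c)) = 0"
    proof (cases "a + c = n")
      case True
      then have "c = n - a" "a \<le> n" by auto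
      then show ?thesis using r restr_eq_0_iff[of n u a] by auto
    qed (use Mn_hom[OF u, of a 0 c] in auto)
  qed (use dcoeff2 in auto)
  then show ?thesis by (auto simp: fun_eq_iff)
qed

abbreviation "\<alpha> \<equiv> complex_of_real (k 1 + k 2) + (of_nat n + 1) / 2"
abbreviation "\<beta>' \<equiv> - complex_of_real (k 2 + k 3) - (of_nat n + 1) / 2"
abbreviation "\<nu> \<equiv> (of_nat n + 1 :: complex) / 2"
abbreviation "d \<equiv> n - t1 - t3"

lemma of_nat_d: "of_nat d = (of_nat n - of_nat t1 - of_nat t3 :: complex)" "real d = real n - real t1 - real t3"
  using le by (simp_all add: of_nat_diff)

text \<open>The middle layer t1 <= a <= n - t3: sequences supported there are stable because
  \<open>dcoeff (k 1) t1\<close> and \<open>dcoeff (k 3) t3\<close> vanish. It is read downwards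
  from the even exponent n - t3, which makes the diagonals of X and Z the negatives of those of E;
  this is the sign twist (-1,-1).\<close>

lemma iso_Mx13:
  "bi_iso (Mx k 1 n \<inter> Mx k 3 n) (BIops k) (dcar d) (dirsum (twist sg_m1m1 perm23 (Emod d \<alpha> \<beta>' \<nu>)))"
  unfolding bi_iso_def
proof (rule BI_quot_iso_bidiag[where k = k and n = n and L = "Xres k n" and R = "Zres k n" and gl = 1 and gr = 3
      and C = "{w. \<forall>a. a < t1 \<or> n - t3 < a \<longrightarrow> w a = 0}" and \<pi> = "\<lambda>j. n - t3 - j" and \<epsilon> = "- 1" and a = \<alpha> and b = \<beta>'
      and \<beta> = "\<lambda>j. - \<i> * (-1) ^ j * dcoeff (k 1) (Suc (n - t3) - j)" and \<delta> = "\<lambda>j. - \<i> * (-1) ^ j * dcoeff (k 3) (Suc (t3 + j))"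
      and \<phi> = "E_phi d \<alpha> \<beta>' \<nu>"])
  let ?U = "Mx k 1 n \<inter> Mx k 3 n"
  let ?C = "{w. \<forall>a. a < t1 \<or> n - t3 < a \<longrightarrow> w a = (0::complex)}"
  show UM: "?U \<subseteq> Mn k n" using Mx_sub by auto
  show "restr n u s \<in> ?C" if "u \<in> ?U" for u s
    using that UM Mx1[of u] Mx3[of u] by auto
  show "Xres k n w \<in> ?C" if w: "w \<in> ?C" for w
  proof (intro CollectI allI impI)
    fix a assume a: "a < t1 \<or> n - t3 < a"
    have "dcoeff (k 1) (Suc a) * w (Suc a) = 0" using a w dcoeff_t(1) by (cases "Suc a = t1") auto
    then show "Xres k n w a = 0" using a w by (auto simp: Xres_def)
  qed
  show "Zres k n w \<in> ?C" if w: "w \<in> ?C" for w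
  proof (intro CollectI allI impI)
    fix a assume a: "a < t1 \<or> n - t3 < a"
    have "dcoeff (k 3) (Suc n - a) * (if a = 0 then 0 else w (a - 1)) = 0"
    proof (cases "a = Suc (n - t3)")
      case True
      then have "Suc n - a = t3" using le by simp
      then show ?thesis using dcoeff_t(2) by simp
    qed (use a w in auto)
    moreover have "w a = 0" using a w by blast
    ultimately show "Zres k n w a = 0" by (simp only: Zres_def mult.assoc mult_zero_right add_0_left)
  qed
  show "\<exists>u\<in>?U. \<forall>s. \<forall>j\<le>d. restr n u s (n - t3 - j) = w s j" for w
  proof -
    let ?w = "\<lambda>s a. if t1 \<le> a \<and> a \<le> n - t3 then w s (n - t3 - a) else 0"
    obtain u where u: "u \<in> Mn k n" "\<And>s a. a \<le> n \<Longrightarrow> restr n u s a = ?w s a"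
      using surj[of ?w] by blast
    have "restr n u s a = 0" if "n - t3 < a" for s a
      using u(2)[of a s] restr_above[OF u(1), of a s] that by (cases "a \<le> n") auto
    then have "u \<in> ?U" using Mx1[OF u(1)] Mx3[OF u(1)] u(2) le by auto
    moreover have "restr n u s (n - t3 - j) = w s j" if "j \<le> d" for s j
      using u(2)[of "n - t3 - j" s] that le by auto
    ultimately show ?thesis by blast
  qed
  show "(\<forall>s. \<forall>j\<le>d. restr n u s (n - t3 - j) = 0) \<longleftrightarrow> u \<in> {\<lambda>_. 0}" if "u \<in> ?U" for u
  proof -
    have u: "u \<in> Mn k n" using that UM by blast
    have "restr n u s a = 0" if r: "\<forall>s. \<forall>j\<le>d. restr n u s (n - t3 - j) = 0" for s a
    proof (cases "t1 \<le> a \<and> a \<le> n - t3")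
      case True
      then have "n - t3 - a \<le> d" "n - t3 - (n - t3 - a) = a" by auto
      then show ?thesis using r by metis
    qed (use \<open>u \<in> ?U\<close> Mx1[OF u] Mx3[OF u] in auto)
    then have "(\<forall>s. \<forall>j\<le>d. restr n u s (n - t3 - j) = 0) \<Longrightarrow> u = (\<lambda>_. 0)" using restr_inj[OF u] by blast
    moreover have "restr n (\<lambda>_. 0) s a = 0" for s a by (simp add: restr_def)
    ultimately show ?thesis by auto
  qed
  show "- \<i> * (-1) ^ j * dcoeff (k 1) (Suc (n - t3) - j) \<noteq> 0" if "1 \<le> j" "j \<le> d" for j
    using that le dcoeff_neq_0(1)[of "Suc (n - t3) - j"] by auto
  fix w :: "nat \<Rightarrow> complex" and j assume w: "w \<in> ?C" and "j \<le> d"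
  then have j: "j + t1 \<le> n - t3" "t3 \<le> n" "j \<le> n - t3" using le by auto
  have "n - t3 - j + (t3 + j) = n" using j by simp
  then have "even (n - t3 - j + (t3 + j)) \<longleftrightarrow> even n" by (simp only:)
  then have "even (n - t3 - j) \<longleftrightarrow> even j" using n odd_t(2) unfolding even_add by blast
  then have e: "(-1::complex) ^ (n - t3 - j) = (-1) ^ j" by (simp add: minus_one_power_iff)
  have x: "of_nat (n - t3 - j) = (of_nat n - of_nat t3 - of_nat j :: complex)" using j by (simp add: of_nat_diff)
  have wS: "w (Suc (n - t3) - j) = (if 1 \<le> j then w (n - t3 - (j - 1)) else 0)"
    using w j by (cases j) auto
  have "Xres k n w (n - t3 - j) = - ((-1) ^ j) * (of_nat t3 + of_nat j + of_real (k 2) + of_real (k 3) + 1 / 2) * w (n - t3 - j)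
      + \<i> * (-1) ^ j * dcoeff (k 1) (Suc (n - t3) - j) * w (Suc (n - t3) - j)"
    unfolding Xres_def e x Suc_diff_le[OF j(3)] by simp
  moreover have th: "thetaf d \<alpha> j = (-1) ^ j * (of_nat t3 + of_nat j + of_real (k 2) + of_real (k 3) + 1 / 2)"
    unfolding thetaf_eq of_nat_d by (simp add: k_t field_simps)
  ultimately show "Xres k n w (n - t3 - j) = - 1 * (thetaf d \<alpha> j * w (n - t3 - j)
      + (if 1 \<le> j then - \<i> * (-1) ^ j * dcoeff (k 1) (Suc (n - t3) - j) * w (n - t3 - (j - 1)) else 0))"
    unfolding wS th by (cases "1 \<le> j") (simp_all add: algebra_simps)
  \<comment> \<open>At the lower end a = t1 the neighbouring coordinate is 0 by the support
    condition; in the quotients it was the coefficient that vanished.\<close>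
  have wp: "(if n - t3 - j = 0 then 0 else w (n - t3 - j - 1)) = (if j < d then w (n - t3 - Suc j) else 0)"
  proof (cases "j < d")
    case False
    then have "n - t3 - j = t1" using j by simp
    then show ?thesis using w False odd_pos[OF odd_t(1)] by simp
  qed (use le in auto)
  have s: "Suc n - (n - t3 - j) = Suc (t3 + j)" using j by simp
  have "Zres k n w (n - t3 - j) = (-1) ^ j * (of_nat n - of_nat t3 - of_nat j + of_real (k 1) + of_real (k 2) + 1 / 2) * w (n - t3 - j)
      + \<i> * (-1) ^ j * dcoeff (k 3) (Suc (t3 + j)) * (if j < d then w (n - t3 - Suc j) else 0)"
    unfolding Zres_def e x s wp by simp
  moreover have th: "thetaf d \<beta>' j = - ((-1) ^ j) * (of_nat n - of_nat t3 - of_nat j + of_real (k 1) + of_real (k 2) + 1 / 2)"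
    unfolding thetaf_eq of_nat_d by (simp add: k_t field_simps)
  ultimately show "Zres k n w (n - t3 - j) = - 1 * (thetaf d \<beta>' j * w (n - t3 - j)
      + (if j < d then - \<i> * (-1) ^ j * dcoeff (k 3) (Suc (t3 + j)) * w (n - t3 - Suc j) else 0))"
    unfolding th by (cases "j < d") (simp_all add: algebra_simps)
next
  fix j assume "j < d"
  then have j: "j + t1 \<le> n - t3" "t3 \<le> n" "j \<le> n - t3" "Suc (n - t3) - Suc j = n - t3 - j" using le by auto
  have "n - t3 - j + (t3 + j) = n" using j by simp
  then have "even (n - t3 - j + (t3 + j)) \<longleftrightarrow> even n" by (simp only:)
  then have "even (n - t3 - j) \<longleftrightarrow> even j" using n odd_t(2) unfolding even_add by blast
  then have e: "(-1::complex) ^ (n - t3 - j) = (-1) ^ j" by (simp add: minus_one_power_iff)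
  have e': "(-1::complex) ^ (t3 + j) = - ((-1) ^ j)" using odd_t by (simp add: power_add)
  have x: "of_nat (n - t3 - j) = (of_nat n - of_nat t3 - of_nat j :: complex)" using j by (simp add: of_nat_diff)
  have "- \<i> * (-1) ^ j * dcoeff (k 3) (Suc (t3 + j)) * (- \<i> * (-1) ^ Suc j * dcoeff (k 1) (n - t3 - j)) = dcoeff (k 3) (Suc (t3 + j)) * dcoeff (k 1) (n - t3 - j)"
    by (simp add: algebra_simps m1sq)
  also have "\<dots> = E_phi d \<alpha> \<beta>' \<nu> (Suc j)"
  proof -
    have b3: "dcoeff (k 3) (Suc (t3 + j)) = of_nat t3 + of_nat j + 1 - of_nat t3 / 2 * (1 - (-1) ^ j)"
      unfolding dcoeff_Suc e' k_t by simp
    have b1: "dcoeff (k 1) (n - t3 - j) = of_nat n - of_nat t3 - of_nat j - of_nat t1 / 2 * (1 - (-1) ^ j)"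
      unfolding dcoeff_def e x k_t by simp
    show ?thesis
      unfolding b3 b1 E_phi_def of_nat_d by (cases "even j") (simp_all add: k_t field_simps power2_eq_square)
  qed
  finally show "- \<i> * (-1) ^ j * dcoeff (k 3) (Suc (t3 + j)) * (- \<i> * (-1) ^ Suc j * dcoeff (k 1) (Suc (n - t3) - Suc j))
      = E_phi d \<alpha> \<beta>' \<nu> (Suc j)" unfolding j(4) .
next
  have "\<nu> ^ 2 - \<alpha> ^ 2 - \<beta>' ^ 2 + (of_nat d + 1) ^ 2 / 4 = BI_scalar k n"
    unfolding BI_scalar_def of_nat_d by (simp add: k_t field_simps power2_eq_square)
  then show "twist sg_m1m1 perm23 (Emod d \<alpha> \<beta>' \<nu>) 2 v =
      (\<lambda>j. Xmat d \<alpha> (Ymat d \<beta>' (E_phi d \<alpha> \<beta>' \<nu>) v) j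
        + Ymat d \<beta>' (E_phi d \<alpha> \<beta>' \<nu>) (Xmat d \<alpha> v) j - BI_scalar k n * v j)" for v
    by (simp add: twist_def perm23_def sg_m1m1_def Emod_def bimod_def)
qed (use n in \<open>auto simp: twist_def perm23_def sg_m1m1_def Emod_def bimod_def\<close>)

section \<open>Irreducibility of W1, W2, W3 for k2 >= 0\<close>

lemma real_t: "1 \<le> real t1" "1 \<le> real t3" "2 * k 1 = - real t1" "2 * k 3 = - real t3" "real t1 + real t3 \<le> real n"
  using odd_pos[OF odd_t(1)] odd_pos[OF odd_t(2)] t1 t3 le by (auto simp: tval_eq_enat)

text \<open>All four forms lie outside the interval from -(d-1)/2 to (d-1)/2 in which (d+1)/2 - i
  ranges. The tightest is \<open>- \<alpha> + \<beta>' + \<nu>\<close> = -(d+1)/2 - 2 k2, where k2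
  >= 0 enters.\<close>

lemma E_generic_d:
  assumes "0 \<le> k 2"
  shows "E_generic d \<alpha> \<beta>' \<nu>"
  unfolding E_generic_def
proof (intro allI impI)
  fix i assume i: "odd i" "i \<le> d"
  have r: "1 \<le> real i" "real i \<le> real n - real t1 - real t3"
    using i of_nat_d(2) odd_pos[OF i(1)] by linarith+
  have ne: "(of_nat d + 1) / 2 - of_nat i \<noteq> z" if "(real n - real t1 - real t3 + 1) / 2 - real i \<noteq> Re z" for z
  proof
    assume "(of_nat d + 1) / 2 - of_nat i = z"
    then have "Re ((of_nat d + 1) / 2 - of_nat i) = Re z" by (rule arg_cong)
    then show False using that unfolding of_nat_d by simp
  qed
  have "(of_nat d + 1) / 2 - of_nat i \<noteq> \<alpha> + \<beta>' + \<nu>" "(of_nat d + 1) / 2 - of_nat i \<noteq> \<alpha> + \<beta>' - \<nu>"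
    "(of_nat d + 1) / 2 - of_nat i \<noteq> \<alpha> - \<beta>' + \<nu>" "(of_nat d + 1) / 2 - of_nat i \<noteq> - \<alpha> + \<beta>' + \<nu>"
    by (rule ne; use assms real_t r in \<open>simp add: field_simps\<close>; fail)+
  then show "(of_nat d + 1) / 2 - of_nat i \<notin> {\<alpha> + \<beta>' + \<nu>, \<alpha> + \<beta>' - \<nu>, \<alpha> - \<beta>' + \<nu>, - \<alpha> + \<beta>' + \<nu>}"
    by blast
qed

text \<open>A collision 2a = l - m with 1 <= m <= 2l - 1 forces 2 Re a to lie between 1 - l and l -
  1.\<close>

lemma th_distinctI:
  assumes "real l < 2 * Re a + 1 \<or> 2 * Re a < 1 - real l"
  shows "th_distinct l a"
  unfolding th_distinct_def
proof (intro allI impI notI)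
  fix m assume m: "odd m" "m < 2 * l" "2 * a = of_nat l - of_nat m"
  have "2 * Re a = real l - real m" using arg_cong[OF m(3), of Re] by simp
  moreover have "1 \<le> real m" "real m \<le> 2 * real l - 1" using odd_pos[OF m(1)] m(2) by linarith+
  ultimately show False using assms by linarith
qed

lemma bimod_twist_Vd:
  assumes "\<sigma> ` {1,2,3} = {1,2,3}" "g \<in> {1,2,3}" "v \<in> Vd l"
  shows "twist sg_id \<sigma> (bimod l a b \<phi> z) g v \<in> Vd l"
proof -
  have "\<sigma> g \<in> {1,2,3}" using assms(1,2) by blast
  from bimod_Vd[OF this assms(3)] show ?thesis by (simp add: twist_def sg_id_def)
qed

lemma W1_irreducible:
  assumes "0 \<le> k 2"
  shows "bi_irred (Vd d) (twist sg_m1m1 perm23 (Emod d \<alpha> \<beta>' \<nu>))"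
    and "bi_iso (Vd d) (twist sg_m1m1 perm23 (Emod d \<alpha> \<beta>' \<nu>))
      (Vd d) (twist sg_m11 perm_id (Emod d \<alpha> \<nu> (complex_of_real (k 2 + k 3) + (of_nat n + 1) / 2)))"
proof -
  have odd_d: "odd d" using n odd_t le by (simp add: diff_diff_left)
  have dist: "th_distinct d \<alpha>"
  proof (intro th_distinctI disjI1)
    have r: "2 * Re \<alpha> = 2 * k 1 + 2 * k 2 + real n + 1" by (simp add: field_simps)
    show "real d < 2 * Re \<alpha> + 1" unfolding of_nat_d(2) r using assms real_t by linarith
  qed
  show "bi_irred (Vd d) (twist sg_m1m1 perm23 (Emod d \<alpha> \<beta>' \<nu>))"
    by (intro bi_irred_twist Emod_irreducible odd_d E_generic_d assms dist perm_surj sg_square)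
  \<comment> \<open>E_d depends on its third parameter only through the square, so
    \<open>\<beta>'\<close> may be replaced by its negative.\<close>
  have "Emod d \<alpha> \<nu> (complex_of_real (k 2 + k 3) + (of_nat n + 1) / 2) = Emod d \<alpha> \<nu> (- \<beta>')"
    by (simp only: minus_diff_eq diff_minus_eq_add add.commute)
  also have "\<dots> = Emod d \<alpha> \<nu> \<beta>'"
    unfolding Emod_def E_phi_def[abs_def] power2_minus ..
  finally have eq: "Emod d \<alpha> \<nu> (complex_of_real (k 2 + k 3) + (of_nat n + 1) / 2) = Emod d \<alpha> \<nu> \<beta>'" .
  show "bi_iso (Vd d) (twist sg_m1m1 perm23 (Emod d \<alpha> \<beta>' \<nu>))
      (Vd d) (twist sg_m11 perm_id (Emod d \<alpha> \<nu> (complex_of_real (k 2 + k 3) + (of_nat n + 1) / 2)))"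
    unfolding eq
  \<comment> \<open>After the swap the signs of (-1,-1) sit on the generators 1 and 3, which is the
    sign automorphism (-1,1).\<close>
  proof (rule bi_iso_multiples[OF Emod_swap_iso[OF odd_d E_generic_d[OF assms] dist] Vd_csub, where s = "\<lambda>g. if g = 2 then 1 else - 1"])
    show "twist sg_id perm23 (Emod d \<alpha> \<beta>' \<nu>) g v \<in> Vd d" if "g \<in> {1,2,3}" "v \<in> Vd d" for g v
      unfolding Emod_def by (rule bimod_twist_Vd[OF perm_surj(1) that])
  qed (auto simp: twist_def sg_id_def sg_m1m1_def sg_m11_def perm23_def perm_id_def)
qed

text \<open>As for \<open>E_generic_d\<close>: t1 + t3 <= n and k2 >= 0 keep the four forms outside
  the range of t3/2 - i.\<close>

lemma O_generic_t3:
  assumes "0 \<le> k 2"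
  shows "O_generic (t3 - 1) (of_real (k 2)) \<mu> (of_real (k 1))"
  unfolding O_generic_def
proof (intro allI impI)
  fix i assume i: "even i" "1 \<le> i" "i \<le> t3 - 1"
  have r: "1 \<le> real i" "real i \<le> real t3 - 1" using i by linarith+
  have ne: "(of_nat (t3 - 1) + 1) / 2 - of_nat i \<noteq> z" if "real t3 / 2 - real i \<noteq> Re z" for z
  proof
    assume "(of_nat (t3 - 1) + 1) / 2 - of_nat i = z"
    then have "Re ((of_nat (t3 - 1) + 1) / 2 - of_nat i) = Re z" by (rule arg_cong)
    then show False using that unfolding of_nat_t by simp
  qed
  let ?a = "complex_of_real (k 2)" and ?c = "complex_of_real (k 1)"
  have "(of_nat (t3 - 1) + 1) / 2 - of_nat i \<noteq> ?a + \<mu> + ?c" "(of_nat (t3 - 1) + 1) / 2 - of_nat i \<noteq> - ?a - \<mu> + ?c"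
    "(of_nat (t3 - 1) + 1) / 2 - of_nat i \<noteq> - ?a + \<mu> - ?c" "(of_nat (t3 - 1) + 1) / 2 - of_nat i \<noteq> ?a - \<mu> - ?c"
    by (rule ne; use assms real_t r in \<open>simp add: field_simps\<close>; fail)+
  then show "(of_nat (t3 - 1) + 1) / 2 - of_nat i \<notin> {?a + \<mu> + ?c, - ?a - \<mu> + ?c, - ?a + \<mu> - ?c, ?a - \<mu> - ?c}"
    by blast
qed

lemma O_generic_t1:
  assumes "0 \<le> k 2"
  shows "O_generic (t1 - 1) (of_real (k 2)) \<mu> (of_real (k 3))"
  unfolding O_generic_def
proof (intro allI impI)
  fix i assume i: "even i" "1 \<le> i" "i \<le> t1 - 1"
  have r: "1 \<le> real i" "real i \<le> real t1 - 1" using i by linarith+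
  have ne: "(of_nat (t1 - 1) + 1) / 2 - of_nat i \<noteq> z" if "real t1 / 2 - real i \<noteq> Re z" for z
  proof
    assume "(of_nat (t1 - 1) + 1) / 2 - of_nat i = z"
    then have "Re ((of_nat (t1 - 1) + 1) / 2 - of_nat i) = Re z" by (rule arg_cong)
    then show False using that unfolding of_nat_t by simp
  qed
  let ?a = "complex_of_real (k 2)" and ?c = "complex_of_real (k 3)"
  have "(of_nat (t1 - 1) + 1) / 2 - of_nat i \<noteq> ?a + \<mu> + ?c" "(of_nat (t1 - 1) + 1) / 2 - of_nat i \<noteq> - ?a - \<mu> + ?c"
    "(of_nat (t1 - 1) + 1) / 2 - of_nat i \<noteq> - ?a + \<mu> - ?c" "(of_nat (t1 - 1) + 1) / 2 - of_nat i \<noteq> ?a - \<mu> - ?c"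
    by (rule ne; use assms real_t r in \<open>simp add: field_simps\<close>; fail)+
  then show "(of_nat (t1 - 1) + 1) / 2 - of_nat i \<notin> {?a + \<mu> + ?c, - ?a - \<mu> + ?c, - ?a + \<mu> - ?c, ?a - \<mu> - ?c}"
    by blast
qed

text \<open>Here 2 \<open>\<mu>\<close> <= t1 + t3 - 2n - 2 <= -n - 2, which lies to the left of
  every possible collision.\<close>

lemma th_distinct_mu:
  assumes "0 \<le> k 2"
  shows "th_distinct (t1 - 1) \<mu>" "th_distinct (t3 - 1) \<mu>"
proof -
  have "real (t1 - 1) = real t1 - 1" "real (t3 - 1) = real t3 - 1"
    using real_t by (simp_all add: of_nat_diff)
  then show "th_distinct (t1 - 1) \<mu>" "th_distinct (t3 - 1) \<mu>"
    using assms real_t by (intro th_distinctI disjI2; simp)+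
qed

text \<open>The rotated module has \<open>\<mu>\<close> as parameter of its X, whose eigenvalues are
  distinct; irreducibility is pulled back along the isomorphism.\<close>

lemma W3_irreducible:
  assumes "0 \<le> k 2"
  shows "bi_irred (Vd (t1 - 1)) (twist sg_id perm123 (Omod (t1 - 1) (of_real (k 2)) \<mu> (of_real (k 3))))"
    and "bi_iso (Vd (t1 - 1)) (twist sg_id perm123 (Omod (t1 - 1) (of_real (k 2)) \<mu> (of_real (k 3))))
      (Vd (t1 - 1)) (Omod (t1 - 1) \<mu> (of_real (k 3)) (of_real (k 2)))"
proof -
  have ev: "even (t1 - 1)" using odd_t by simp
  show iso: "bi_iso (Vd (t1 - 1)) (twist sg_id perm123 (Omod (t1 - 1) (of_real (k 2)) \<mu> (of_real (k 3))))
      (Vd (t1 - 1)) (Omod (t1 - 1) \<mu> (of_real (k 3)) (of_real (k 2)))"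
    by (rule Omod_rotate_iso[OF ev O_generic_t1[OF assms] th_distinct_mu(1)[OF assms]])
  show "bi_irred (Vd (t1 - 1)) (twist sg_id perm123 (Omod (t1 - 1) (of_real (k 2)) \<mu> (of_real (k 3))))"
    by (rule bi_irred_transfer[OF iso Omod_irreducible[OF ev O_generic_perm[OF O_generic_t1[OF assms]] th_distinct_mu(1)[OF assms]] Vd_csub])
qed

text \<open>The eigenvalues for the parameter k2 may coincide when 2 k2 is a small odd integer.
  Irreducibility therefore comes from the rotated module with first parameter \<open>\<mu>\<close>,
  and passes to the other twists because renaming generators does not change the submodules.\<close>

lemma W2_irreducible:
  assumes "0 \<le> k 2"
  shows "bi_irred (Vd (t3 - 1)) (twist sg_id perm23 (Omod (t3 - 1) (of_real (k 2)) \<mu> (of_real (k 1))))"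
    and "bi_iso (Vd (t3 - 1)) (twist sg_id perm23 (Omod (t3 - 1) (of_real (k 2)) \<mu> (of_real (k 1))))
      (Vd (t3 - 1)) (Omod (t3 - 1) (of_real (k 2)) (of_real (k 1)) \<mu>)"
proof -
  let ?O = "Omod (t3 - 1) (of_real (k 2)) \<mu> (of_real (k 1))"
  have ev: "even (t3 - 1)" using odd_t by simp
  have iso: "bi_iso (Vd (t3 - 1)) (twist sg_id perm123 ?O) (Vd (t3 - 1)) (Omod (t3 - 1) \<mu> (of_real (k 1)) (of_real (k 2)))"
    by (rule Omod_rotate_iso[OF ev O_generic_t3[OF assms] th_distinct_mu(2)[OF assms]])
  have "bi_irred (Vd (t3 - 1)) (twist sg_id perm123 ?O)"
    by (rule bi_irred_transfer[OF iso Omod_irreducible[OF ev O_generic_perm[OF O_generic_t3[OF assms]] th_distinct_mu(2)[OF assms]] Vd_csub])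
  then have irr: "bi_irred (Vd (t3 - 1)) ?O"
  proof (rule bi_irred_multiples)
    fix g :: nat assume "g \<in> {1,2,3}"
    then have "perm123 g \<in> {1,2,3}" using perm_surj(2) by blast
    moreover have "twist sg_id perm123 ?O g v = (\<lambda>x. 1 * ?O (perm123 g) v x)" for v
      by (simp add: twist_def sg_id_def)
    ultimately show "\<exists>h\<in>{1,2,3}. \<exists>s. \<forall>v\<in>Vd (t3 - 1). twist sg_id perm123 ?O g v = (\<lambda>x. s * ?O h v x)"
      by blast
  qed
  show "bi_irred (Vd (t3 - 1)) (twist sg_id perm23 ?O)"
    by (intro bi_irred_twist irr perm_surj sg_square)
  show "bi_iso (Vd (t3 - 1)) (twist sg_id perm23 ?O) (Vd (t3 - 1)) (Omod (t3 - 1) (of_real (k 2)) (of_real (k 1)) \<mu>)"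
    by (rule Omod_swap_iso[OF ev irr])
qed

end

theorem theorem8p5:
  fixes k1 k2 k3 :: real and n t1 t3 :: nat
  assumes "odd n"
    and "tval k1 = enat t1" and "tval k3 = enat t3"
    and "t1 + t3 \<le> n" and "enat n < tval k2"
  shows
   "bi_iso (Mx (kf k1 k2 k3) 1 n \<inter> Mx (kf k1 k2 k3) 3 n) (BIops (kf k1 k2 k3))
      (dcar (n - t1 - t3))
      (dirsum (twist sg_m1m1 perm23 (Emod (n - t1 - t3)
          (of_real (k1 + k2) + (of_nat n + 1) / 2) (- of_real (k2 + k3) - (of_nat n + 1) / 2) ((of_nat n + 1) / 2))))
  \<and> bi_quot_iso (Mx (kf k1 k2 k3) 1 n) (Mx (kf k1 k2 k3) 1 n \<inter> Mx (kf k1 k2 k3) 3 n) (BIops (kf k1 k2 k3))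
      (dcar (t3 - 1))
      (dirsum (twist sg_id perm23 (Omod (t3 - 1) (of_real k2) (- of_real (k1 + k2 + k3) - of_nat n - 1) (of_real k1))))
  \<and> bi_quot_iso (Mn (kf k1 k2 k3) n) (Mx (kf k1 k2 k3) 3 n) (BIops (kf k1 k2 k3))
      (dcar (t3 - 1))
      (dirsum (twist sg_id perm23 (Omod (t3 - 1) (of_real k2) (- of_real (k1 + k2 + k3) - of_nat n - 1) (of_real k1))))
  \<and> bi_quot_iso (Mx (kf k1 k2 k3) 3 n) (Mx (kf k1 k2 k3) 1 n \<inter> Mx (kf k1 k2 k3) 3 n) (BIops (kf k1 k2 k3))
      (dcar (t1 - 1))
      (dirsum (twist sg_id perm123 (Omod (t1 - 1) (of_real k2) (- of_real (k1 + k2 + k3) - of_nat n - 1) (of_real k3))))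
  \<and> bi_quot_iso (Mn (kf k1 k2 k3) n) (Mx (kf k1 k2 k3) 1 n) (BIops (kf k1 k2 k3))
      (dcar (t1 - 1))
      (dirsum (twist sg_id perm123 (Omod (t1 - 1) (of_real k2) (- of_real (k1 + k2 + k3) - of_nat n - 1) (of_real k3))))
  \<and> (k2 \<ge> 0 \<longrightarrow>
      bi_irred (Vd (n - t1 - t3)) (twist sg_m1m1 perm23 (Emod (n - t1 - t3)
          (of_real (k1 + k2) + (of_nat n + 1) / 2) (- of_real (k2 + k3) - (of_nat n + 1) / 2) ((of_nat n + 1) / 2)))
    \<and> bi_irred (Vd (t3 - 1)) (twist sg_id perm23 (Omod (t3 - 1) (of_real k2) (- of_real (k1 + k2 + k3) - of_nat n - 1) (of_real k1)))
    \<and> bi_irred (Vd (t1 - 1)) (twist sg_id perm123 (Omod (t1 - 1) (of_real k2) (- of_real (k1 + k2 + k3) - of_nat n - 1) (of_real k3)))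
    \<and> bi_iso (Vd (n - t1 - t3)) (twist sg_m1m1 perm23 (Emod (n - t1 - t3)
          (of_real (k1 + k2) + (of_nat n + 1) / 2) (- of_real (k2 + k3) - (of_nat n + 1) / 2) ((of_nat n + 1) / 2)))
        (Vd (n - t1 - t3)) (twist sg_m11 perm_id (Emod (n - t1 - t3)
          (of_real (k1 + k2) + (of_nat n + 1) / 2) ((of_nat n + 1) / 2) (of_real (k2 + k3) + (of_nat n + 1) / 2)))
    \<and> bi_iso (Vd (t3 - 1)) (twist sg_id perm23 (Omod (t3 - 1) (of_real k2) (- of_real (k1 + k2 + k3) - of_nat n - 1) (of_real k1)))
        (Vd (t3 - 1)) (Omod (t3 - 1) (of_real k2) (of_real k1) (- of_real (k1 + k2 + k3) - of_nat n - 1))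
    \<and> bi_iso (Vd (t1 - 1)) (twist sg_id perm123 (Omod (t1 - 1) (of_real k2) (- of_real (k1 + k2 + k3) - of_nat n - 1) (of_real k3)))
        (Vd (t1 - 1)) (Omod (t1 - 1) (- of_real (k1 + k2 + k3) - of_nat n - 1) (of_real k3) (of_real k2)))"
proof -
  let ?k = "kf k1 k2 k3"
  have k: "?k 1 = k1" "?k 2 = k2" "?k 3 = k3" by (simp_all add: kf_def)
  interpret odd_degree ?k n t1 t3
    unfolding odd_degree_def k using assms by blast
  have "Mn ?k n \<inter> Mx ?k i n = Mx ?k i n" for i using Mx_sub by blast
  moreover have "Mx ?k 3 n \<inter> Mx ?k 1 n = Mx ?k 1 n \<inter> Mx ?k 3 n" by (rule Int_commute)
  moreover note iso_Mx13[unfolded k] quot_Mx3[of "Mn ?k n", unfolded k] quot_Mx3[of "Mx ?k 1 n", unfolded k]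
    quot_Mx1[of "Mn ?k n", unfolded k] quot_Mx1[of "Mx ?k 3 n", unfolded k]
    W1_irreducible[unfolded k] W2_irreducible[unfolded k] W3_irreducible[unfolded k]
  ultimately show ?thesis by (intro conjI impI) (simp_all only: simp_thms)
qed

end
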